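(* Let $p_1,p_2$ be integers with $\gcd(p_1,p_2)=1$. The number of eigenvalues $\lambda$ with non-zero real part (counted with algebraic multiplicity) of the 2-dimensional Euler equations on the torus linearised about the steady state with stream function $\cos(p_1x+p_2y)$ is equal to twice the number of non-zero integer lattice points $\boldsymbol{a}\in\mathbb{Z}^2$ inside the disk of radius $\sqrt{p_1^2+p_2^2}$ centred at the origin, i.e. with $0<a_1^2+a_2^2<p_1^2+p_2^2$.
   Context: The Euler equations in stream function form on $\mathbb{T}^2=[-\pi,\pi]^2$ (periodic) are $\nabla^2\Psi_t=\Psi_x(\nabla^2\Psi)_y-\Psi_y(\nabla^2\Psi)_x$. With $\psi=\cos(p_1x+p_2y)$, the linearised equation for a periodic perturbation $\phi$ is $$\nabla^2\phi_t=\psi_x(\nabla^2\phi)_y+\phi_x(\nabla^2\psi)_y-\psi_y(\nabla^2\phi)_x-\phi_y(\nabla^2\psi)_x,$$ regarded as an evolution equation for the mean-zero vorticity $\omega=\nabla^2\phi\in L^2(\mathbb{T}^2)$ ($\phi$ taken modulo constants); $\lambda$ is an eigenvalue if there is a non-zero solution $\omega\, e^{\lambda t}$. *)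

theory Defs
  imports "HOL-Analysis.Analysis"
begin

section \<open>Smooth periodic functions\<close>

text \<open>
  Class $C^n$ on the plane via iterated partial derivatives: all partial derivatives of order at
  most \<open>n\<close> exist and are (jointly) continuous.
\<close>

fun C_class :: "nat \<Rightarrow> (real \<times> real \<Rightarrow> complex) \<Rightarrow> bool" where
  "C_class 0 f \<longleftrightarrow> continuous_on UNIV f"
| "C_class (Suc n) f \<longleftrightarrow> continuous_on UNIV f \<and>
     (\<exists>fx fy. (\<forall>x y. ((\<lambda>s. f (s, y)) has_vector_derivative fx (x, y)) (at x)) \<and>
              (\<forall>x y. ((\<lambda>s. f (x, s)) has_vector_derivative fy (x, y)) (at y)) \<and>
              C_class n fx \<and> C_class n fy)"

definition periodic2 :: "(real \<times> real \<Rightarrow> complex) \<Rightarrow> bool" where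
  "periodic2 f \<longleftrightarrow> (\<forall>x y. f (x + 2 * pi, y) = f (x, y) \<and> f (x, y + 2 * pi) = f (x, y))"

lemma C_class_const: "C_class n (\<lambda>_. c)"
proof (induction n arbitrary: c)
  case (Suc n)
  show ?case
    using Suc by (auto intro!: exI[of _ "\<lambda>_. 0"] has_vector_derivative_const)
qed auto

lemma C_class_continuous: "C_class n f \<Longrightarrow> continuous_on UNIV f"
  by (cases n) auto

lemma C_class_SucD: "C_class (Suc n) f \<Longrightarrow> C_class n f"
proof (induction n arbitrary: f)
  case (Suc n)
  from Suc.prems obtain fx fy where
    "continuous_on UNIV f"
    "\<forall>x y. ((\<lambda>s. f (s, y)) has_vector_derivative fx (x, y)) (at x)"
    "\<forall>x y. ((\<lambda>s. f (x, s)) has_vector_derivative fy (x, y)) (at y)"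
    "C_class (Suc n) fx" "C_class (Suc n) fy"
    unfolding C_class.simps(2)[of "Suc n"] by blast
  with Suc.IH show ?case
    unfolding C_class.simps(2)[of n] by blast
qed auto

lemma C_class_add:
  "C_class n f \<Longrightarrow> C_class n g \<Longrightarrow> C_class n (\<lambda>z. f z + g z)"
proof (induction n arbitrary: f g)
  case (Suc n)
  obtain fx fy where f:
    "continuous_on UNIV f"
    "\<And>x y. ((\<lambda>s. f (s, y)) has_vector_derivative fx (x, y)) (at x)"
    "\<And>x y. ((\<lambda>s. f (x, s)) has_vector_derivative fy (x, y)) (at y)"
    "C_class n fx" "C_class n fy"
    using Suc.prems(1) by auto
  obtain gx gy where g:
    "continuous_on UNIV g"
    "\<And>x y. ((\<lambda>s. g (s, y)) has_vector_derivative gx (x, y)) (at x)"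
    "\<And>x y. ((\<lambda>s. g (x, s)) has_vector_derivative gy (x, y)) (at y)"
    "C_class n gx" "C_class n gy"
    using Suc.prems(2) by auto
  show ?case
    unfolding C_class.simps
    by (intro conjI exI[of _ "\<lambda>z. fx z + gx z"] exI[of _ "\<lambda>z. fy z + gy z"] allI
        has_vector_derivative_add continuous_on_add f g Suc.IH)
qed (auto intro: continuous_on_add)

lemma C_class_mult:
  "C_class n f \<Longrightarrow> C_class n g \<Longrightarrow> C_class n (\<lambda>z. f z * g z)"
proof (induction n arbitrary: f g)
  case (Suc n)
  have fg: "C_class n f" "C_class n g"
    using Suc.prems C_class_SucD by blast+
  obtain fx fy where f:
    "continuous_on UNIV f"
    "\<And>x y. ((\<lambda>s. f (s, y)) has_vector_derivative fx (x, y)) (at x)"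
    "\<And>x y. ((\<lambda>s. f (x, s)) has_vector_derivative fy (x, y)) (at y)"
    "C_class n fx" "C_class n fy"
    using Suc.prems(1) by auto
  obtain gx gy where g:
    "continuous_on UNIV g"
    "\<And>x y. ((\<lambda>s. g (s, y)) has_vector_derivative gx (x, y)) (at x)"
    "\<And>x y. ((\<lambda>s. g (x, s)) has_vector_derivative gy (x, y)) (at y)"
    "C_class n gx" "C_class n gy"
    using Suc.prems(2) by auto
  show ?case
    unfolding C_class.simps
    by (intro conjI exI[of _ "\<lambda>z. f z * gx z + fx z * g z"]
        exI[of _ "\<lambda>z. f z * gy z + fy z * g z"] allI
        has_vector_derivative_mult continuous_on_mult C_class_add f g fg Suc.IH)
qed (auto intro: continuous_on_mult)

lemma C_class_trig:
  fixes a b :: real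
  shows "C_class n (\<lambda>(x, y). c * complex_of_real (cos (a * x + b * y)))"
    and "C_class n (\<lambda>(x, y). c * complex_of_real (sin (a * x + b * y)))"
proof (induction n arbitrary: c)
  case 0
  {
    case 1
    show ?case by (auto simp: case_prod_unfold intro!: continuous_intros)
  next
    case 2
    show ?case by (auto simp: case_prod_unfold intro!: continuous_intros)
  }
next
  case (Suc n)
  {
    case 1
    show ?case
      unfolding C_class.simps
      by (intro conjI exI[of _ "\<lambda>(x, y). (- c * of_real a) * complex_of_real (sin (a * x + b * y))"]
          exI[of _ "\<lambda>(x, y). (- c * of_real b) * complex_of_real (sin (a * x + b * y))"] Suc.IH)
        (auto simp: case_prod_unfold has_vector_derivative_def scaleR_conv_of_real algebra_simps
            intro!: continuous_intros derivative_eq_intros)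
  next
    case 2
    show ?case
      unfolding C_class.simps
      by (intro conjI exI[of _ "\<lambda>(x, y). (c * of_real a) * complex_of_real (cos (a * x + b * y))"]
          exI[of _ "\<lambda>(x, y). (c * of_real b) * complex_of_real (cos (a * x + b * y))"] Suc.IH)
        (auto simp: case_prod_unfold has_vector_derivative_def scaleR_conv_of_real algebra_simps
            intro!: continuous_intros derivative_eq_intros)
  }
qed

typedef test_fun = "{f :: real \<times> real \<Rightarrow> complex. periodic2 f \<and> (\<forall>n. C_class n f)}"
  by (rule exI[of _ "\<lambda>_. 0"]) (auto simp: periodic2_def C_class_const)

setup_lifting type_definition_test_fun

lemma partials_C_class:
  assumes "\<forall>n. C_class n f"
  shows "\<forall>n. C_class n (\<lambda>(x, y). vector_derivative (\<lambda>s. f (s, y)) (at x))"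
    and "\<forall>n. C_class n (\<lambda>(x, y). vector_derivative (\<lambda>s. f (x, s)) (at y))"
proof -
  have *: "C_class n (\<lambda>(x, y). vector_derivative (\<lambda>s. f (s, y)) (at x)) \<and>
           C_class n (\<lambda>(x, y). vector_derivative (\<lambda>s. f (x, s)) (at y))" for n
  proof -
    obtain fx fy where f:
      "\<And>x y. ((\<lambda>s. f (s, y)) has_vector_derivative fx (x, y)) (at x)"
      "\<And>x y. ((\<lambda>s. f (x, s)) has_vector_derivative fy (x, y)) (at y)"
      "C_class n fx" "C_class n fy"
      using assms[rule_format, of "Suc n"] by auto
    have "(\<lambda>(x, y). vector_derivative (\<lambda>s. f (s, y)) (at x)) = fx"
      and "(\<lambda>(x, y). vector_derivative (\<lambda>s. f (x, s)) (at y)) = fy"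
      by (simp_all add: fun_eq_iff vector_derivative_at[OF f(1)] vector_derivative_at[OF f(2)])
    with f(3,4) show ?thesis by (simp only: simp_thms)
  qed
  show "\<forall>n. C_class n (\<lambda>(x, y). vector_derivative (\<lambda>s. f (s, y)) (at x))"
    and "\<forall>n. C_class n (\<lambda>(x, y). vector_derivative (\<lambda>s. f (x, s)) (at y))"
    using * by auto
qed

lemma partials_periodic:
  assumes per: "periodic2 f" and smooth: "\<forall>n. C_class n f"
  shows "periodic2 (\<lambda>(x, y). vector_derivative (\<lambda>s. f (s, y)) (at x))"
    and "periodic2 (\<lambda>(x, y). vector_derivative (\<lambda>s. f (x, s)) (at y))"
proof -
  obtain fx fy where f:
    "\<And>x y. ((\<lambda>s. f (s, y)) has_vector_derivative fx (x, y)) (at x)"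
    "\<And>x y. ((\<lambda>s. f (x, s)) has_vector_derivative fy (x, y)) (at y)"
    using smooth[rule_format, of "Suc 0"] by auto
  have per1: "f (x + 2 * pi, y) = f (x, y)" and per2: "f (x, y + 2 * pi) = f (x, y)" for x y
    using per by (auto simp: periodic2_def)
  have shift: "((\<lambda>s. s + 2 * pi) has_vector_derivative 1) (at (t::real))" for t
    by (auto intro!: derivative_eq_intros)
  have "((\<lambda>s. f (s, y)) has_vector_derivative fx (x + 2 * pi, y)) (at x)" for x y
    using vector_diff_chain_at[OF shift f(1)[of y "x + 2 * pi"]] by (simp add: o_def per1)
  then have x: "fx (x + 2 * pi, y) = fx (x, y)" for x y
    by (rule vector_derivative_unique_at) (rule f(1))
  have "((\<lambda>s. f (x, s)) has_vector_derivative fy (x, y + 2 * pi)) (at y)" for x y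
    using vector_diff_chain_at[OF shift f(2)[of x "y + 2 * pi"]] by (simp add: o_def per2)
  then have y: "fy (x, y + 2 * pi) = fy (x, y)" for x y
    by (rule vector_derivative_unique_at) (rule f(2))
  have x': "fx (x, y + 2 * pi) = fx (x, y)" for x y
    using f(1)[of "y + 2 * pi" x] unfolding per2
    by (rule vector_derivative_unique_at) (rule f(1))
  have y': "fy (x + 2 * pi, y) = fy (x, y)" for x y
    using f(2)[of "x + 2 * pi" y] unfolding per1
    by (rule vector_derivative_unique_at) (rule f(2))
  have fx: "vector_derivative (\<lambda>s. f (s, y)) (at x) = fx (x, y)"
    and fy: "vector_derivative (\<lambda>s. f (x, s)) (at y) = fy (x, y)" for x y
    by (simp_all only: vector_derivative_at[OF f(1)] vector_derivative_at[OF f(2)])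
  show "periodic2 (\<lambda>(x, y). vector_derivative (\<lambda>s. f (s, y)) (at x))"
    by (simp add: periodic2_def fx x x')
  show "periodic2 (\<lambda>(x, y). vector_derivative (\<lambda>s. f (x, s)) (at y))"
    by (simp add: periodic2_def fy y y')
qed

instantiation test_fun :: "{plus, times}"
begin

lift_definition plus_test_fun :: "test_fun \<Rightarrow> test_fun \<Rightarrow> test_fun" is "\<lambda>f g z. f z + g z"
  by (auto simp: periodic2_def intro: C_class_add)

lift_definition times_test_fun :: "test_fun \<Rightarrow> test_fun \<Rightarrow> test_fun" is "\<lambda>f g z. f z * g z"
  by (auto simp: periodic2_def intro: C_class_mult)

instance ..

end

lift_definition test_dx :: "test_fun \<Rightarrow> test_fun"
  is "\<lambda>f (x, y). vector_derivative (\<lambda>s. f (s, y)) (at x)"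
  using partials_C_class(1) partials_periodic(1) by blast

lift_definition test_dy :: "test_fun \<Rightarrow> test_fun"
  is "\<lambda>f (x, y). vector_derivative (\<lambda>s. f (x, s)) (at y)"
  using partials_C_class(2) partials_periodic(2) by blast

definition test_laplacian :: "test_fun \<Rightarrow> test_fun" where
  "test_laplacian f = test_dx (test_dx f) + test_dy (test_dy f)"

lemma trig_periodic:
  fixes a :: int
  shows "cos (of_int a * (x + 2 * pi) + r) = cos (of_int a * x + r)"
    and "cos (r + of_int a * (x + 2 * pi)) = cos (r + of_int a * x)"
proof -
  have "cos (t + 2 * pi * of_int a) = cos t" for t :: real
    by (simp add: cos_add sin_int_2pin cos_int_2pin)
  from this[of "of_int a * x + r"]
  show "cos (of_int a * (x + 2 * pi) + r) = cos (of_int a * x + r)"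
    by (simp add: algebra_simps)
  then show "cos (r + of_int a * (x + 2 * pi)) = cos (r + of_int a * x)"
    by (simp add: add.commute)
qed

text \<open>The steady stream function $\psi = \cos(p_1 x + p_2 y)$.\<close>

lift_definition steady :: "int \<Rightarrow> int \<Rightarrow> test_fun"
  is "\<lambda>p1 p2 (x, y). complex_of_real (cos (of_int p1 * x + of_int p2 * y))"
proof (intro conjI allI)
  fix p1 p2 :: int and n
  show "periodic2 (\<lambda>(x, y). complex_of_real (cos (of_int p1 * x + of_int p2 * y)))"
    by (simp add: periodic2_def trig_periodic)
  show "C_class n (\<lambda>(x, y). complex_of_real (cos (of_int p1 * x + of_int p2 * y)))"
    using C_class_trig(1)[of n 1] by simp
qed

section \<open>The space of square-integrable functions on the torus\<close>

definition torus :: "(real \<times> real) measure" where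
  "torus = restrict_space lborel ({-pi..pi} \<times> {-pi..pi})"

definition square_integrable :: "(real \<times> real \<Rightarrow> complex) \<Rightarrow> bool" where
  "square_integrable f \<longleftrightarrow> f \<in> borel_measurable torus \<and> integrable torus (\<lambda>z. (norm (f z))\<^sup>2)"

lemma square_integrable_add:
  assumes "square_integrable f" "square_integrable g"
  shows "square_integrable (\<lambda>z. f z + g z)"
proof -
  have [measurable]: "f \<in> borel_measurable torus" "g \<in> borel_measurable torus"
    using assms by (auto simp: square_integrable_def)
  have bound: "(norm (f z + g z))\<^sup>2 \<le> 2 * (norm (f z))\<^sup>2 + 2 * (norm (g z))\<^sup>2" for z
  proof -
    have "(norm (f z + g z))\<^sup>2 \<le> (norm (f z) + norm (g z))\<^sup>2"
      by (intro power_mono norm_triangle_ineq) auto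
    also have "\<dots> \<le> 2 * (norm (f z))\<^sup>2 + 2 * (norm (g z))\<^sup>2"
      using sum_squares_bound[of "norm (f z)" "norm (g z)"] by (simp add: power2_sum)
    finally show ?thesis .
  qed
  have "integrable torus (\<lambda>z. 2 * (norm (f z))\<^sup>2 + 2 * (norm (g z))\<^sup>2)"
    using assms by (auto simp: square_integrable_def)
  then have "integrable torus (\<lambda>z. (norm (f z + g z))\<^sup>2)"
    by (rule Bochner_Integration.integrable_bound) (use bound in auto)
  then show ?thesis
    by (simp add: square_integrable_def)
qed

lemma square_integrable_cmult:
  "square_integrable f \<Longrightarrow> square_integrable (\<lambda>z. c * f z)"
  by (auto simp: square_integrable_def norm_mult power_mult_distrib)

lemma square_integrable_uminus: "square_integrable f \<Longrightarrow> square_integrable (\<lambda>z. - f z)"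
  by (auto simp: square_integrable_def)

lemma square_integrable_diff:
  assumes "square_integrable f" "square_integrable g"
  shows "square_integrable (\<lambda>z. f z - g z)"
  using square_integrable_add[OF assms(1) square_integrable_uminus[OF assms(2)]] by simp

lemma square_integrable_zero: "square_integrable (\<lambda>_. 0)"
  by (simp add: square_integrable_def)

definition L2_rel :: "(real \<times> real \<Rightarrow> complex) \<Rightarrow> (real \<times> real \<Rightarrow> complex) \<Rightarrow> bool" where
  "L2_rel f g \<longleftrightarrow> square_integrable f \<and> square_integrable g \<and> (AE z in torus. f z = g z)"

text \<open>
  $L^2(\mathbb{T}^2)$: complex square-integrable functions modulo equality almost everywhere.
  Values of representatives outside the fundamental square are irrelevant.
\<close>

quotient_type L2_torus = "real \<times> real \<Rightarrow> complex" / partial: L2_rel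
proof (rule part_equivpI)
  show "\<exists>f. L2_rel f f"
    using square_integrable_zero by (auto simp: L2_rel_def)
  show "symp L2_rel"
    by (auto simp: symp_def L2_rel_def)
  show "transp L2_rel"
    unfolding transp_def L2_rel_def by (auto elim: eventually_elim2)
qed

instantiation L2_torus :: ab_group_add
begin

lift_definition zero_L2_torus :: L2_torus is "\<lambda>_. 0"
  by (simp add: L2_rel_def square_integrable_zero)

lift_definition plus_L2_torus :: "L2_torus \<Rightarrow> L2_torus \<Rightarrow> L2_torus" is "\<lambda>f g z. f z + g z"
  unfolding L2_rel_def by (auto simp: square_integrable_add)

lift_definition uminus_L2_torus :: "L2_torus \<Rightarrow> L2_torus" is "\<lambda>f z. - f z"
  unfolding L2_rel_def by (auto simp: square_integrable_uminus)

lift_definition minus_L2_torus :: "L2_torus \<Rightarrow> L2_torus \<Rightarrow> L2_torus" is "\<lambda>f g z. f z - g z"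
  unfolding L2_rel_def by (auto simp: square_integrable_diff)

instance
proof
  fix a b c :: L2_torus
  show "a + b + c = a + (b + c)"
    by transfer (simp add: L2_rel_def square_integrable_add add.assoc)
  show "a + b = b + a"
    by transfer (simp add: L2_rel_def square_integrable_add add.commute)
  show "0 + a = a"
    by transfer (simp add: L2_rel_def)
  show "- a + a = 0"
    by transfer (simp add: L2_rel_def square_integrable_zero)
  show "a - b = a + - b"
    by transfer (simp add: L2_rel_def square_integrable_diff)
qed

end

lift_definition L2_scale :: "complex \<Rightarrow> L2_torus \<Rightarrow> L2_torus" is "\<lambda>c f z. c * f z"
  unfolding L2_rel_def by (auto simp: square_integrable_cmult)

interpretation L2: vector_space L2_scale
proof
  fix a b :: complex and x y :: L2_torus
  show "L2_scale a (x + y) = L2_scale a x + L2_scale a y"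
    by transfer (simp add: L2_rel_def square_integrable_add square_integrable_cmult distrib_left)
  show "L2_scale (a + b) x = L2_scale a x + L2_scale b x"
    by transfer (simp add: L2_rel_def square_integrable_add square_integrable_cmult distrib_right)
  show "L2_scale a (L2_scale b x) = L2_scale (a * b) x"
    by transfer (simp add: L2_rel_def square_integrable_cmult mult.assoc)
  show "L2_scale 1 x = x"
    by transfer (simp add: L2_rel_def)
qed

section \<open>Periodic distributions\<close>

type_synonym distribution = "test_fun \<Rightarrow> complex"

lemma test_fun_measurable:
  assumes "C_class n f"
  shows "f \<in> borel_measurable torus"
  using borel_measurable_continuous_onI[OF C_class_continuous[OF assms]]
  by (simp add: torus_def measurable_restrict_space1)

text \<open>The regular distribution given by a function in $L^2$, without complex conjugation.\<close>

lift_definition dist_of :: "L2_torus \<Rightarrow> distribution"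
  is "\<lambda>f \<theta>. \<integral>z. f z * Rep_test_fun \<theta> z \<partial>torus"
proof
  fix f g \<theta>
  assume fg: "L2_rel f g"
  have [measurable]: "Rep_test_fun \<theta> \<in> borel_measurable torus"
    using Rep_test_fun[of \<theta>] test_fun_measurable by blast
  have [measurable]: "f \<in> borel_measurable torus" "g \<in> borel_measurable torus"
    using fg by (auto simp: L2_rel_def square_integrable_def)
  show "(\<integral>z. f z * Rep_test_fun \<theta> z \<partial>torus) = (\<integral>z. g z * Rep_test_fun \<theta> z \<partial>torus)"
    using fg by (intro integral_cong_AE) (auto simp: L2_rel_def)
qed

definition dist_dx :: "distribution \<Rightarrow> distribution" where
  "dist_dx T = (\<lambda>\<theta>. - T (test_dx \<theta>))"

definition dist_dy :: "distribution \<Rightarrow> distribution" where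
  "dist_dy T = (\<lambda>\<theta>. - T (test_dy \<theta>))"

definition dist_laplacian :: "distribution \<Rightarrow> distribution" where
  "dist_laplacian T = (\<lambda>\<theta>. dist_dx (dist_dx T) \<theta> + dist_dy (dist_dy T) \<theta>)"

definition dist_mult :: "test_fun \<Rightarrow> distribution \<Rightarrow> distribution" where
  "dist_mult m T = (\<lambda>\<theta>. T (m * \<theta>))"

section \<open>The linearised Euler equation\<close>

lift_definition L2_integral :: "L2_torus \<Rightarrow> complex" is "\<lambda>f. \<integral>z. f z \<partial>torus"
  by (rule integral_cong_AE) (auto simp: L2_rel_def square_integrable_def)

definition mean_zero :: "L2_torus \<Rightarrow> bool" where
  "mean_zero \<omega> \<longleftrightarrow> L2_integral \<omega> = 0"

text \<open>
  The right-hand side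
  $\psi_x \omega_y + \phi_x (\nabla^2\psi)_y - \psi_y \omega_x - \phi_y (\nabla^2\psi)_x$
  as a distribution, for $\omega = \nabla^2\phi$.
\<close>

definition euler_rhs :: "int \<Rightarrow> int \<Rightarrow> L2_torus \<Rightarrow> L2_torus \<Rightarrow> distribution" where
  "euler_rhs p1 p2 \<phi> \<omega> = (\<lambda>\<theta>. let \<psi> = steady p1 p2 in
       dist_mult (test_dx \<psi>) (dist_dy (dist_of \<omega>)) \<theta>
     + dist_mult (test_dy (test_laplacian \<psi>)) (dist_dx (dist_of \<phi>)) \<theta>
     - dist_mult (test_dy \<psi>) (dist_dx (dist_of \<omega>)) \<theta>
     - dist_mult (test_dx (test_laplacian \<psi>)) (dist_dy (dist_of \<phi>)) \<theta>)"

definition stream_function :: "L2_torus \<Rightarrow> L2_torus \<Rightarrow> bool" where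
  "stream_function \<phi> \<omega> \<longleftrightarrow> dist_laplacian (dist_of \<phi>) = dist_of \<omega>"

text \<open>
  Solutions of the evolution equation for the vorticity. The time derivative is taken in the sense
  of distributions, i.e. after pairing with each test function in the space variables. The stream
  function is determined by the vorticity up to a constant, on which the right-hand side does not
  depend.
\<close>

definition euler_solution :: "int \<Rightarrow> int \<Rightarrow> (real \<Rightarrow> L2_torus) \<Rightarrow> bool" where
  "euler_solution p1 p2 u \<longleftrightarrow>
     (\<forall>t. mean_zero (u t) \<and>
       (\<exists>\<phi>. stream_function \<phi> (u t) \<and>
         (\<forall>\<theta>. ((\<lambda>s. dist_of (u s) \<theta>) has_vector_derivative euler_rhs p1 p2 \<phi> (u t) \<theta>) (at t))))"

definition euler_eigenvalue :: "int \<Rightarrow> int \<Rightarrow> complex \<Rightarrow> bool" where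
  "euler_eigenvalue p1 p2 \<mu> \<longleftrightarrow>
     (\<exists>\<omega>. \<omega> \<noteq> 0 \<and> euler_solution p1 p2 (\<lambda>t. L2_scale (exp (\<mu> * of_real t)) \<omega>))"

text \<open>
  The graph of the (unbounded) linearised operator on mean-zero vorticities, with its maximal
  domain: those \<open>\<omega>\<close> for which the right-hand side of the equation is again in $L^2$.
\<close>

definition euler_op :: "int \<Rightarrow> int \<Rightarrow> L2_torus \<Rightarrow> L2_torus \<Rightarrow> bool" where
  "euler_op p1 p2 \<omega> \<eta> \<longleftrightarrow> mean_zero \<omega> \<and> mean_zero \<eta> \<and>
     (\<exists>\<phi>. stream_function \<phi> \<omega> \<and> dist_of \<eta> = euler_rhs p1 p2 \<phi> \<omega>)"

text \<open>The kernel of the \<open>n\<close>-th power of the operator minus \<open>\<mu>\<close>.\<close>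

fun euler_ker :: "int \<Rightarrow> int \<Rightarrow> complex \<Rightarrow> nat \<Rightarrow> L2_torus set" where
  "euler_ker p1 p2 \<mu> 0 = {0}"
| "euler_ker p1 p2 \<mu> (Suc n) =
     {\<omega>. \<exists>\<eta>. euler_op p1 p2 \<omega> \<eta> \<and> \<eta> - L2_scale \<mu> \<omega> \<in> euler_ker p1 p2 \<mu> n}"

definition generalised_eigenspace :: "int \<Rightarrow> int \<Rightarrow> complex \<Rightarrow> L2_torus set" where
  "generalised_eigenspace p1 p2 \<mu> = (\<Union>n. euler_ker p1 p2 \<mu> n)"

text \<open>
  Complex dimension of the generalised eigenspace. The library dimension of an
  infinite-dimensional space is \<open>0\<close>, so statements using this multiplicity should also assert
  \<open>finite_multiplicity\<close>.
\<close>

definition algebraic_multiplicity :: "int \<Rightarrow> int \<Rightarrow> complex \<Rightarrow> nat" where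
  "algebraic_multiplicity p1 p2 \<mu> = L2.dim (generalised_eigenspace p1 p2 \<mu>)"

definition finite_multiplicity :: "int \<Rightarrow> int \<Rightarrow> complex \<Rightarrow> bool" where
  "finite_multiplicity p1 p2 \<mu> \<longleftrightarrow>
     (\<exists>B. finite B \<and> generalised_eigenspace p1 p2 \<mu> \<subseteq> L2.span B)"

definition nonimaginary_eigenvalues :: "int \<Rightarrow> int \<Rightarrow> complex set" where
  "nonimaginary_eigenvalues p1 p2 = {\<mu>. euler_eigenvalue p1 p2 \<mu> \<and> Re \<mu> \<noteq> 0}"

end

theory Submission
  imports Defs
    "HOL-Computational_Algebra.Fundamental_Theorem_Algebra"
    "HOL-Library.Function_Algebras"
    "HOL-Complex_Analysis.Great_Picard"
begin

text \<open>
  In Fourier coefficients \<open>a\<close> of the vorticity the linearised equation couples only lattice points that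
  differ by \<open>p\<close>. With the weight \<open>rho p k = 1 - |p|^2/|k|^2\<close> and the cross product \<open>p \<times> k\<close>, the operator is
  \<open>(L a) k = (p \<times> k)/2 * (rho (k + p) * a (k + p) - rho (k - p) * a (k - p))\<close>; it is \<open>lat_op p\<close>, and
  \<open>euler_op_iff\<close> identifies it with the Euler operator. Hence \<open>L\<close> is a skew-symmetric operator
  composed with multiplication by \<open>rho\<close>, and it is skew for the indefinite Hermitian form
  \<open>B x y = (\<Sum>k. rho k * x k * cnj (y k))\<close>. The weight is negative exactly on the lattice points of
  the punctured disk, \<open>disk p\<close>. The theorem says that each negative direction of \<open>B\<close> produces one
  eigenvalue in either open half-plane.

  At most \<open>card (disk p)\<close> (\<open>unstable_vanishing_on_disk\<close>): skewness makes \<open>B\<close> vanish on the span of the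
  generalised eigenspaces of one half-plane, even on each line \<open>k + \<int> p\<close> separately. An element of
  this span that is zero on the disk is then annihilated by \<open>rho\<close> off the line \<open>\<int> p\<close>, hence by \<open>L\<close>, and an eigenvector
  for \<open>0\<close> cannot lie in the span. So the coordinates on the disk determine the element.

  At least \<open>card (disk p)\<close> (\<open>unstable_flag_exists\<close>): restrict \<open>L\<close> to a finite box and subtract
  \<open>\<epsilon> * rho\<close>. The result is strictly dissipative for \<open>B\<close>, and a Lyapunov argument in finite dimension
  yields a flag of \<open>card (disk p)\<close> vectors, invariant and with diagonal entries in the open right
  half-plane (\<open>orthonormal_unstable_flag\<close>). Since \<open>B\<close> is nonpositive on the flag, the coordinates on the
  disk bound all others uniformly, and a limit exists as the box exhausts the lattice and \<open>\<epsilon>\<close> tends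
  to \<open>0\<close> (\<open>flag_limit_exists\<close>). The limit can lose the equations at zeros of \<open>rho\<close>, which one more
  application of \<open>L\<close> restores, and the strict inequality \<open>Re > 0\<close>. For the latter it remains to exclude
  square-summable eigenvectors with imaginary eigenvalue that vanish on the line \<open>\<int> p\<close>.

  This is \<open>no_neutral_mode\<close>. On a line \<open>k + \<int> p\<close> such a vector becomes a decaying solution of
  \<open>\<mu> * g n = (1 - 1/((n - t)^2 + h)) * (g (n + 1) + g (n - 1))\<close> with real \<open>\<mu>\<close> and \<open>h > 0\<close>, which must vanish
  (\<open>neutral_chain_trivial\<close>). For \<open>|\<mu>| < 2\<close> the recurrence is a summable perturbation of an
  oscillating one and has no decaying solution but \<open>0\<close>. For \<open>\<mu> \<ge> 2\<close> the solution has a constant sign on each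
  half-line; it is compared with the explicit solution \<open>z^n * (\<kappa> + 1/(n + t))\<close> of the case \<open>h = 0\<close>,
  and the resulting bounds are incompatible with the equations at the two points next to the centre.
  An alternating sign exchanges \<open>\<mu>\<close> and \<open>- \<mu>\<close>.

  Coprimality of \<open>p1\<close> and \<open>p2\<close> enters because it keeps the line \<open>\<int> p\<close>, on which \<open>L\<close> vanishes, away from
  the disk. The dictionary between functions and coefficients needs that Fourier coefficients
  determine an integrable function (\<open>fourier_uniqueness\<close>, from the Stone-Weierstrass theorem) and
  that every square-summable family occurs (\<open>riesz_fischer\<close>).
\<close>

section \<open>Operators dissipative for an indefinite Hermitian form\<close>

locale complex_vector_space = vector_space scale
  for scale :: "complex \<Rightarrow> 'v::ab_group_add \<Rightarrow> 'v" (infixr "*c" 75)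
begin

abbreviation operator :: "('v \<Rightarrow> 'v) \<Rightarrow> bool" where
  "operator \<equiv> Vector_Spaces.linear scale scale"

lemma operatorI:
  assumes "\<And>x y. L (x + y) = L x + L y" "\<And>c x. L (c *c x) = c *c L x"
  shows "operator L"
  unfolding linear_iff_module_hom module_hom_def module_hom_axioms_def
  using assms module_axioms by auto

lemma
  assumes "operator L"
  shows operator_add: "L (x + y) = L x + L y"
    and operator_scale: "L (c *c x) = c *c L x"
    and operator_diff: "L (x - y) = L x - L y"
    and operator_zero: "L 0 = 0"
    and operator_sum: "L (sum f A) = (\<Sum>a\<in>A. L (f a))"
  using assms unfolding linear_iff_module_hom
  by (simp_all add: module_hom.add module_hom.scale module_hom.diff module_hom.zero module_hom.sum)

lemma operator_maps_span:
  assumes "operator L" "\<And>b. b \<in> B \<Longrightarrow> L b \<in> T" "subspace T" "x \<in> span B"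
  shows "L x \<in> T"
  using assms(4)
proof (induction rule: span_induct_alt)
  case base
  then show ?case using assms by (simp add: operator_zero subspace_0)
next
  case (step c x y)
  then show ?case
    using assms by (simp add: operator_add operator_scale subspace_add subspace_scale)
qed

text \<open>
  Horner evaluation of the vector \<open>q(L) x\<close>; powers of \<open>L\<close> are never formed.
\<close>

definition orbit_poly :: "('v \<Rightarrow> 'v) \<Rightarrow> 'v \<Rightarrow> complex poly \<Rightarrow> 'v" where
  "orbit_poly L x q = fold_coeffs (\<lambda>a y. a *c x + L y) q 0"

lemma orbit_poly_0: "orbit_poly L x 0 = 0"
  by (simp add: orbit_poly_def)

lemma orbit_poly_pCons:
  assumes "operator L"
  shows "orbit_poly L x (pCons a q) = a *c x + L (orbit_poly L x q)"
  using operator_zero[OF assms]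
  by (cases "a = 0 \<and> q = 0") (auto simp: orbit_poly_def fold_coeffs_pCons_not_0_0_eq)

lemma orbit_poly_add:
  assumes "operator L"
  shows "orbit_poly L x (q + r) = orbit_poly L x q + orbit_poly L x r"
  by (induction q r rule: poly_induct2)
     (auto simp: orbit_poly_0 orbit_poly_pCons[OF assms] operator_add[OF assms] scale_left_distrib)

lemma orbit_poly_smult:
  assumes "operator L"
  shows "orbit_poly L x (smult c q) = c *c orbit_poly L x q"
  by (induction q)
     (auto simp: orbit_poly_0 orbit_poly_pCons[OF assms] operator_scale[OF assms] scale_right_distrib)

lemma orbit_poly_sum:
  assumes "operator L"
  shows "orbit_poly L x (sum f A) = (\<Sum>a\<in>A. orbit_poly L x (f a))"
  by (induction A rule: infinite_finite_induct)
     (auto simp: orbit_poly_0 orbit_poly_add[OF assms])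

lemma orbit_poly_linear_factor:
  assumes "operator L"
  shows "orbit_poly L x ([:- a, 1:] * q) = L (orbit_poly L x q) - a *c orbit_poly L x q"
proof -
  have "[:- a, 1:] * q = smult (- a) q + pCons 0 q" by simp
  then show ?thesis
    by (simp only: orbit_poly_add[OF assms] orbit_poly_smult[OF assms] orbit_poly_pCons[OF assms]) simp
qed

lemma orbit_poly_in:
  assumes "operator L" "subspace V" "\<And>y. y \<in> V \<Longrightarrow> L y \<in> V" "x \<in> V"
  shows "orbit_poly L x q \<in> V"
  by (induction q) (auto simp: orbit_poly_0 orbit_poly_pCons[OF assms(1)] assms
      intro!: subspace_0 subspace_add subspace_scale)

text \<open>
  The vectors \<open>x, L x, L^2 x, \<dots>\<close> lie in a finite-dimensional space, so finitely many of them are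
  linearly dependent.
\<close>

lemma annihilating_poly_exists:
  assumes "operator L" "subspace V" "\<And>y. y \<in> V \<Longrightarrow> L y \<in> V" "x \<in> V" "finite S" "V \<subseteq> span S"
  shows "\<exists>q. q \<noteq> 0 \<and> orbit_poly L x q = 0"
proof -
  define v where "v i = orbit_poly L x (monom 1 i)" for i :: nat
  have vV: "v i \<in> span S" for i
    using orbit_poly_in[OF assms(1-4)] assms(6) by (auto simp: v_def)
  let ?I = "{..card S}"
  show ?thesis
  proof (cases "inj_on v ?I")
    case False
    then obtain i j where "i \<noteq> j" "v i = v j" by (auto simp: inj_on_def)
    have "orbit_poly L x (monom 1 i + smult (-1) (monom 1 j)) = 0"
      unfolding orbit_poly_add[OF assms(1)] orbit_poly_smult[OF assms(1)]
      using \<open>v i = v j\<close> by (simp add: v_def)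
    moreover have "coeff (monom 1 i + smult (-1) (monom 1 j) :: complex poly) i \<noteq> 0"
      using \<open>i \<noteq> j\<close> by simp
    ultimately show ?thesis by (metis coeff_0)
  next
    case True
    have "dependent (v ` ?I)"
    proof (rule ccontr)
      assume "independent (v ` ?I)"
      then have "card (v ` ?I) \<le> card S"
        using independent_span_bound[of S "v ` ?I"] assms(5) vV by auto
      then show False using card_image[OF True] by simp
    qed
    then obtain u y where u: "y \<in> v ` ?I" "u y \<noteq> 0" "(\<Sum>y\<in>v ` ?I. u y *c y) = 0"
      by (auto simp: dependent_finite)
    then obtain i where i: "i \<in> ?I" "u (v i) \<noteq> 0" by auto
    define q where "q = (\<Sum>i\<in>?I. smult (u (v i)) (monom 1 i))"
    have "orbit_poly L x q = (\<Sum>i\<in>?I. u (v i) *c v i)"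
      by (simp add: q_def orbit_poly_sum[OF assms(1)] orbit_poly_smult[OF assms(1)] v_def)
    also have "\<dots> = 0"
      using u(3) by (simp add: sum.reindex[OF True])
    finally have "orbit_poly L x q = 0" .
    moreover have "coeff q i = u (v i)"
      using i(1) by (simp add: q_def coeff_sum sum.delta if_distrib cong: if_cong)
    ultimately show ?thesis using i(2) by (metis coeff_0)
  qed
qed

text \<open>
  An annihilating polynomial of least degree has a root \<open>a\<close>; splitting off the corresponding linear
  factor leaves a vector that is nonzero by minimality and is killed by \<open>L - a\<close>.
\<close>

lemma eigenvector_exists:
  assumes "operator L" "subspace V" "\<And>y. y \<in> V \<Longrightarrow> L y \<in> V" "x \<in> V" "x \<noteq> 0"
    "finite S" "V \<subseteq> span S"
  obtains e a where "e \<in> V" "e \<noteq> 0" "L e = a *c e"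
proof -
  obtain q where q: "q \<noteq> 0" "orbit_poly L x q = 0"
    and minimal: "\<And>r. r \<noteq> 0 \<Longrightarrow> orbit_poly L x r = 0 \<Longrightarrow> degree q \<le> degree r"
    using annihilating_poly_exists[OF assms(1-4,6,7)]
      exists_least_iff[of "\<lambda>n. \<exists>q. q \<noteq> 0 \<and> orbit_poly L x q = 0 \<and> degree q = n"]
    by (metis not_less)
  have "\<not> constant (poly q)"
  proof
    assume "constant (poly q)"
    then have "degree q = 0" by (simp add: constant_degree)
    then obtain c where c: "q = [:c:]" by (rule degree_eq_zeroE)
    then have "c *c x = 0"
      using q(2) by (simp add: orbit_poly_pCons[OF assms(1)] orbit_poly_0 operator_zero[OF assms(1)])
    then show False using q(1) c assms(5) by auto
  qed
  from Fundamental_Theorem_Algebra.fundamental_theorem_of_algebra[OF this] obtain a where "poly q a = 0" ..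
  then obtain r where r: "q = [:- a, 1:] * r"
    unfolding poly_eq_0_iff_dvd by (rule dvdE)
  have "r \<noteq> 0" using q(1) r by auto
  then have "degree q = Suc (degree r)"
    unfolding r by (subst degree_mult_eq) auto
  then have "orbit_poly L x r \<noteq> 0"
    using minimal[OF \<open>r \<noteq> 0\<close>] by auto
  moreover have "L (orbit_poly L x r) = a *c orbit_poly L x r"
    using q(2) unfolding r orbit_poly_linear_factor[OF assms(1)] by simp
  moreover have "orbit_poly L x r \<in> V"
    using orbit_poly_in[OF assms(1-4)] .
  ultimately show ?thesis using that by blast
qed


definition hermitian :: "('v \<Rightarrow> 'v \<Rightarrow> complex) \<Rightarrow> bool" where
  "hermitian B \<longleftrightarrow> (\<forall>x y z. B (x + y) z = B x z + B y z) \<and>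
     (\<forall>c x y. B (c *c x) y = c * B x y) \<and> (\<forall>x y. B y x = cnj (B x y))"

lemma
  assumes "hermitian B"
  shows herm_add_left: "B (x + y) z = B x z + B y z"
    and herm_scale_left: "B (c *c x) y = c * B x y"
    and herm_sym: "B y x = cnj (B x y)"
    and herm_add_right: "B z (x + y) = B z x + B z y"
    and herm_scale_right: "B x (c *c y) = cnj c * B x y"
proof -
  show l: "B (x + y) z = B x z + B y z" "B (c *c x) y = c * B x y" and s: "B y x = cnj (B x y)"
    for x y z c using assms unfolding hermitian_def by blast+
  show "B z (x + y) = B z x + B z y"
    unfolding s[where y = z] l by simp
  show "B x (c *c y) = cnj c * B x y"
    unfolding s[where x = "c *c y"] l complex_cnj_mult by (simp add: s[where x = y and y = x])
qed

lemma
  assumes "hermitian B"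
  shows herm_zero_left: "B 0 y = 0" and herm_zero_right: "B y 0 = 0"
    and herm_diff_left: "B (x - z) y = B x y - B z y"
    and herm_Im: "Im (B x x) = 0"
proof -
  show z: "B 0 y = 0" "B y 0 = 0" for y
    using herm_scale_left[OF assms, of 0] herm_scale_right[OF assms, of y 0] by auto
  show "B (x - z) y = B x y - B z y"
    using herm_add_left[OF assms, of "x - z" z y] by simp
  show "Im (B x x) = 0"
    using arg_cong[OF herm_sym[OF assms, of x x], of Im] by simp
qed

lemma herm_sum_left: "hermitian B \<Longrightarrow> B (sum f A) y = (\<Sum>a\<in>A. B (f a) y)"
  by (induction A rule: infinite_finite_induct) (auto simp: herm_zero_left herm_add_left)

lemma herm_Re_scale: "hermitian B \<Longrightarrow> Re (c * B x x) = Re c * Re (B x x)"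
  by (simp add: herm_Im)

text \<open>
  With \<open>z = e\<close> and \<open>k = B e e\<close> this is the \<open>B\<close>-orthogonal projection along \<open>e\<close>.
\<close>

lemma operator_projection:
  assumes "hermitian B"
  shows "operator (\<lambda>y. y - (B y e / k) *c z)"
proof (rule operatorI)
  fix x y c
  show "x + y - (B (x + y) e / k) *c z = x - (B x e / k) *c z + (y - (B y e / k) *c z)"
    by (simp only: herm_add_left[OF assms] add_divide_distrib scale_left_distrib) simp
  show "c *c x - (B (c *c x) e / k) *c z = c *c (x - (B x e / k) *c z)"
    by (simp only: herm_scale_left[OF assms] scale_right_diff_distrib scale_scale) simp
qed

lemma operator_compose: "operator L \<Longrightarrow> operator M \<Longrightarrow> operator (\<lambda>x. M (L x))"
  by (rule operatorI) (simp_all add: operator_add operator_scale)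

lemma subspace_hyperplane:
  assumes "hermitian B" "subspace V"
  shows "subspace {y \<in> V. B y e = 0}"
proof (rule subspaceI)
  show "0 \<in> {y \<in> V. B y e = 0}"
    using assms by (simp add: subspace_0 herm_zero_left)
  show "x + y \<in> {y \<in> V. B y e = 0}" if "x \<in> {y \<in> V. B y e = 0}" "y \<in> {y \<in> V. B y e = 0}" for x y
    using that assms by (simp add: subspace_add herm_add_left)
  show "c *c x \<in> {y \<in> V. B y e = 0}" if "x \<in> {y \<in> V. B y e = 0}" for c x
    using that assms by (simp add: subspace_scale herm_scale_left)
qed

text \<open>
  Dissipativity forces \<open>Re a * B e e < 0\<close> for every eigenvector, so the sign of \<open>B e e\<close> decides in which
  half-plane the eigenvalue lies. If a chosen eigenvector \<open>e\<close> is positive, compress \<open>L\<close> to the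
  \<open>B\<close>-orthogonal complement of \<open>e\<close>: the compression is again dissipative, the nonpositive vector
  survives the projection, and an unstable eigenvector of the compression lifts back to one of \<open>L\<close>.
\<close>

lemma dissipative_unstable_eigenvector:
  assumes B: "hermitian B" and S: "finite S" "V \<subseteq> span S"
    and L: "operator L" and V: "subspace V" "\<And>y. y \<in> V \<Longrightarrow> L y \<in> V"
    and dissipative: "\<And>y. y \<in> V \<Longrightarrow> y \<noteq> 0 \<Longrightarrow> Re (B (L y) y) < 0"
    and x: "x \<in> V" "x \<noteq> 0" "Re (B x x) \<le> 0"
  shows "\<exists>e a. e \<in> V \<and> e \<noteq> 0 \<and> L e = a *c e \<and> Re (B e e) < 0 \<and> Re a > 0"
  using S L V dissipative x
proof (induction k \<equiv> "card S" arbitrary: S V L x rule: less_induct)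
  case less
  note L = \<open>operator L\<close> and V = \<open>subspace V\<close>
  note inv = less.prems(5) and diss = less.prems(6)
  have eigen: "Re a * Re (B e e) < 0" if "e \<in> V" "e \<noteq> 0" "L e = a *c e" for a e
    using diss[OF that(1,2)] unfolding that(3) herm_scale_left[OF B] herm_Re_scale[OF B] .
  obtain e a where e: "e \<in> V" "e \<noteq> 0" "L e = a *c e"
    using eigenvector_exists[OF L V inv less.prems(7,8,1,2)] by blast
  show ?case
  proof (cases "Re (B e e) < 0")
    case True
    then show ?thesis using e eigen[OF e] by (auto simp: mult_less_0_iff)
  next
    case False
    then have pos: "Re (B e e) > 0" and a: "Re a < 0"
      using eigen[OF e] by (auto simp: mult_less_0_iff)
    then have ne: "B e e \<noteq> 0" by auto
    define P where "P y = y - (B y e / B e e) *c e" for y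
    have P0: "B (P y) e = 0" for y
      using ne by (simp add: P_def herm_diff_left[OF B] herm_scale_left[OF B])
    have PV: "P y \<in> V" if "y \<in> V" for y
      unfolding P_def using that e(1) V by (intro subspace_diff subspace_scale)
    define V' where "V' = {y \<in> V. B y e = 0}"
    have V': "subspace V'"
      unfolding V'_def by (rule subspace_hyperplane[OF B V])
    obtain D where D: "D \<subseteq> V'" "independent D" "V' \<subseteq> span D" "card D = dim V'"
      using basis_exists[of V'] by metis
    have "e \<notin> span D"
      using span_minimal[OF D(1) V'] ne by (auto simp: V'_def)
    then have "independent (insert e D)" and "e \<notin> D"
      using D(2) independent_insertI span_base by blast+
    moreover have "insert e D \<subseteq> span S"
      using D(1) e less.prems(2) by (auto simp: V'_def)
    ultimately have D': "finite D" "card D < card S"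
      using independent_span_bound[OF less.prems(1), of "insert e D"] by auto
    have L': "operator (\<lambda>y. P (L y))"
      unfolding P_def by (rule operator_compose[OF L operator_projection[OF B]])
    define al where "al = B x e / B e e"
    have xP: "x = P x + al *c e" by (simp add: P_def al_def)
    have eP: "B e (P x) = 0" using herm_sym[OF B, of "P x" e] P0 by simp
    have "B x x = B (P x) (P x) + al * cnj al * B e e"
      by (subst (1 2) xP)
         (simp add: herm_add_left[OF B] herm_add_right[OF B] herm_scale_left[OF B]
          herm_scale_right[OF B] P0 eP)
    then have Bx: "Re (B x x) = Re (B (P x) (P x)) + (cmod al)\<^sup>2 * Re (B e e)"
      unfolding complex_norm_square[symmetric] by simp
    have Px: "P x \<noteq> 0"
    proof
      assume z: "P x = 0"
      then have "(cmod al)\<^sup>2 * Re (B e e) \<le> 0"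
        using Bx less.prems(9) by (simp add: herm_zero_left[OF B])
      then have "al = 0" using pos by (simp add: mult_le_0_iff)
      then show False using xP z less.prems(8) by simp
    qed
    have "(cmod al)\<^sup>2 * Re (B e e) \<ge> 0" using pos by simp
    then have PxB: "Re (B (P x) (P x)) \<le> 0" using Bx less.prems(9) by linarith
    have "\<exists>e' b. e' \<in> V' \<and> e' \<noteq> 0 \<and> P (L e') = b *c e' \<and> Re (B e' e') < 0 \<and> Re b > 0"
    proof (rule less.hyps[OF D'(2) D'(1) D(3) L' V' _ _ _ Px PxB])
      show "P (L y) \<in> V'" if "y \<in> V'" for y
        using that PV inv P0 by (auto simp: V'_def)
      show "P x \<in> V'" using PV less.prems(7) P0 by (auto simp: V'_def)
      fix y assume y: "y \<in> V'" "y \<noteq> 0"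
      then have "B e y = 0" using herm_sym[OF B, of y e] by (auto simp: V'_def)
      then have "B (P (L y)) y = B (L y) y"
        by (simp add: P_def herm_diff_left[OF B] herm_scale_left[OF B])
      then show "Re (B (P (L y)) y) < 0" using diss y by (auto simp: V'_def)
    qed
    then obtain e' b where e': "e' \<in> V" "B e' e = 0" "e' \<noteq> 0" "P (L e') = b *c e'" "Re b > 0"
      by (auto simp: V'_def)
    define c where "c = B (L e') e / B e e"
    have Le': "L e' = b *c e' + c *c e" using e'(4) by (simp add: P_def c_def algebra_simps)
    \<comment> \<open>The lift adds the multiple of \<open>e\<close> that solves \<open>c + d * a = b * d\<close>; this is possible because
      \<open>a\<close> and \<open>b\<close> lie on different sides of the imaginary axis.\<close>
    define d where "d = c / (b - a)"
    have "b \<noteq> a" using a e'(5) by auto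
    then have d: "c + d * a = b * d" by (simp add: d_def field_simps)
    have "L (e' + d *c e) = b *c e' + (c + d * a) *c e"
      by (simp add: operator_add[OF L] operator_scale[OF L] Le' e(3) scale_left_distrib add.assoc)
    then have Le'': "L (e' + d *c e) = b *c (e' + d *c e)"
      by (simp add: d scale_right_distrib)
    have V'': "e' + d *c e \<in> V" using e'(1) e(1) V by (auto intro!: subspace_add subspace_scale)
    have nz: "e' + d *c e \<noteq> 0"
    proof
      assume z: "e' + d *c e = 0"
      have "B (e' + d *c e) e = d * B e e"
        by (simp add: herm_add_left[OF B] herm_scale_left[OF B] e'(2))
      then have "d = 0" using z ne by (simp add: herm_zero_left[OF B])
      then show False using z e'(3) by simp
    qed
    show ?thesis
      using eigen[OF V'' nz Le''] V'' nz Le'' e'(5)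
      by (intro exI[of _ "e' + d *c e"] exI[of _ b]) (auto simp: mult_less_0_iff)
  qed
qed

definition triangular :: "('v \<Rightarrow> 'v) \<Rightarrow> (nat \<Rightarrow> 'v) \<Rightarrow> (nat \<Rightarrow> complex) \<Rightarrow> nat \<Rightarrow> bool" where
  "triangular L w lam n \<longleftrightarrow> (\<forall>i<n. L (w i) - lam i *c w i \<in> span (w ` {..<i}))"

lemma in_span_lessThan_iff:
  fixes n :: nat
  shows "x \<in> span (w ` {..<n}) \<longleftrightarrow> (\<exists>c. x = (\<Sum>i<n. c i *c w i))"
proof (induction n arbitrary: x)
  case (Suc n)
  have "x \<in> span (w ` {..<Suc n}) \<longleftrightarrow> (\<exists>k. x - k *c w n \<in> span (w ` {..<n}))"
    by (simp add: lessThan_Suc span_breakdown_eq)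
  also have "\<dots> \<longleftrightarrow> (\<exists>c. x = (\<Sum>i<Suc n. c i *c w i))"
  proof safe
    fix k assume "x - k *c w n \<in> span (w ` {..<n})"
    then obtain c where c: "x - k *c w n = (\<Sum>i<n. c i *c w i)" using Suc by blast
    have "x = (\<Sum>i<Suc n. (c(n := k)) i *c w i)"
      using c by (simp add: algebra_simps)
    then show "\<exists>c. x = (\<Sum>i<Suc n. c i *c w i)" by blast
  next
    fix c
    show "\<exists>k. (\<Sum>i<Suc n. c i *c w i) - k *c w n \<in> span (w ` {..<n})"
      by (rule exI[of _ "c n"]) (use Suc in auto)
  qed
  finally show ?case .
qed auto

lemma triangular_invariant:
  assumes "operator L" "triangular L w lam n" "m \<le> n" "x \<in> span (w ` {..<m})"
  shows "L x \<in> span (w ` {..<m})"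
proof (rule operator_maps_span[OF assms(1) _ subspace_span assms(4)])
  fix b assume "b \<in> w ` {..<m}"
  then obtain i where i: "i < m" "b = w i" by auto
  have "L (w i) - lam i *c w i \<in> span (w ` {..<m})"
    using assms(2,3) i(1) span_mono[of "w ` {..<i}" "w ` {..<m}"]
    by (fastforce simp: triangular_def)
  from span_add[OF this span_scale[OF span_base, of "w i" _ "lam i"]]
  show "L b \<in> span (w ` {..<m})" using i by auto
qed

text \<open>
  A triangular matrix is invertible away from its diagonal entries, by back substitution.
\<close>

lemma triangular_solve:
  assumes "operator L" "triangular L w lam n" "\<And>j. j < n \<Longrightarrow> lam j \<noteq> a" "y \<in> span (w ` {..<n})"
  shows "\<exists>z \<in> span (w ` {..<n}). L z - a *c z = y"
  using assms(2-)
proof (induction n arbitrary: y)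
  case (Suc n)
  obtain k where k: "y - k *c w n \<in> span (w ` {..<n})"
    using Suc.prems(3) by (auto simp: lessThan_Suc span_breakdown_eq)
  define d where "d = k / (lam n - a)"
  have d: "d * (lam n - a) = k" using Suc.prems(2)[of n] by (simp add: d_def)
  define r where "r = L (w n) - lam n *c w n"
  have r: "r \<in> span (w ` {..<n})" using Suc.prems(1) by (simp add: triangular_def r_def)
  have y': "(y - k *c w n) - d *c r \<in> span (w ` {..<n})"
    using span_diff[OF k span_scale[OF r]] .
  obtain z where z: "z \<in> span (w ` {..<n})" "L z - a *c z = (y - k *c w n) - d *c r"
    using Suc.IH[OF _ _ y'] Suc.prems(1,2) by (auto simp: triangular_def)
  have "L (d *c w n) - a *c (d *c w n) = k *c w n + d *c r"
    by (simp add: operator_scale[OF assms(1)] r_def d[symmetric] algebra_simps)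
  then have "L (z + d *c w n) - a *c (z + d *c w n) = y"
    using z(2) by (simp add: operator_add[OF assms(1)] scale_right_distrib algebra_simps)
  moreover have "z + d *c w n \<in> span (w ` {..<Suc n})"
    using z(1) by (auto simp: lessThan_Suc span_breakdown_eq intro!: exI[of _ d])
  ultimately show ?case by blast
qed (auto simp: operator_zero[OF assms(1)])

lemma negative_on_orthogonal_span:
  fixes n :: nat
  assumes B: "hermitian B"
    and w: "\<And>i. i < n \<Longrightarrow> Re (B (w i) (w i)) < 0"
      "\<And>i j. i < n \<Longrightarrow> j < n \<Longrightarrow> i \<noteq> j \<Longrightarrow> B (w i) (w j) = 0"
    and x: "x \<in> span (w ` {..<n})" "x \<noteq> 0"
  shows "Re (B x x) < 0"
proof -
  obtain c where c: "x = (\<Sum>i<n. c i *c w i)"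
    using x(1) unfolding in_span_lessThan_iff by blast
  have "B (w i) x = cnj (c i) * B (w i) (w i)" if "i < n" for i
  proof -
    have "B x (w i) = (\<Sum>j<n. c j * B (w j) (w i))"
      by (simp add: c herm_sum_left[OF B] herm_scale_left[OF B])
    also have "\<dots> = (\<Sum>j<n. if j = i then c i * B (w i) (w i) else 0)"
      using w(2) that by (intro sum.cong) auto
    also have "\<dots> = c i * B (w i) (w i)" using that by simp
    finally have "B x (w i) = c i * B (w i) (w i)" .
    then show ?thesis
      by (subst herm_sym[OF B], subst (2) herm_sym[OF B]) simp
  qed
  then have "B x x = (\<Sum>i<n. (c i * cnj (c i)) * B (w i) (w i))"
    by (subst c) (simp add: herm_sum_left[OF B] herm_scale_left[OF B] mult.assoc)
  then have eq: "Re (B x x) = (\<Sum>i<n. (cmod (c i))\<^sup>2 * Re (B (w i) (w i)))"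
    unfolding complex_norm_square[symmetric] by simp
  obtain i where i: "i < n" "c i \<noteq> 0"
    using x(2) c by (metis (mono_tags, lifting) lessThan_iff scale_eq_0_iff sum.neutral)
  have le: "(cmod (c j))\<^sup>2 * Re (B (w j) (w j)) \<le> 0" if "j < n" for j
    using w(1)[OF that] by (simp add: mult_nonneg_nonpos)
  have "(cmod (c i))\<^sup>2 * Re (B (w i) (w i)) < 0"
    using w(1)[OF i(1)] i(2) by (simp add: mult_pos_neg)
  then have "(\<Sum>i<n. (cmod (c i))\<^sup>2 * Re (B (w i) (w i))) < (\<Sum>i<n. 0)"
    using le i(1) by (intro sum_strict_mono_ex1) auto
  then show ?thesis unfolding eq by simp
qed

text \<open>
  A Lyapunov inertia statement: a dissipative operator has at least as many unstable eigenvalues as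
  the form has negative directions. Each step splits off one unstable eigenvector and passes to the
  compression on its \<open>B\<close>-orthogonal complement, where one negative direction fewer remains. The flag
  form (instead of eigenvectors) accounts for multiplicities and is stable under limits.
\<close>

lemma dissipative_unstable_flag:
  assumes B: "hermitian B" and S: "finite S" "V \<subseteq> span S"
    and L: "operator L" and V: "subspace V" "\<And>y. y \<in> V \<Longrightarrow> L y \<in> V"
    and dissipative: "\<And>y. y \<in> V \<Longrightarrow> y \<noteq> 0 \<Longrightarrow> Re (B (L y) y) < 0"
    and X: "X \<subseteq> V" "independent X" "finite X" "card X = n"
      "\<And>x. x \<in> span X \<Longrightarrow> x \<noteq> 0 \<Longrightarrow> Re (B x x) < 0"
  shows "\<exists>w lam. (\<forall>i<n. w i \<in> V \<and> Re (B (w i) (w i)) < 0 \<and> Re (lam i) > 0) \<and>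
    (\<forall>i<n. \<forall>j<n. i \<noteq> j \<longrightarrow> B (w i) (w j) = 0) \<and> triangular L w lam n"
  using S(2) L V dissipative X
proof (induction n arbitrary: V L X)
  case 0
  then show ?case by (simp add: triangular_def)
next
  case (Suc n)
  note L = \<open>operator L\<close> and V = \<open>subspace V\<close>
  note inv = Suc.prems(4) and diss = Suc.prems(5) and negX = Suc.prems(10)
  obtain x0 where x0: "x0 \<in> X" using Suc.prems(9) by fastforce
  then have "x0 \<noteq> 0" using Suc.prems(7) dependent_zero by blast
  then have "Re (B x0 x0) \<le> 0" using negX[OF span_base[OF x0]] by simp
  then obtain e a where e: "e \<in> V" "e \<noteq> 0" "L e = a *c e" "Re (B e e) < 0" "Re a > 0"
    using dissipative_unstable_eigenvector[OF B S(1) Suc.prems(1) L V inv diss _ \<open>x0 \<noteq> 0\<close>]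
      Suc.prems(6) x0 by blast
  then have ne: "B e e \<noteq> 0" by auto
  define P where "P y = y - (B y e / B e e) *c e" for y
  have P0: "B (P y) e = 0" for y
    using ne by (simp add: P_def herm_diff_left[OF B] herm_scale_left[OF B])
  have PV: "P y \<in> V" if "y \<in> V" for y
    unfolding P_def using that e(1) V by (intro subspace_diff subspace_scale)
  define V' where "V' = {y \<in> V. B y e = 0}"
  have V': "subspace V'"
    unfolding V'_def by (rule subspace_hyperplane[OF B V])
  have L': "operator (\<lambda>y. P (L y))"
    unfolding P_def by (rule operator_compose[OF L operator_projection[OF B]])
  \<comment> \<open>A hyperplane section of the span of \<open>X\<close> loses at most one dimension.\<close>
  have "\<exists>Y. Y \<subseteq> V' \<and> independent Y \<and> finite Y \<and> card Y = n \<and> Y \<subseteq> span X"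
  proof (cases "\<forall>x\<in>X. B x e = 0")
    case True
    then show ?thesis
      using Suc.prems(6-9) x0 independent_mono[OF Suc.prems(7), of "X - {x0}"]
      by (intro exI[of _ "X - {x0}"]) (auto simp: V'_def intro: span_base)
  next
    case False
    then obtain x1 where x1: "x1 \<in> X" "B x1 e \<noteq> 0" by blast
    define f where "f x = x - (B x e / B x1 e) *c x1" for x
    have f: "operator f"
      by (unfold f_def, rule operator_projection[OF B])
    have indep: "independent (X - {x1})" using Suc.prems(7) independent_mono by blast
    have inj: "inj_on f (span (X - {x1}))"
    proof (rule inj_onI)
      fix x y assume xy: "x \<in> span (X - {x1})" "y \<in> span (X - {x1})" "f x = f y"
      define c where "c = B (x - y) e / B x1 e"
      have "f (x - y) = 0" using xy(3) by (simp add: operator_diff[OF f])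
      then have c: "x - y = c *c x1" by (simp add: f_def c_def)
      have "c = 0"
      proof (rule ccontr)
        assume "c \<noteq> 0"
        then have "x1 = (1 / c) *c (x - y)" by (simp add: c)
        then have "x1 \<in> span (X - {x1})"
          using span_scale[OF span_diff[OF xy(1,2)], of "1 / c"] by simp
        then show False using Suc.prems(7) x1(1) by (auto simp: dependent_def)
      qed
      then show "x = y" using c by simp
    qed
    have "independent (f ` (X - {x1}))"
      using module_hom.independent_injective_image[OF f[unfolded linear_iff_module_hom] indep inj] .
    moreover have "card (f ` (X - {x1})) = n"
      using Suc.prems(8,9) x1(1) card_image[OF inj_on_subset[OF inj span_superset]] by simp
    moreover have "f ` (X - {x1}) \<subseteq> V'"
      using x1 Suc.prems(6) V
      by (auto simp: V'_def f_def herm_diff_left[OF B] herm_scale_left[OF B]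
          intro!: subspace_diff subspace_scale)
    moreover have "f ` (X - {x1}) \<subseteq> span X"
    proof
      fix z assume "z \<in> f ` (X - {x1})"
      then obtain y where "y \<in> X" "z = y - (B y e / B x1 e) *c x1" by (auto simp: f_def)
      then show "z \<in> span X"
        using span_diff[OF span_base span_scale[OF span_base]] x1(1) by simp
    qed
    ultimately show ?thesis using Suc.prems(8) by blast
  qed
  then obtain Y where Y: "Y \<subseteq> V'" "independent Y" "finite Y" "card Y = n" "Y \<subseteq> span X"
    by blast
  have "\<exists>w lam. (\<forall>i<n. w i \<in> V' \<and> Re (B (w i) (w i)) < 0 \<and> Re (lam i) > 0) \<and>
    (\<forall>i<n. \<forall>j<n. i \<noteq> j \<longrightarrow> B (w i) (w j) = 0) \<and> triangular (\<lambda>y. P (L y)) w lam n"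
  proof (rule Suc.IH[OF _ L' V' _ _ Y(1-4)])
    show "V' \<subseteq> span S" using Suc.prems(1) by (auto simp: V'_def)
    show "P (L y) \<in> V'" if "y \<in> V'" for y
      using that PV inv P0 by (auto simp: V'_def)
    show "Re (B x x) < 0" if "x \<in> span Y" "x \<noteq> 0" for x
      using negX that span_minimal[OF Y(5) subspace_span] by blast
    fix y assume y: "y \<in> V'" "y \<noteq> 0"
    then have "B e y = 0" using herm_sym[OF B, of y e] by (auto simp: V'_def)
    then have "B (P (L y)) y = B (L y) y"
      by (simp add: P_def herm_diff_left[OF B] herm_scale_left[OF B])
    then show "Re (B (P (L y)) y) < 0" using diss y by (auto simp: V'_def)
  qed
  then obtain w lam where w: "\<And>i. i < n \<Longrightarrow> w i \<in> V'" "\<And>i. i < n \<Longrightarrow> Re (B (w i) (w i)) < 0"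
    "\<And>i. i < n \<Longrightarrow> Re (lam i) > 0" "\<And>i j. i < n \<Longrightarrow> j < n \<Longrightarrow> i \<noteq> j \<Longrightarrow> B (w i) (w j) = 0"
    "triangular (\<lambda>y. P (L y)) w lam n"
    by blast
  define w' where "w' = case_nat e w"
  define lam' where "lam' = case_nat a lam"
  \<comment> \<open>The new eigenvector becomes the first member of the flag; \<open>P \<circ> L\<close> and \<open>L\<close> differ by multiples of it.\<close>
  have img: "w' ` {..<Suc i} = insert e (w ` {..<i})" for i
    by (simp add: w'_def lessThan_Suc_eq_insert_0 image_image)
  have "triangular L w' lam' (Suc n)"
    unfolding triangular_def
  proof (intro allI impI)
    fix i assume "i < Suc n"
    show "L (w' i) - lam' i *c w' i \<in> span (w' ` {..<i})"
    proof (cases i)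
      case 0
      then show ?thesis by (simp add: w'_def lam'_def e)
    next
      case (Suc j)
      then have "j < n" using \<open>i < Suc n\<close> by simp
      then have j: "P (L (w j)) - lam j *c w j \<in> span (w ` {..<j})"
        using w(5) by (simp add: triangular_def)
      define c where "c = B (L (w j)) e / B e e"
      have "L (w' i) - lam' i *c w' i - c *c e = P (L (w j)) - lam j *c w j"
        by (simp add: P_def Suc w'_def lam'_def c_def algebra_simps)
      then have "L (w' i) - lam' i *c w' i - c *c e \<in> span (w ` {..<j})"
        using j by simp
      then show ?thesis
        unfolding Suc img span_breakdown_eq by blast
    qed
  qed
  moreover have "B (w' i) (w' j) = 0" if "i < Suc n" "j < Suc n" "i \<noteq> j" for i j
  proof -
    have "B (w i) e = 0" if "i < n" for i using w(1)[OF that] by (simp add: V'_def)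
    then show ?thesis
      using that w(4) herm_sym[OF B, of "w (i - 1)" e] herm_sym[OF B, of "w (j - 1)" e]
      by (cases i; cases j) (simp_all add: w'_def)
  qed
  moreover have "w' i \<in> V \<and> Re (B (w' i) (w' i)) < 0 \<and> Re (lam' i) > 0" if "i < Suc n" for i
    using that w(1-3) e by (cases i) (auto simp: w'_def lam'_def V'_def)
  ultimately show ?case by blast
qed

lemma span_triangular_change:
  fixes n :: nat
  assumes "\<And>i. i < n \<Longrightarrow> \<exists>c. c \<noteq> 0 \<and> u i - c *c w i \<in> span (w ` {..<i})"
  shows "span (u ` {..<n}) = span (w ` {..<n})"
  using assms
proof (induction n)
  case (Suc n)
  have IH: "span (u ` {..<n}) = span (w ` {..<n})"
    by (rule Suc.IH, rule Suc.prems) simp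
  obtain c where c: "c \<noteq> 0" "u n - c *c w n \<in> span (w ` {..<n})"
    using Suc.prems[of n] by auto
  have "w n - (1 / c) *c u n = (- 1 / c) *c (u n - c *c w n)"
    using c(1) by (simp add: scale_right_diff_distrib)
  then have w: "w n - (1 / c) *c u n \<in> span (u ` {..<n})"
    using span_scale[OF c(2), of "- 1 / c"] IH by simp
  have "u ` {..<n} \<subseteq> span (w ` {..<n})" "w ` {..<n} \<subseteq> span (u ` {..<n})"
    using IH span_superset[of "u ` {..<n}"] span_superset[of "w ` {..<n}"] by simp_all
  moreover have "span (w ` {..<n}) \<subseteq> span (insert (w n) (w ` {..<n}))"
    "span (u ` {..<n}) \<subseteq> span (insert (u n) (u ` {..<n}))"
    by (intro span_mono; blast)+
  moreover have "u n \<in> span (insert (w n) (w ` {..<n}))"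
    unfolding span_breakdown_eq using c(2) by (rule exI)
  moreover have "w n \<in> span (insert (u n) (u ` {..<n}))"
    unfolding span_breakdown_eq using w by (rule exI)
  ultimately show ?case
    unfolding lessThan_Suc image_insert span_eq insert_subset by (meson subset_trans)
qed simp

lemma gram_schmidt:
  fixes n :: nat
  assumes C: "hermitian C"
    and pos: "\<And>x. x \<in> span (w ` {..<n}) \<Longrightarrow> x \<noteq> 0 \<Longrightarrow> Re (C x x) > 0"
    and new: "\<And>i. i < n \<Longrightarrow> w i \<notin> span (w ` {..<i})"
  shows "\<exists>u. (\<forall>i<n. \<forall>j<n. C (u i) (u j) = (if i = j then 1 else 0)) \<and>
     (\<forall>i<n. \<exists>c. c \<noteq> 0 \<and> u i - c *c w i \<in> span (w ` {..<i}))"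
  using assms(2-)
proof (induction n)
  case (Suc n)
  have sub: "span (w ` {..<n}) \<subseteq> span (w ` {..<Suc n})" by (intro span_mono) auto
  have "\<exists>u. (\<forall>i<n. \<forall>j<n. C (u i) (u j) = (if i = j then 1 else 0)) \<and>
     (\<forall>i<n. \<exists>c. c \<noteq> 0 \<and> u i - c *c w i \<in> span (w ` {..<i}))"
  proof (rule Suc.IH)
    show "Re (C x x) > 0" if "x \<in> span (w ` {..<n})" "x \<noteq> 0" for x
      using Suc.prems(1) that sub by blast
    show "w i \<notin> span (w ` {..<i})" if "i < n" for i
      using Suc.prems(2) that by simp
  qed
  then obtain u where u: "\<And>i j. i < n \<Longrightarrow> j < n \<Longrightarrow> C (u i) (u j) = (if i = j then 1 else 0)"
    "\<And>i. i < n \<Longrightarrow> \<exists>c. c \<noteq> 0 \<and> u i - c *c w i \<in> span (w ` {..<i})"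
    by blast
  have span: "span (u ` {..<n}) = span (w ` {..<n})"
    using span_triangular_change[of n u w] u(2) by blast
  define s where "s = (\<Sum>j<n. C (w n) (u j) *c u j)"
  have s: "s \<in> span (w ` {..<n})"
    unfolding s_def span[symmetric] in_span_lessThan_iff
    by (rule exI[of _ "\<lambda>j. C (w n) (u j)"]) simp
  define v where "v = w n - s"
  have v: "v \<in> span (w ` {..<Suc n})"
  proof -
    have s': "s \<in> span (w ` {..<Suc n})"
      using s span_mono[of "w ` {..<n}" "w ` {..<Suc n}"] by fastforce
    show ?thesis unfolding v_def by (rule span_diff[OF span_base s']) simp
  qed
  have "v \<noteq> 0" using s Suc.prems(2)[of n] by (auto simp: v_def)
  define r where "r = Re (C v v)"
  have r: "r > 0" using Suc.prems(1) v \<open>v \<noteq> 0\<close> by (auto simp: r_def)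
  have Cv: "C v v = of_real r" using herm_Im[OF C, of v] by (simp add: r_def complex_eq_iff)
  have vu: "C v (u j) = 0" if "j < n" for j
  proof -
    have "C s (u j) = (\<Sum>i<n. C (w n) (u i) * C (u i) (u j))"
      by (simp add: s_def herm_sum_left[OF C] herm_scale_left[OF C])
    also have "\<dots> = (\<Sum>i<n. if i = j then C (w n) (u j) else 0)"
      using u(1) that by (intro sum.cong) auto
    also have "\<dots> = C (w n) (u j)" using that by simp
    finally show ?thesis by (simp add: v_def herm_diff_left[OF C])
  qed
  have uv: "C (u j) v = 0" if "j < n" for j
    using herm_sym[OF C, of v "u j"] vu[OF that] by simp
  define d :: complex where "d = of_real (1 / sqrt r)"
  have d: "d \<noteq> 0" "cnj d * (d * of_real r) = 1"
    using r by (auto simp: d_def complex_eq_iff field_simps)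
  define u' where "u' = u(n := d *c v)"
  have "C (u' i) (u' j) = (if i = j then 1 else 0)" if "i < Suc n" "j < Suc n" for i j
    using that u(1) vu uv d(2)
    by (auto simp: u'_def less_Suc_eq herm_scale_left[OF C] herm_scale_right[OF C] Cv)
  moreover have "\<exists>c. c \<noteq> 0 \<and> u' i - c *c w i \<in> span (w ` {..<i})" if "i < Suc n" for i
  proof (cases "i = n")
    case True
    have "u' n - d *c w n = (- d) *c s"
      by (simp add: u'_def v_def scale_right_diff_distrib)
    then show ?thesis using True s d(1) by (metis span_scale)
  next
    case False
    then show ?thesis using u(2) that by (auto simp: u'_def)
  qed
  ultimately show ?case by blast
qed simp

text \<open>
  The flag of the previous lemma, orthonormalised for a second form \<open>C\<close> that is positive wherever \<open>B\<close>
  is negative. Orthonormality for a \<open>C\<close> that sees only finitely many fixed coordinates is what keeps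
  the vectors independent when a limit over growing spaces is taken.
\<close>

lemma orthonormal_unstable_flag:
  assumes B: "hermitian B" and C: "hermitian C" and S: "finite S" "V \<subseteq> span S"
    and L: "operator L" and V: "subspace V" "\<And>y. y \<in> V \<Longrightarrow> L y \<in> V"
    and dissipative: "\<And>y. y \<in> V \<Longrightarrow> y \<noteq> 0 \<Longrightarrow> Re (B (L y) y) < 0"
    and X: "X \<subseteq> V" "independent X" "finite X" "card X = n"
      "\<And>x. x \<in> span X \<Longrightarrow> x \<noteq> 0 \<Longrightarrow> Re (B x x) < 0"
    and BC: "\<And>x. x \<in> V \<Longrightarrow> Re (B x x) < 0 \<Longrightarrow> Re (C x x) > 0"
  shows "\<exists>u lam. (\<forall>i<n. u i \<in> V \<and> Re (B (u i) (u i)) \<le> 0 \<and> Re (lam i) > 0) \<and>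
    (\<forall>i<n. \<forall>j<n. C (u i) (u j) = (if i = j then 1 else 0)) \<and> triangular L u lam n"
proof -
  obtain w lam where w: "\<And>i. i < n \<Longrightarrow> w i \<in> V" "\<And>i. i < n \<Longrightarrow> Re (B (w i) (w i)) < 0"
    "\<And>i. i < n \<Longrightarrow> Re (lam i) > 0" "\<And>i j. i < n \<Longrightarrow> j < n \<Longrightarrow> i \<noteq> j \<Longrightarrow> B (w i) (w j) = 0"
    "triangular L w lam n"
    using dissipative_unstable_flag[OF B S L V dissipative X] by metis
  have WV: "span (w ` {..<i}) \<subseteq> V" if "i \<le> n" for i
    using w(1) that V(1) by (intro span_minimal) auto
  have neg: "Re (B x x) < 0" if "x \<in> span (w ` {..<n})" "x \<noteq> 0" for x
    using negative_on_orthogonal_span[OF B w(2,4) that] by blast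
  have new: "w i \<notin> span (w ` {..<i})" if i: "i < n" for i
  proof
    assume "w i \<in> span (w ` {..<i})"
    then obtain c where c: "w i = (\<Sum>j<i. c j *c w j)" unfolding in_span_lessThan_iff by blast
    have "B (w i) (w i) = (\<Sum>j<i. c j * B (w j) (w i))"
      by (subst c) (simp add: herm_sum_left[OF B] herm_scale_left[OF B])
    also have "\<dots> = 0" using w(4) i by (intro sum.neutral) auto
    finally show False using w(2)[OF i] by simp
  qed
  obtain u where u: "\<And>i j. i < n \<Longrightarrow> j < n \<Longrightarrow> C (u i) (u j) = (if i = j then 1 else 0)"
    "\<And>i. i < n \<Longrightarrow> \<exists>c. c \<noteq> 0 \<and> u i - c *c w i \<in> span (w ` {..<i})"
    using gram_schmidt[OF C _ new, of n] neg BC WV[of n] by (metis order_refl subsetD)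
  have span: "span (u ` {..<i}) = span (w ` {..<i})" if "i \<le> n" for i
    using span_triangular_change[of i u w] u(2) that by (meson less_le_trans)
  have uW: "u i \<in> span (w ` {..<n})" if "i < n" for i
    using span[of n] that by (auto intro: span_base)
  have "triangular L u lam n"
    unfolding triangular_def
  proof (intro allI impI)
    fix i assume i: "i < n"
    obtain c where c: "u i - c *c w i \<in> span (w ` {..<i})" using u(2) i by blast
    define r where "r = u i - c *c w i"
    have ui: "u i = c *c w i + r" by (simp add: r_def)
    have "L (u i) - lam i *c u i = c *c (L (w i) - lam i *c w i) + (L r - lam i *c r)"
      by (simp add: ui operator_add[OF L] operator_scale[OF L] algebra_simps)
    also have "\<dots> \<in> span (w ` {..<i})"
    proof -
      have "L r \<in> span (w ` {..<i})" "r \<in> span (w ` {..<i})"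
        using c i triangular_invariant[OF L w(5), of i r] by (auto simp: r_def)
      moreover have "L (w i) - lam i *c w i \<in> span (w ` {..<i})"
        using w(5) i by (simp add: triangular_def)
      ultimately show ?thesis
        using span_add[OF span_scale span_diff[OF _ span_scale]] by blast
    qed
    finally show "L (u i) - lam i *c u i \<in> span (u ` {..<i})" using span[of i] i by simp
  qed
  moreover have "Re (B (u i) (u i)) \<le> 0" if "i < n" for i
    using neg[OF uW[OF that]] by (cases "u i = 0") (auto simp: herm_zero_left[OF B])
  ultimately show ?thesis
    using u(1) w(3) WV[of n] uW by blast
qed

end

section \<open>Generalised eigenspaces of unbounded operators\<close>

context complex_vector_space begin

text \<open>
  Here \<open>L\<close> acts on all vectors, and \<open>H\<close> is the space in which solutions are sought. The condition
  \<open>L x \<in> H\<close> restricts \<open>L\<close> to its maximal domain in \<open>H\<close>.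
\<close>

fun gen_ker :: "('v \<Rightarrow> 'v) \<Rightarrow> 'v set \<Rightarrow> complex \<Rightarrow> nat \<Rightarrow> 'v set" where
  "gen_ker L H a 0 = {0}"
| "gen_ker L H a (Suc n) = {x \<in> H. L x \<in> H \<and> L x - a *c x \<in> gen_ker L H a n}"

definition gen_eigenspace :: "('v \<Rightarrow> 'v) \<Rightarrow> 'v set \<Rightarrow> complex \<Rightarrow> 'v set" where
  "gen_eigenspace L H a = (\<Union>n. gen_ker L H a n)"

lemma operator_shift: "operator L \<Longrightarrow> operator (\<lambda>x. L x - a *c x)"
  by (rule operatorI) (simp_all add: operator_add operator_scale scale_right_distrib
      scale_right_diff_distrib mult.commute)

context
  fixes L :: "'v \<Rightarrow> 'v" and H :: "'v set"
  assumes L: "operator L" and H: "subspace H"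
begin

lemma gen_ker_subset: "gen_ker L H a n \<subseteq> H"
  using subspace_0[OF H] by (cases n) auto

lemma gen_ker_subspace: "subspace (gen_ker L H a n)"
proof (induction n)
  case (Suc n)
  note M = operator_shift[OF L, of a]
  show ?case
  proof (rule subspaceI)
    show "0 \<in> gen_ker L H a (Suc n)"
      using Suc H by (simp add: operator_zero[OF L] subspace_0)
    show "x + y \<in> gen_ker L H a (Suc n)"
      if "x \<in> gen_ker L H a (Suc n)" "y \<in> gen_ker L H a (Suc n)" for x y
      using that Suc H unfolding gen_ker.simps mem_Collect_eq operator_add[OF M, of x y]
      by (simp add: operator_add[OF L] subspace_add)
    show "c *c x \<in> gen_ker L H a (Suc n)" if "x \<in> gen_ker L H a (Suc n)" for c x
      using that Suc H unfolding gen_ker.simps mem_Collect_eq operator_scale[OF M, of c x]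
      by (simp add: operator_scale[OF L] subspace_scale)
  qed
qed auto

lemma gen_ker_Suc: "gen_ker L H a n \<subseteq> gen_ker L H a (Suc n)"
proof (induction n)
  case 0
  then show ?case using subspace_0[OF H] by (simp add: operator_zero[OF L])
qed auto

lemma gen_ker_mono: "m \<le> n \<Longrightarrow> gen_ker L H a m \<subseteq> gen_ker L H a n"
  using lift_Suc_mono_le[of "gen_ker L H a"] gen_ker_Suc by blast

lemma gen_eigenspace_subspace: "subspace (gen_eigenspace L H a)"
proof (rule subspaceI)
  show "0 \<in> gen_eigenspace L H a"
    unfolding gen_eigenspace_def using subspace_0[OF gen_ker_subspace] by blast
  show "x + y \<in> gen_eigenspace L H a" if xy: "x \<in> gen_eigenspace L H a" "y \<in> gen_eigenspace L H a" for x y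
  proof -
    obtain m n where "x \<in> gen_ker L H a m" "y \<in> gen_ker L H a n"
      using xy unfolding gen_eigenspace_def by blast
    then have "x \<in> gen_ker L H a (max m n)" "y \<in> gen_ker L H a (max m n)"
      using gen_ker_mono[of m "max m n" a] gen_ker_mono[of n "max m n" a] by auto
    then show ?thesis
      using subspace_add[OF gen_ker_subspace] unfolding gen_eigenspace_def by blast
  qed
  show "c *c x \<in> gen_eigenspace L H a" if "x \<in> gen_eigenspace L H a" for c x
    using that subspace_scale[OF gen_ker_subspace] unfolding gen_eigenspace_def by blast
qed

lemma gen_ker_invariant:
  assumes "x \<in> gen_ker L H a n"
  shows "L x \<in> gen_ker L H a n"
proof (cases n)
  case (Suc m)
  have "L x - a *c x \<in> gen_ker L H a n"
    using assms gen_ker_Suc[of a m] unfolding Suc by auto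
  from subspace_add[OF gen_ker_subspace this subspace_scale[OF gen_ker_subspace assms, of a]]
  show ?thesis by simp
qed (use assms in \<open>auto simp: operator_zero[OF L]\<close>)

lemma gen_ker_shift:
  assumes "x \<in> gen_ker L H a n"
  shows "L x - b *c x \<in> gen_ker L H a n"
  using assms subspace_diff[OF gen_ker_subspace gen_ker_invariant[OF assms]]
    subspace_scale[OF gen_ker_subspace] by blast

lemma gen_ker_no_other_eigenvector:
  assumes "x \<in> gen_ker L H a n" "L x = b *c x" "a \<noteq> b"
  shows "x = 0"
  using assms(1)
proof (induction n)
  case (Suc n)
  then have "(b - a) *c x \<in> gen_ker L H a n"
    using assms(2) by (simp add: scale_left_diff_distrib)
  from subspace_scale[OF gen_ker_subspace this, of "1 / (b - a)"]
  have "x \<in> gen_ker L H a n" using assms(3) by simp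
  then show ?case by (rule Suc.IH)
qed auto

text \<open>
  \<open>L - b\<close> is the nonzero scalar \<open>a - b\<close> plus a nilpotent operator on \<open>gen_ker L H a n\<close>, hence onto.
\<close>

lemma gen_ker_solve:
  assumes "y \<in> gen_ker L H a n" "a \<noteq> b"
  shows "\<exists>x \<in> gen_ker L H a n. L x - b *c x = y"
  using assms(1)
proof (induction n arbitrary: y)
  case (Suc n)
  define r where "r = L y - a *c y"
  have r: "r \<in> gen_ker L H a n" using Suc.prems by (simp add: r_def)
  then obtain z where z: "z \<in> gen_ker L H a n" "L z - b *c z = r" using Suc.IH by blast
  define c where "c = 1 / (a - b)"
  have c: "c * (a - b) = 1" using assms(2) by (simp add: c_def)
  have "L (c *c (y - z)) - b *c (c *c (y - z)) = c *c ((L y - b *c y) - (L z - b *c z))"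
    by (simp add: operator_scale[OF L] operator_diff[OF L] algebra_simps)
  also have "\<dots> = c *c ((a - b) *c y)"
    unfolding z(2) r_def by (simp add: algebra_simps)
  also have "\<dots> = y" using c by simp
  finally have eq: "L (c *c (y - z)) - b *c (c *c (y - z)) = y" .
  have "z \<in> gen_ker L H a (Suc n)" using z(1) gen_ker_Suc by blast
  from subspace_scale[OF gen_ker_subspace subspace_diff[OF gen_ker_subspace Suc.prems this]]
  show ?case using eq by blast
qed (auto simp: operator_zero[OF L])

lemma gen_eigenspace_zero_sum:
  assumes "finite A" "\<And>a. a \<in> A \<Longrightarrow> f a \<in> gen_eigenspace L H a" "(\<Sum>a\<in>A. f a) = 0" "a \<in> A"
  shows "f a = 0"
  using assms
proof (induction A arbitrary: f a rule: finite_induct)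
  case (insert b A)
  obtain n where "f b \<in> gen_ker L H b n"
    using insert.prems(1)[of b] by (auto simp: gen_eigenspace_def)
  then have "\<forall>a\<in>insert b A. f a = 0"
    using insert.prems(1,2)
  proof (induction n arbitrary: f)
    case 0
    then have fb: "f b = 0" by simp
    have "f a = 0" if "a \<in> A" for a
      by (rule insert.IH[of f]) (use 0 fb insert.hyps that in auto)
    then show ?case using fb by simp
  next
    case (Suc n)
    define g where "g a = L (f a) - b *c f a" for a
    note M = operator_shift[OF L, of b]
    have "\<forall>a\<in>insert b A. g a = 0"
    proof (rule Suc.IH)
      show "g b \<in> gen_ker L H b n" using Suc.prems(1) by (simp add: g_def)
      show "g a \<in> gen_eigenspace L H a" if "a \<in> insert b A" for a
        using Suc.prems(2)[OF that] gen_ker_shift unfolding g_def gen_eigenspace_def by blast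
      show "(\<Sum>a\<in>insert b A. g a) = 0"
        using operator_sum[OF M, of f "insert b A"] Suc.prems(3)
        by (simp add: g_def operator_zero[OF L])
    qed
    then have eig: "L (f a) = b *c f a" if "a \<in> A" for a
      using that by (simp add: g_def)
    have z: "f a = 0" if aA: "a \<in> A" for a
    proof -
      obtain m where "f a \<in> gen_ker L H a m"
        using Suc.prems(2)[of a] aA unfolding gen_eigenspace_def by blast
      then show ?thesis
        using gen_ker_no_other_eigenvector[OF _ eig[OF aA]] insert.hyps(2) aA by blast
    qed
    then have "f b = 0" using Suc.prems(3) insert.hyps by simp
    then show ?case using z by simp
  qed
  then show ?case using insert.prems(3) by blast
qed simp

lemma gen_eigenspace_disjoint:
  assumes "x \<in> gen_eigenspace L H a" "x \<in> gen_eigenspace L H b" "a \<noteq> b"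
  shows "x = 0"
proof -
  define f where "f c = (if c = a then x else - x)" for c
  have "- x \<in> gen_eigenspace L H b" using subspace_neg[OF gen_eigenspace_subspace assms(2)] .
  then have "f c \<in> gen_eigenspace L H c" if "c \<in> {a, b}" for c
    using that assms(1,3) by (auto simp: f_def)
  moreover have "(\<Sum>c\<in>{a, b}. f c) = 0" using assms(3) by (simp add: f_def)
  ultimately have "f a = 0"
    using gen_eigenspace_zero_sum[of "{a, b}" f a] by simp
  then show ?thesis by (simp add: f_def)
qed

lemma independent_Union_gen_eigenspace:
  assumes B: "\<And>a. a \<in> A \<Longrightarrow> B a \<subseteq> gen_eigenspace L H a" "\<And>a. a \<in> A \<Longrightarrow> independent (B a)"
  shows "independent (\<Union>a\<in>A. B a)"
proof (rule notI)
  assume "dependent (\<Union>a\<in>A. B a)"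
  then obtain t u v where t: "finite t" "t \<subseteq> (\<Union>a\<in>A. B a)" "(\<Sum>v\<in>t. u v *c v) = 0" "v \<in> t" "u v \<noteq> 0"
    unfolding dependent_explicit by blast
  have uniq: "a = b" if "x \<in> B a" "x \<in> B b" "a \<in> A" "b \<in> A" for x a b
    using that gen_eigenspace_disjoint[of x a b] B dependent_zero[of "B a"] by blast
  have "\<forall>x\<in>t. \<exists>a\<in>A. x \<in> B a" using t(2) by blast
  then obtain h where h: "\<And>x. x \<in> t \<Longrightarrow> h x \<in> A \<and> x \<in> B (h x)" by metis
  define f where "f a = (\<Sum>x\<in>{x\<in>t. h x = a}. u x *c x)" for a
  have sum: "(\<Sum>a\<in>h ` t. f a) = 0"
    using t(3) sum.group[of t "h ` t" h "\<lambda>x. u x *c x"] t(1) by (simp add: f_def)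
  have f: "f a \<in> gen_eigenspace L H a" if "a \<in> h ` t" for a
    unfolding f_def
    using h B(1) by (intro subspace_sum subspace_scale gen_eigenspace_subspace) blast
  have "f (h v) = 0"
    using gen_eigenspace_zero_sum[of "h ` t" f "h v"] f sum t(1,4) by simp
  moreover have "{x\<in>t. h x = h v} \<subseteq> B (h v)" using h by force
  ultimately have "u v = 0"
    unfolding f_def
    using t(1,4) h[OF t(4)] B(2) independentD[of "B (h v)" "{x\<in>t. h x = h v}" u v] by simp
  then show False using t(5) by simp
qed

text \<open>
  The last vector of the flag satisfies \<open>(L - b) w = y + y'\<close> with \<open>y\<close> in the generalised eigenspace for \<open>b\<close>
  and \<open>y'\<close> in the others. On the others \<open>L - b\<close> can be inverted, so a correction \<open>x'\<close> moves \<open>w\<close> into the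
  generalised eigenspace for \<open>b\<close>.
\<close>

lemma flag_in_gen_eigenspaces:
  assumes w: "triangular L w lam n" "\<And>i. i < n \<Longrightarrow> w i \<in> H" "\<And>i. i < n \<Longrightarrow> L (w i) \<in> H"
    "\<And>i. i < n \<Longrightarrow> lam i \<in> A"
  shows "i < n \<Longrightarrow> w i \<in> span (\<Union>a\<in>A. gen_eigenspace L H a)"
proof (induction i rule: less_induct)
  case (less i)
  let ?E = "gen_eigenspace L H"
  define b where "b = lam i"
  define S where "S = span (\<Union>a\<in>A. ?E a)"
  define S' where "S' = span (\<Union>a\<in>A - {b}. ?E a)"
  have b: "b \<in> A" using w(4) less.prems by (simp add: b_def)
  have "span (w ` {..<i}) \<subseteq> S"
    unfolding S_def using less by (intro span_minimal) auto
  then have "L (w i) - b *c w i \<in> S"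
    using w(1) less.prems unfolding triangular_def b_def by blast
  moreover have "(\<Union>a\<in>A. ?E a) = ?E b \<union> (\<Union>a\<in>A - {b}. ?E a)" using b by auto
  ultimately have "L (w i) - b *c w i \<in> {x + y | x y. x \<in> span (?E b) \<and> y \<in> S'}"
    unfolding S_def S'_def by (simp only: span_Un)
  then obtain y y' where y: "L (w i) - b *c w i = y + y'" "y \<in> ?E b" "y' \<in> S'"
    unfolding span_eq_iff[THEN iffD2, OF gen_eigenspace_subspace] by blast
  have "\<exists>x'\<in>S'. x' \<in> H \<and> L x' \<in> H \<and> L x' - b *c x' = y'"
    using y(3) unfolding S'_def
  proof (induction rule: span_induct_alt)
    case base
    then show ?case
      using subspace_0[OF H] by (intro bexI[of _ 0]) (auto simp: operator_zero[OF L] span_zero)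
  next
    case (step c z y)
    then obtain a m where a: "a \<in> A - {b}" "z \<in> gen_ker L H a m" by (auto simp: gen_eigenspace_def)
    then obtain x where x: "x \<in> gen_ker L H a m" "L x - b *c x = z"
      using gen_ker_solve[of z a m b] by blast
    then have xH: "x \<in> H" "L x \<in> H" "x \<in> span (\<Union>a\<in>A - {b}. ?E a)"
      using gen_ker_subset gen_ker_invariant[of x a m] a(1)
      by (auto simp: gen_eigenspace_def intro!: span_base)
    obtain x' where x': "x' \<in> span (\<Union>a\<in>A - {b}. ?E a)" "x' \<in> H" "L x' \<in> H" "L x' - b *c x' = y"
      using step by blast
    have "L (c *c x + x') - b *c (c *c x + x') = c *c z + y"
      unfolding x(2)[symmetric] x'(4)[symmetric]
      by (simp add: operator_add[OF L] operator_scale[OF L] algebra_simps)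
    then show ?case
      using x' xH H
      by (intro bexI[of _ "c *c x + x'"])
         (auto simp: operator_add[OF L] operator_scale[OF L] subspace_add subspace_scale
           span_add span_scale)
  qed
  then obtain x' where x': "x' \<in> S'" "x' \<in> H" "L x' \<in> H" "L x' - b *c x' = y'" by blast
  obtain m where m: "y \<in> gen_ker L H b m" using y(2) by (auto simp: gen_eigenspace_def)
  have "L (w i - x') - b *c (w i - x') = (L (w i) - b *c w i) - (L x' - b *c x')"
    by (simp add: operator_diff[OF L] algebra_simps)
  then have "L (w i - x') - b *c (w i - x') = y"
    using y(1) x'(4) by simp
  then have "w i - x' \<in> gen_ker L H b (Suc m)"
    using m w(2,3)[OF less.prems] x' H by (simp add: operator_diff[OF L] subspace_diff)
  then have "w i - x' \<in> ?E b" unfolding gen_eigenspace_def by blast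
  then have "w i - x' \<in> S" unfolding S_def using b by (intro span_base) blast
  moreover have "x' \<in> S"
    using x'(1) span_mono[of "\<Union>a\<in>A - {b}. ?E a" "\<Union>a\<in>A. ?E a"] unfolding S_def S'_def by blast
  ultimately have "w i - x' + x' \<in> S" unfolding S_def by (rule span_add)
  then show ?case by (simp add: S_def)
qed

text \<open>
  The upper bound is expressed by a linear map \<open>f\<close> into an at most \<open>n\<close>-dimensional space that is
  injective on the span, the lower bound by \<open>n\<close> independent vectors. Since generalised eigenspaces are
  independent, bases of them combine to a basis of the span, which has dimension \<open>n\<close>.
\<close>

theorem sum_dim_gen_eigenspaces:
  assumes upper: "operator f" "finite D" "card D \<le> n" "\<And>x. f x \<in> span D"
      "\<And>x. x \<in> span (\<Union>a\<in>A. gen_eigenspace L H a) \<Longrightarrow> f x = 0 \<Longrightarrow> x = 0"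
    and lower: "independent Y" "card Y = n" "Y \<subseteq> span (\<Union>a\<in>A. gen_eigenspace L H a)"
  defines "A' \<equiv> {a \<in> A. gen_eigenspace L H a \<noteq> {0}}"
  shows "finite A'"
    and "\<And>a. a \<in> A \<Longrightarrow> \<exists>b. finite b \<and> gen_eigenspace L H a \<subseteq> span b"
    and "(\<Sum>a\<in>A'. dim (gen_eigenspace L H a)) = n"
proof -
  let ?E = "gen_eigenspace L H"
  have bound: "finite X \<and> card X \<le> n" if X: "independent X" "X \<subseteq> span (\<Union>a\<in>A. ?E a)" for X
  proof -
    have sub: "span X \<subseteq> span (\<Union>a\<in>A. ?E a)" using X(2) by (rule span_minimal) (rule subspace_span)
    have inj: "inj_on f (span X)"
    proof (rule inj_onI)
      fix x y assume "x \<in> span X" "y \<in> span X" "f x = f y"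
      then have "x - y \<in> span X" "f (x - y) = 0"
        by (auto simp: operator_diff[OF upper(1)] intro: span_diff)
      then show "x = y" using upper(5)[of "x - y"] sub by auto
    qed
    have "independent (f ` X)"
      using module_hom.independent_injective_image[OF upper(1)[unfolded linear_iff_module_hom] X(1) inj] .
    then have "finite (f ` X) \<and> card (f ` X) \<le> card D"
      by (rule independent_span_bound[OF upper(2)]) (use upper(4) in auto)
    moreover have "inj_on f X" using inj span_superset by (rule inj_on_subset)
    ultimately show ?thesis
      using upper(3) card_image[of f X] finite_image_iff[of f X] by auto
  qed
  have "\<exists>b. b \<subseteq> ?E a \<and> independent b \<and> ?E a \<subseteq> span b \<and> card b = dim (?E a)" for a
    by (rule basis_exists[of "?E a"]) blast
  then obtain B where B: "\<And>a. B a \<subseteq> ?E a" "\<And>a. independent (B a)" "\<And>a. ?E a \<subseteq> span (B a)"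
    "\<And>a. card (B a) = dim (?E a)" by metis
  have ES: "?E a \<subseteq> span (\<Union>a\<in>A. ?E a)" if "a \<in> A" for a
    using that by (intro subset_trans[OF UN_upper span_superset])
  have Bfin: "finite (B a)" if "a \<in> A" for a
    using bound[OF B(2)[of a]] B(1)[of a] ES[OF that] by auto
  show "\<exists>b. finite b \<and> ?E a \<subseteq> span b" if "a \<in> A" for a
    using Bfin[OF that] B(3) by blast
  define U where "U = (\<Union>a\<in>A. B a)"
  have U: "independent U" unfolding U_def
    by (rule independent_Union_gen_eigenspace) (use B in auto)
  have "U \<subseteq> span (\<Union>a\<in>A. ?E a)" unfolding U_def by (intro UN_least subset_trans[OF B(1) ES])
  then have Ufin: "finite U" "card U \<le> n" using bound[OF U] by auto
  have Bne: "B a \<noteq> {}" if "a \<in> A'" for a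
  proof
    assume "B a = {}"
    then have "?E a \<subseteq> {0}" using B(3)[of a] by simp
    then show False using that subspace_0[OF gen_eigenspace_subspace, of a] by (auto simp: A'_def)
  qed
  have B0: "B a = {}" if a: "a \<in> A - A'" for a
  proof (rule equals0I)
    fix x assume x: "x \<in> B a"
    have "?E a = {0}" using a by (simp add: A'_def)
    then have "x = 0" using B(1)[of a] x by auto
    then show False using x B(2)[of a] dependent_zero by simp
  qed
  have disj: "B a \<inter> B b = {}" if "a \<noteq> b" for a b
  proof (rule ccontr)
    assume "B a \<inter> B b \<noteq> {}"
    then obtain x where "x \<in> B a" "x \<in> B b" by blast
    then have "x = 0" using gen_eigenspace_disjoint[of x a b] B(1)[of a] B(1)[of b] that by auto
    then show False using \<open>x \<in> B a\<close> B(2)[of a] dependent_zero[of "B a"] by simp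
  qed
  have UA': "U = (\<Union>a\<in>A'. B a)" 
  proof
    show "U \<subseteq> (\<Union>a\<in>A'. B a)" using B0 by (fastforce simp: U_def)
    show "(\<Union>a\<in>A'. B a) \<subseteq> U" by (auto simp: U_def A'_def)
  qed
  define g where "g a = (SOME x. x \<in> B a)" for a
  have g: "g a \<in> B a" if "a \<in> A'" for a
    using Bne[OF that] unfolding g_def by (rule some_in_eq[THEN iffD2])
  have "inj_on g A'" 
  proof (rule inj_onI, rule ccontr)
    fix a b assume "a \<in> A'" "b \<in> A'" "g a = g b" "a \<noteq> b"
    then show False using g[of a] g[of b] disj[of a b] by auto
  qed
  moreover have "g ` A' \<subseteq> U" using g UA' by blast
  ultimately show A'fin: "finite A'" 
    using Ufin(1) finite_imageD[of g A'] finite_subset[of "g ` A'" U] by blast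
  have "card U = (\<Sum>a\<in>A'. card (B a))"
    unfolding UA' using A'fin Bfin disj by (intro card_UN_disjoint) (auto simp: A'_def)
  then have cardU: "card U = (\<Sum>a\<in>A'. dim (?E a))" by (simp add: B(4))
  have "?E a \<subseteq> span U" if "a \<in> A" for a
    using span_mono[of "B a" U] that by (intro subset_trans[OF B(3)]) (auto simp: U_def)
  then have "(\<Union>a\<in>A. ?E a) \<subseteq> span U" by (rule UN_least)
  then have "span (\<Union>a\<in>A. ?E a) \<subseteq> span U" by (rule span_minimal) (rule subspace_span)
  then have "n \<le> card U"
    using independent_span_bound[OF Ufin(1) lower(1)] lower(2,3) by auto
  then show "(\<Sum>a\<in>A'. dim (?E a)) = n" using Ufin(2) cardU by simp
qed

end

end

section \<open>Decaying solutions of the neutral recurrence\<close>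

text \<open>
  For \<open>|mu| < 2\<close> the quadratic form \<open>E n = f(n)^2 + f(n+1)^2 - mu * f(n) * f(n+1)\<close> is positive definite and
  is conserved by the recurrence with \<open>q = 0\<close>. With summable \<open>q\<close> the total relative change of \<open>E\<close> over a far
  tail is small, so the supremum \<open>S\<close> of \<open>E\<close> over the tail satisfies \<open>S \<le> S/2\<close> once \<open>E\<close> tends to \<open>0\<close>. Running
  the recurrence backwards from the tail finishes the proof.
\<close>

lemma bounded_recurrence_trivial:
  fixes f q :: "nat \<Rightarrow> real" and mu :: real
  assumes mu: "\<bar>mu\<bar> < 2" and q: "summable q" "\<And>n. q n \<ge> 0"
    and rec: "\<And>n. f (n + 2) + f n = mu * (1 + q (n + 1)) * f (n + 1)"
    and lim: "f \<longlonglongrightarrow> 0"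
  shows "f n = 0"
proof -
  define c where "c = 1 - \<bar>mu\<bar> / 2"
  have c: "c > 0" using mu by (simp add: c_def)
  define E where "E n = (f n)\<^sup>2 + (f (n + 1))\<^sup>2 - mu * f n * f (n + 1)" for n
  have Ege: "c * ((f n)\<^sup>2 + (f (n + 1))\<^sup>2) \<le> E n" for n
  proof -
    have "2 * \<bar>f n * f (n + 1)\<bar> \<le> (f n)\<^sup>2 + (f (n + 1))\<^sup>2"
      using sum_squares_bound[of "\<bar>f n\<bar>" "\<bar>f (n + 1)\<bar>"] by (simp add: abs_mult mult.assoc)
    then have "\<bar>mu\<bar> * (2 * \<bar>f n * f (n + 1)\<bar>) \<le> \<bar>mu\<bar> * ((f n)\<^sup>2 + (f (n + 1))\<^sup>2)"
      by (rule mult_left_mono) simp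
    moreover have "mu * (f n * f (n + 1)) \<le> \<bar>mu\<bar> * \<bar>f n * f (n + 1)\<bar>"
      using abs_ge_self[of "mu * (f n * f (n + 1))"] by (simp add: abs_mult)
    ultimately show ?thesis
      unfolding E_def c_def by (simp add: algebra_simps)
  qed
  have E0: "E n \<ge> 0" for n
    using order_trans[OF _ Ege[of n], of 0] c by simp
  have step: "E n - E (n + 1) \<le> q (n + 1) / c * (E (n + 1) + E n)" for n
  proof -
    have "E n - E (n + 1) = (f n - f (n + 2)) * (f (n + 2) + f n - mu * f (n + 1))"
      by (simp add: E_def algebra_simps power2_eq_square)
    also have "f (n + 2) + f n - mu * f (n + 1) = mu * q (n + 1) * f (n + 1)"
      unfolding rec by (simp add: algebra_simps)
    also have "(f n - f (n + 2)) * (mu * q (n + 1) * f (n + 1))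
        = q (n + 1) * (mu * ((f n - f (n + 2)) * f (n + 1)))"
      by (simp add: algebra_simps)
    also have "mu * ((f n - f (n + 2)) * f (n + 1)) \<le> 2 * \<bar>(f n - f (n + 2)) * f (n + 1)\<bar>"
      using mu abs_ge_self[of "mu * ((f n - f (n + 2)) * f (n + 1))"]
        mult_right_mono[of "\<bar>mu\<bar>" 2 "\<bar>(f n - f (n + 2)) * f (n + 1)\<bar>"]
      by (simp add: abs_mult)
    then have "q (n + 1) * (mu * ((f n - f (n + 2)) * f (n + 1)))
        \<le> q (n + 1) * (2 * \<bar>(f n - f (n + 2)) * f (n + 1)\<bar>)"
      by (rule mult_left_mono) (rule q(2))
    also have "2 * \<bar>(f n - f (n + 2)) * f (n + 1)\<bar>
        \<le> (f n)\<^sup>2 + (f (n + 1))\<^sup>2 + ((f (n + 1))\<^sup>2 + (f (n + 2))\<^sup>2)"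
    proof -
      have "2 * ((f n - f (n + 2)) * f (n + 1)) \<le> (f n)\<^sup>2 + (f (n + 1))\<^sup>2 + ((f (n + 1))\<^sup>2 + (f (n + 2))\<^sup>2)"
        using zero_le_power2[of "f n - f (n + 1)"] zero_le_power2[of "f (n + 2) + f (n + 1)"]
        by (simp add: algebra_simps power2_eq_square)
      moreover have "- (2 * ((f n - f (n + 2)) * f (n + 1))) \<le> (f n)\<^sup>2 + (f (n + 1))\<^sup>2 + ((f (n + 1))\<^sup>2 + (f (n + 2))\<^sup>2)"
        using zero_le_power2[of "f n + f (n + 1)"] zero_le_power2[of "f (n + 2) - f (n + 1)"]
        by (simp add: algebra_simps power2_eq_square)
      ultimately show ?thesis by (simp add: abs_if)
    qed
    then have "q (n + 1) * (2 * \<bar>(f n - f (n + 2)) * f (n + 1)\<bar>)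
        \<le> q (n + 1) * ((f n)\<^sup>2 + (f (n + 1))\<^sup>2 + ((f (n + 1))\<^sup>2 + (f (n + 2))\<^sup>2))"
      by (rule mult_left_mono) (rule q(2))
    also have "(f n)\<^sup>2 + (f (n + 1))\<^sup>2 + ((f (n + 1))\<^sup>2 + (f (n + 2))\<^sup>2) \<le> (E (n + 1) + E n) / c"
      using Ege[of n] Ege[of "n + 1"] c by (simp add: field_simps)
    then have "q (n + 1) * ((f n)\<^sup>2 + (f (n + 1))\<^sup>2 + ((f (n + 1))\<^sup>2 + (f (n + 2))\<^sup>2))
        \<le> q (n + 1) * ((E (n + 1) + E n) / c)"
      by (rule mult_left_mono) (rule q(2))
    finally show ?thesis by (simp add: field_simps)
  qed
  have Elim: "E \<longlonglongrightarrow> 0"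
  proof -
    have "(\<lambda>n. f (n + 1)) \<longlonglongrightarrow> 0" using lim by (rule LIMSEQ_ignore_initial_segment)
    then have "E \<longlonglongrightarrow> 0\<^sup>2 + 0\<^sup>2 - mu * 0 * 0"
      unfolding E_def using lim by (intro tendsto_intros)
    then show ?thesis by simp
  qed
  have "summable (\<lambda>n. q (n + 1) / c)"
    using q(1) by (intro summable_divide summable_ignore_initial_segment)
  then obtain m where m: "\<And>k N. k \<ge> m \<Longrightarrow> norm (\<Sum>n=k..<N. q (n + 1) / c) < 1 / 4"
    unfolding summable_Cauchy by (meson zero_less_divide_1_iff zero_less_numeral)
  define S where "S = (SUP n\<in>{m..}. E n)"
  have "Bseq E" using Elim by (intro convergent_imp_Bseq convergentI)
  then have bdd: "bdd_above (E ` {m..})"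
    using bounded_imp_bdd_above[of "range E"] bdd_above_mono[of "range E" "E ` {m..}"]
      image_mono[of "{m..}" UNIV E] by (simp add: Bseq_eq_bounded)
  have ES: "E n \<le> S" if "n \<ge> m" for n
    unfolding S_def by (rule cSUP_upper[OF _ bdd]) (use that in auto)
  have half: "E k \<le> S / 2" if k: "k \<ge> m" for k
  proof -
    have "E k - S / 2 \<le> E N" if "N \<ge> k" for N
    proof -
      have "E k - E N = (\<Sum>n=k..<N. E n - E (n + 1))"
        using sum_Suc_diff'[OF that, of E] by (simp add: sum_subtractf)
      also have "\<dots> \<le> (\<Sum>n=k..<N. q (n + 1) / c * (2 * S))"
      proof (rule sum_mono)
        fix n assume "n \<in> {k..<N}"
        then have "E (n + 1) + E n \<le> 2 * S" using ES[of n] ES[of "n + 1"] k by simp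
        then show "E n - E (n + 1) \<le> q (n + 1) / c * (2 * S)"
          using step[of n] mult_left_mono[of "E (n + 1) + E n" "2 * S" "q (n + 1) / c"] q(2)[of "n + 1"] c
          by simp
      qed
      also have "\<dots> = (\<Sum>n=k..<N. q (n + 1) / c) * (2 * S)" by (simp add: sum_distrib_right)
      also have "\<dots> \<le> 1 / 4 * (2 * S)"
        using m[OF k, of N] ES[of m] E0[of m] by (intro mult_right_mono) auto
      finally show ?thesis by simp
    qed
    then show ?thesis
      using LIMSEQ_le_const[OF Elim, of "E k - S / 2"] by auto
  qed
  have "S \<le> S / 2"
    unfolding S_def by (rule cSUP_least) (use half in \<open>auto simp: S_def\<close>)
  then have zero: "f k = 0" if "k \<ge> m" for k
  proof -
    have "E k \<le> 0" using ES[OF that] \<open>S \<le> S / 2\<close> by simp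
    then have "c * ((f k)\<^sup>2 + (f (k + 1))\<^sup>2) \<le> 0" using Ege[of k] by simp
    then show ?thesis using c by (simp add: mult_le_0_iff sum_power2_le_zero_iff)
  qed
  have "k \<le> m \<Longrightarrow> (\<forall>j\<ge>m - k. f j = 0)" for k
  proof (induction k)
    case (Suc k)
    define i where "i = m - Suc k"
    have i: "m - k = i + 1" using Suc.prems by (simp add: i_def)
    have IH: "f j = 0" if "j \<ge> i + 1" for j using Suc that unfolding i by simp
    have "f i = 0" using rec[of i] IH[of "i + 1"] IH[of "i + 2"] by simp
    then have "f j = 0" if "j \<ge> i" for j using that IH[of j] by (cases "j = i") auto
    then show ?case by (simp add: i_def)
  qed (use zero in auto)
  from this[of m] show ?thesis by simp
qed

text \<open>
  Coefficients of size at least \<open>2\<close> make \<open>f\<close> convex where it is positive. Hence a single step of growth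
  would persist, against the decay.
\<close>

lemma convex_recurrence_decreasing:
  fixes f A :: "nat \<Rightarrow> real"
  assumes A: "\<And>n. A n \<ge> 2"
    and rec: "\<And>n. f (n + 2) + f n = A (n + 1) * f (n + 1)"
    and lim: "f \<longlonglongrightarrow> 0" and start: "f 0 \<ge> 0"
  shows "0 \<le> f (Suc n) \<and> f (Suc n) \<le> f n"
proof -
  have grow: False
    if s: "\<bar>s\<bar> = 1" "s * f (Suc n) > 0" "s * f (Suc n) > s * f n" for n and s :: real
  proof -
    have "s * f (Suc (n + k)) \<ge> s * f (Suc n) \<and> s * f (Suc (n + k)) > s * f (n + k)" for k
    proof (induction k)
      case (Suc k)
      have "A (n + k + 1) * (s * f (n + k + 1)) \<ge> 2 * (s * f (n + k + 1))"
        using Suc s A by (intro mult_right_mono) auto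
      moreover have "s * f (n + k + 2) + s * f (n + k) = A (n + k + 1) * (s * f (n + k + 1))"
        using arg_cong[OF rec[of "n + k"], of "\<lambda>x. s * x"] by (simp add: algebra_simps)
      ultimately show ?case using Suc by simp
    qed (use s in auto)
    then have "s * f (Suc n) \<le> s * f (k + Suc n)" for k by (simp add: add.commute)
    moreover have "(\<lambda>k. s * f (k + Suc n)) \<longlonglongrightarrow> s * 0"
      using lim by (intro tendsto_mult_left LIMSEQ_ignore_initial_segment)
    ultimately have "s * f (Suc n) \<le> s * 0" by (intro LIMSEQ_le_const) auto
    then show False using s(2) by simp
  qed
  have step: "0 \<le> f (Suc n) \<and> f (Suc n) \<le> f n" if "f n \<ge> 0" for n
    using grow[of 1 n] grow[of "-1" n] that by fastforce
  have "f n \<ge> 0" for n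
    by (induction n) (use start step in auto)
  then show ?thesis using step by blast
qed

text \<open>
  The Wronskian \<open>W n = f n * y (n + 1) - f (n + 1) * y n\<close> increases, because the coefficient of \<open>y\<close>
  dominates that of \<open>f\<close>, and it tends to \<open>0\<close>; so \<open>W 0 \<le> 0\<close>.
\<close>

lemma recurrence_comparison:
  fixes f y A Y :: "nat \<Rightarrow> real"
  assumes A: "\<And>n. A n \<ge> 2" and AY: "\<And>n. A (Suc n) \<le> Y (Suc n)"
    and f: "\<And>n. f (n + 2) + f n = A (n + 1) * f (n + 1)" "f \<longlonglongrightarrow> 0" "f 0 \<ge> 0"
    and y: "\<And>n. y (n + 2) + y n = Y (n + 1) * y (n + 1)" "\<And>n. 0 \<le> y n" "\<And>n. y n \<le> C"
  shows "f 0 * y 1 \<le> f 1 * y 0"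
proof -
  have fpos: "f n \<ge> 0" for n
    using convex_recurrence_decreasing[OF A f, of "n - 1"] f(3) by (cases n) auto
  define W where "W n = f n * y (Suc n) - f (Suc n) * y n" for n
  have "W (Suc n) - W n = (Y (n + 1) - A (n + 1)) * (f (n + 1) * y (n + 1))" for n
  proof -
    have "W (Suc n) - W n = f (n + 1) * (y (n + 2) + y n) - y (n + 1) * (f (n + 2) + f n)"
      by (simp add: W_def algebra_simps)
    then show ?thesis unfolding y(1) f(1) by (simp add: algebra_simps)
  qed
  moreover have "(Y (n + 1) - A (n + 1)) * (f (n + 1) * y (n + 1)) \<ge> 0" for n
    using AY[of n] fpos y(2) by simp
  ultimately have "W n \<le> W (Suc n)" for n by (metis diff_ge_0_iff_ge)
  then have "incseq W" by (rule incseq_SucI)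
  moreover have "W \<longlonglongrightarrow> 0"
  proof -
    have b: "Bfun (\<lambda>n. y (n + k)) sequentially" for k
      using y(2,3) by (intro BfunI[of _ C]) auto
    have "Zfun (\<lambda>n. f n * y (n + 1)) sequentially"
      using bounded_bilinear.Zfun_prod_Bfun[OF bounded_bilinear_mult _ b[of 1]] f(2)
      by (simp add: tendsto_Zfun_iff)
    then have "(\<lambda>n. f n * y (n + 1)) \<longlonglongrightarrow> 0" by (simp add: tendsto_Zfun_iff)
    moreover have "Zfun (\<lambda>n. f (n + 1) * y n) sequentially"
      using bounded_bilinear.Zfun_prod_Bfun[OF bounded_bilinear_mult _ b[of 0], of "\<lambda>n. f (n + 1)"]
        LIMSEQ_ignore_initial_segment[OF f(2), of 1]
      by (simp add: tendsto_Zfun_iff)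
    then have "(\<lambda>n. f (n + 1) * y n) \<longlonglongrightarrow> 0" by (simp add: tendsto_Zfun_iff)
    ultimately have "(\<lambda>n. f n * y (n + 1) - f (n + 1) * y n) \<longlonglongrightarrow> 0 - 0" by (rule tendsto_diff)
    then show ?thesis by (simp add: W_def[abs_def])
  qed
  ultimately have "W 0 \<le> 0" by (rule incseq_le)
  then show ?thesis by (simp add: W_def)
qed

text \<open>
  This is \<open>- y (-1) / y 0\<close> for the explicit solution \<open>y n = z^n * (k + 1/(n + t))\<close> of the recurrence with
  \<open>h = 0\<close>, the comparison function in the next lemma.
\<close>

definition shear_ratio :: "real \<Rightarrow> real \<Rightarrow> real \<Rightarrow> real" where
  "shear_ratio z k t = (1 / (1 - t) - k) / (z * (k + 1 / t))"

text \<open>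
  For \<open>hh = 0\<close> the recurrence is solved by \<open>y n = z^n * (k + 1/(n + t))\<close>, where \<open>z\<close> is the decaying root of
  \<open>z + 1/z = mu\<close>. Positive \<open>hh\<close> lowers the coefficients, so \<open>recurrence_comparison\<close> bounds the ratio
  \<open>f 1 / f 0\<close> below by \<open>y 1 / y 0\<close>. The recurrence for \<open>y\<close> at the centre rewrites that quotient through
  \<open>shear_ratio\<close>; the error term has the exact form that appears when two half-lines are matched.
\<close>

lemma decaying_ratio_bounds:
  fixes f :: "nat \<Rightarrow> real" and mu z k t hh :: real
  assumes z: "0 < z" "z \<le> 1" "z + 1 / z = mu" "k * mu = 1 / z - z"
    and t: "0 \<le> t" "t \<le> 1" and hh: "hh > 0"
    and f: "\<And>n. f (n + 2) + f n = mu / (1 - 1 / ((of_nat n + 1 + t)\<^sup>2 + hh)) * f (n + 1)"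
      "f \<longlonglongrightarrow> 0"
  obtains R where "f 1 = R * f 0" "0 \<le> R" "R \<le> 1"
    "f 0 \<noteq> 0 \<Longrightarrow> 0 < t \<Longrightarrow> t\<^sup>2 + hh < 1 \<Longrightarrow>
      R > shear_ratio z k t - mu * (t\<^sup>2 + hh) / (1 - (t\<^sup>2 + hh))"
proof -
  have mu2: "mu \<ge> 2"
  proof -
    have "0 \<le> (1 - z)\<^sup>2 / z" using z by simp
    also have "\<dots> = mu - 2" using z(1) unfolding z(3)[symmetric] by (simp add: field_simps power2_eq_square)
    finally show ?thesis by simp
  qed
  have k0: "k \<ge> 0"
  proof -
    have "1 / z \<ge> 1" using z by simp
    then have "k * mu \<ge> 0" using z(2) unfolding z(4) by linarith
    then show ?thesis using mu2 by (simp add: zero_le_mult_iff)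
  qed
  define A where "A n = mu / (1 - 1 / ((of_nat n + t)\<^sup>2 + hh))" for n :: nat
  have d: "0 < 1 - 1 / ((of_nat (Suc n) + t)\<^sup>2 + hh)" "1 - 1 / ((of_nat (Suc n) + t)\<^sup>2 + hh) < 1" for n
  proof -
    define s where "s = (of_nat (Suc n) + t)\<^sup>2"
    have "s \<ge> 1" using t by (simp add: s_def)
    then have "0 < 1 - 1 / (s + hh)" "1 - 1 / (s + hh) < 1"
      using hh by (auto simp: field_simps intro: add_pos_pos)
    then show "0 < 1 - 1 / ((of_nat (Suc n) + t)\<^sup>2 + hh)" "1 - 1 / ((of_nat (Suc n) + t)\<^sup>2 + hh) < 1"
      unfolding s_def by auto
  qed
  have A2: "2 \<le> A (Suc n)" for n
  proof -
    have "mu / 1 \<le> A (Suc n)" unfolding A_def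
      using mu2 d[of n] by (intro divide_left_mono) auto
    then show ?thesis using mu2 by simp
  qed
  \<comment> \<open>The coefficient at \<open>0\<close> does not occur in the recurrence and may be singular; it is replaced by \<open>2\<close>.\<close>
  define A' where "A' n = (if n = 0 then 2 else A n)" for n
  have A': "A' n \<ge> 2" for n
    using A2[of "n - 1"] by (auto simp: A'_def)
  define s where "s = (if f 0 < 0 then - 1 else 1 :: real)"
  have s: "s * f 0 \<ge> 0" "s \<noteq> 0" by (auto simp: s_def)
  define F where "F n = s * f n" for n
  have F: "F (n + 2) + F n = A' (n + 1) * F (n + 1)" for n
    using arg_cong[OF f(1)[of n], of "\<lambda>x. s * x"]
    by (simp add: F_def A'_def A_def algebra_simps)
  have Flim: "F \<longlonglongrightarrow> 0" unfolding F_def using tendsto_mult_left[OF f(2), of s] by simp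
  have F0: "F 0 \<ge> 0" using s by (simp add: F_def)
  have mono: "0 \<le> F 1 \<and> F 1 \<le> F 0"
    using convex_recurrence_decreasing[OF A' F Flim F0, of 0] by simp
  define R where "R = F 1 / F 0"
  have fR: "f 1 = R * f 0"
    using mono s(2) by (cases "f 0 = 0") (auto simp: R_def F_def)
  \<comment> \<open>The identity that makes \<open>y\<close> a solution; it determines \<open>k\<close>.\<close>
  have core: "z * (k + 1 / (x + 1)) + (k + 1 / (x - 1)) / z = mu / (1 - 1 / x\<^sup>2) * (k + 1 / x)"
    if x: "x \<noteq> 0" "x\<^sup>2 \<noteq> 1" for x
  proof -
    have x': "x + 1 \<noteq> 0" "x - 1 \<noteq> 0"
      using x(2) power2_eq_1_iff[of x] by (auto simp: eq_neg_iff_add_eq_0)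
    have x2: "x\<^sup>2 - 1 = (x - 1) * (x + 1)" by (simp add: algebra_simps power2_eq_square)
    have frac: "1 / (x + 1) = (x - 1) / (x\<^sup>2 - 1)" "1 / (x - 1) = (x + 1) / (x\<^sup>2 - 1)"
      unfolding x2 using x' by simp_all
    have "z * (k + 1 / (x + 1)) + (k + 1 / (x - 1)) / z
        = k * (z + 1 / z) + (z * (x - 1) + (1 / z) * (x + 1)) / (x\<^sup>2 - 1)"
    proof -
      have "z * (k + a / D) + (k + b / D) / z = k * (z + 1 / z) + (z * a + (1 / z) * b) / D" for a b D
        by (simp add: algebra_simps add_divide_distrib)
      then show ?thesis unfolding frac .
    qed
    also have "z * (x - 1) + (1 / z) * (x + 1) = (z + 1 / z) * x + (1 / z - z)"
      by (simp add: algebra_simps add_divide_distrib)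
    also have "k * (z + 1 / z) + ((z + 1 / z) * x + (1 / z - z)) / (x\<^sup>2 - 1) = k * mu + (mu * x + k * mu) / (x\<^sup>2 - 1)"
      unfolding z(3,4) ..
    also have "\<dots> = mu / (1 - 1 / x\<^sup>2) * (k + 1 / x)"
    proof -
      define X where "X = x\<^sup>2"
      have X: "X \<noteq> 1" "X \<noteq> 0" "x / X = 1 / x" using x by (auto simp: X_def power2_eq_square)
      have "k * mu + (mu * x + k * mu) / (X - 1) = mu * (k + x / X) * X / (X - 1)"
        using X(1,2) by (simp add: field_simps)
      also have "X / (X - 1) = 1 / (1 - 1 / X)" using X(1,2) by (simp add: field_simps)
      then have "mu * (k + x / X) * X / (X - 1) = mu * (k + x / X) * (1 / (1 - 1 / X))"
        by (metis times_divide_eq_right)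
      finally show ?thesis unfolding X(3) by (simp add: X_def)
    qed
    finally show ?thesis .
  qed
  show ?thesis
  proof (rule that[OF fR])
    show "0 \<le> R" using mono F0 by (simp add: R_def)
    show "R \<le> 1" using mono F0 by (simp add: R_def divide_le_eq)
    assume f0: "f 0 \<noteq> 0" and t0: "0 < t" and small: "t\<^sup>2 + hh < 1"
    then have F0': "F 0 > 0" using F0 s(2) by (simp add: F_def less_le)
    define Y where "Y n = mu / (1 - 1 / ((of_nat n + t)\<^sup>2))" for n :: nat
    have sq: "(of_nat (Suc n) + t)\<^sup>2 > 1" for n
      using power_strict_mono[of 1 "of_nat (Suc n) + t" 2] t0 by simp
    have AY: "A' (Suc n) \<le> Y (Suc n)" for n
    proof -
      have "0 < 1 - 1 / s" if "s > 1" for s :: real using that by (simp add: field_simps)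
      from this[OF sq] have "0 < 1 - 1 / ((of_nat (Suc n) + t)\<^sup>2)" .
      moreover have "1 - 1 / ((of_nat (Suc n) + t)\<^sup>2) \<le> 1 - 1 / ((of_nat (Suc n) + t)\<^sup>2 + hh)"
        using sq[of n] hh by (intro diff_left_mono divide_left_mono) (auto intro!: mult_pos_pos add_pos_pos)
      ultimately have "mu / (1 - 1 / ((of_nat (Suc n) + t)\<^sup>2 + hh)) \<le> mu / (1 - 1 / ((of_nat (Suc n) + t)\<^sup>2))"
        using mu2 by (intro divide_left_mono mult_pos_pos) linarith+
      then show ?thesis unfolding A'_def A_def Y_def by simp
    qed
    define y where "y n = z ^ n * (k + 1 / (of_nat n + t))" for n :: nat
    have ypos: "y n > 0" for n
      unfolding y_def using z k0 t0 by (intro mult_pos_pos add_nonneg_pos) auto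
    have ybd: "y n \<le> k + 1 / t" for n
    proof -
      have "z ^ n * (k + 1 / (of_nat n + t)) \<le> 1 * (k + 1 / (of_nat n + t))"
        using z k0 t0 by (intro mult_right_mono power_le_one) auto
      also have "\<dots> \<le> k + 1 / t" using t0 by (auto intro!: divide_left_mono)
      finally show ?thesis by (simp add: y_def)
    qed
    have yrec: "y (n + 2) + y n = Y (n + 1) * y (n + 1)" for n
    proof -
      define x where "x = of_nat n + 1 + t"
      have "x = of_nat (Suc n) + t" by (simp add: x_def)
      then have x: "x \<noteq> 0" "x\<^sup>2 \<noteq> 1" using sq[of n] by auto
      have "y (n + 2) + y n = z ^ (n + 1) * (z * (k + 1 / (x + 1)) + (k + 1 / (x - 1)) / z)"
      proof -
        have "z ^ (n + 1) * (z * a + b / z) = z ^ (n + 2) * a + z ^ n * b" for a b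
          using z(1) by (simp add: field_simps)
        moreover have "of_nat (n + 2) + t = x + 1" "of_nat n + t = x - 1" by (simp_all add: x_def)
        ultimately show ?thesis unfolding y_def by metis
      qed
      moreover have "Y (n + 1) = mu / (1 - 1 / x\<^sup>2)" "y (n + 1) = z ^ (n + 1) * (k + 1 / x)"
        by (simp_all add: Y_def y_def x_def add.commute)
      ultimately show ?thesis unfolding core[OF x] by simp
    qed
    have cmp: "F 0 * y 1 \<le> F 1 * y 0"
      using recurrence_comparison[OF A' AY F Flim F0 yrec _ ybd] F0 ypos by (simp add: less_imp_le)
    have t1: "t < 1"
    proof (rule ccontr)
      assume "\<not> t < 1" then have "t\<^sup>2 \<ge> 1" by simp
      then show False using small hh by simp
    qed
    have tsq: "t\<^sup>2 < 1" using small hh by linarith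
    have h1: "y 1 / y 0 \<le> R" unfolding R_def using cmp ypos[of 0] F0' by (simp add: field_simps)
    have h2: "y 1 / y 0 = shear_ratio z k t - mu * t\<^sup>2 / (1 - t\<^sup>2)"
    proof -
      have y1: "y 1 = mu / (1 - 1 / t\<^sup>2) * (k + 1 / t) - (k + 1 / (t - 1)) / z"
      proof -
        have "y 1 = z * (k + 1 / (t + 1))" by (simp add: y_def add.commute)
        moreover have "t \<noteq> 0" "t\<^sup>2 \<noteq> 1" using t0 tsq by auto
        ultimately show ?thesis using core[of t] by linarith
      qed
      then have "y 1 / y 0 = mu / (1 - 1 / t\<^sup>2) - ((k + 1 / (t - 1)) / z) / (k + 1 / t)"
      proof -
        have y0: "y 0 = k + 1 / t" by (simp add: y_def)
        have gen: "(a * b - c) / b = a - c / b" if "b > 0" for a b c :: real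
          using that by (simp add: field_simps)
        show ?thesis unfolding y0 y1 by (rule gen) (use ypos[of 0] in \<open>unfold y0\<close>)
      qed
      also have "mu / (1 - 1 / t\<^sup>2) = - (mu * t\<^sup>2 / (1 - t\<^sup>2))"
      proof -
        have "1 - 1 / X = - ((1 - X) / X)" if "0 < X" for X :: real
          using that by (simp add: field_simps)
        from this[of "t\<^sup>2"] show ?thesis using t0 by simp
      qed
      also have "((k + 1 / (t - 1)) / z) / (k + 1 / t) = - shear_ratio z k t"
      proof -
        have "1 / (t - 1) = - (1 / (1 - t))"
          by (metis minus_diff_eq minus_divide_right)
        then have e: "(k + 1 / (t - 1)) = - (1 / (1 - t) - k)" by simp
        show ?thesis unfolding e shear_ratio_def by (simp only: minus_divide_left divide_divide_eq_left)
      qed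
      finally show ?thesis by (simp only: diff_minus_eq_add add.commute minus_add_cancel uminus_add_conv_diff)
    qed
    have h3: "mu * t\<^sup>2 / (1 - t\<^sup>2) < mu * (t\<^sup>2 + hh) / (1 - (t\<^sup>2 + hh))"
      using mu2 hh small t0 by (intro frac_less) auto
    have "R > a - c" if "p \<le> R" "p = a - b" "b < c" for a b c p :: real
      using that by linarith
    from this[OF h1 h2 h3] show "R > shear_ratio z k t - mu * (t\<^sup>2 + hh) / (1 - (t\<^sup>2 + hh))" .
  qed
qed

lemma shear_ratio_pos:
  assumes "0 < t" "t < 1" "0 < z" "0 \<le> k" "k < 1"
  shows "shear_ratio z k t > 0"
proof -
  have "1 / (1 - t) > 1" using assms by simp
  then have "1 / (1 - t) - k > 0" using assms by linarith
  then show ?thesis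
    unfolding shear_ratio_def using assms by (intro divide_pos_pos mult_pos_pos add_nonneg_pos) auto
qed

text \<open>
  Substituting \<open>z^2 = (1 - k)/(1 + k)\<close> reduces the inequality to \<open>k^3 * t * (1 - t) \<ge> 0\<close>.
\<close>

lemma shear_ratio_product:
  assumes t: "0 < t" "t < 1" and z: "0 < z" "z \<le> 1" and k: "k * (z + 1 / z) = 1 / z - z"
  shows "shear_ratio z k t * shear_ratio z k (1 - t) \<ge> 1"
proof -
  have kz: "k * (1 + z\<^sup>2) = 1 - z\<^sup>2"
    using arg_cong[OF k, of "\<lambda>x. x * z"] z by (simp add: algebra_simps power2_eq_square)
  have k0: "k \<ge> 0" "k < 1"
  proof -
    have zz: "0 < z\<^sup>2" "z\<^sup>2 \<le> 1" using z power_le_one[of z 2] by auto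
    then have "k * (1 + z\<^sup>2) \<ge> 0" using kz by simp
    then show "k \<ge> 0" using zz by (simp add: zero_le_mult_iff)
    have "k * (1 + z\<^sup>2) < 1 * (1 + z\<^sup>2)" using kz zz by simp
    then show "k < 1" using zz by (simp add: mult_less_cancel_right)
  qed
  define u where "u = t * (1 - t)"
  have u: "u > 0" using t by (simp add: u_def)
  define N where "N = (1 - k * (1 - t)) * (1 - k * t)"
  define M where "M = (1 + k * t) * (1 + k * (1 - t))"
  have NM: "N = 1 - k + k\<^sup>2 * u" "M = 1 + k + k\<^sup>2 * u"
    by (simp_all add: N_def M_def u_def algebra_simps power2_eq_square)
  have Mpos: "M > 0" unfolding NM using k0 u by (intro add_pos_nonneg) auto
  have "shear_ratio z k t * shear_ratio z k (1 - t) = N / (z\<^sup>2 * M)"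
  proof -
    have e1: "1 / (1 - t) - k = (1 - k * (1 - t)) / (1 - t)" "k + 1 / t = (1 + k * t) / t"
      "1 / t - k = (1 - k * t) / t" "k + 1 / (1 - t) = (1 + k * (1 - t)) / (1 - t)"
      using t by (auto simp: field_simps)
    have "1 + k * t > 0" "1 + k * (1 - t) > 0" using t k0 by (auto intro!: add_pos_nonneg)
    then show ?thesis
      unfolding shear_ratio_def N_def M_def using t z by (simp add: e1 power2_eq_square)
  qed
  also have "\<dots> \<ge> 1"
  proof -
    have zz: "z\<^sup>2 * (1 + k) = 1 - k" using kz by (simp add: algebra_simps)
    have "z\<^sup>2 * M * (1 + k) = (1 - k) * M" unfolding zz[symmetric] by (simp add: algebra_simps)
    also have "\<dots> = N * (1 + k) - 2 * k * (k\<^sup>2 * u)" unfolding NM by (simp add: algebra_simps)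
    also have "\<dots> \<le> N * (1 + k)" using k0 u by simp
    finally have "z\<^sup>2 * M \<le> N" using k0 by (simp add: mult_le_cancel_right)
    then show ?thesis using Mpos z by (simp add: field_simps)
  qed
  finally show ?thesis .
qed

text \<open>
  The line is cut between the points \<open>0\<close> and \<open>1\<close>, the two nearest to the centre \<open>t\<close>; all other weights are
  positive, so each half-line carries a recurrence with regular coefficients. For \<open>mu \<ge> 2\<close> let \<open>R\<close> and
  \<open>Q\<close> be the ratios of consecutive values at the cut and \<open>r1\<close>, \<open>r0\<close> the weights of the central points.
  Matching requires \<open>(mu - r1 * R) * (mu - r0 * Q) = r1 * r0\<close>. The left-hand side is at least \<open>1\<close>, which
  forces both weights to be negative; and then \<open>shear_ratio_product\<close> makes it exceed the right-hand side.
\<close>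

lemma neutral_chain_trivial_normalised:
  fixes g :: "int \<Rightarrow> real" and mu t hh :: real
  assumes t: "0 \<le> t" "t < 1" and hh: "hh > 0"
    and rec: "\<And>n. mu * g n = (1 - 1 / ((of_int n - t)\<^sup>2 + hh)) * (g (n + 1) + g (n - 1))"
    and lim: "(\<lambda>n. g (int n)) \<longlonglongrightarrow> 0" "(\<lambda>n. g (- int n)) \<longlonglongrightarrow> 0"
    and mu: "mu > - 2"
  shows "g n = 0"
proof -
  define f where "f n = g (int n + 1)" for n
  define l where "l n = g (- int n)" for n
  have flim: "f \<longlonglongrightarrow> 0"
    using LIMSEQ_ignore_initial_segment[OF lim(1), of 1] unfolding f_def by (simp add: add.commute)
  have llim: "l \<longlonglongrightarrow> 0" using lim(2) unfolding l_def .
  have ne: "1 - 1 / ((of_nat n + 1 + x)\<^sup>2 + hh) \<noteq> 0" if "x \<ge> 0" for n and x :: real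
  proof -
    have "(of_nat n + 1 + x)\<^sup>2 \<ge> 1" using that by simp
    then have "(of_nat n + 1 + x)\<^sup>2 + hh > 1" using hh by linarith
    then show ?thesis by (simp add: field_simps)
  qed
  have frec: "f (n + 2) + f n = mu / (1 - 1 / ((of_nat n + 1 + (1 - t))\<^sup>2 + hh)) * f (n + 1)" for n
  proof -
    have "mu * f (n + 1) = (1 - 1 / ((of_nat n + 1 + (1 - t))\<^sup>2 + hh)) * (f (n + 2) + f n)"
      using rec[of "int n + 2"] by (simp add: f_def algebra_simps)
    then show ?thesis using ne[of "1 - t" n] t by (simp add: field_simps)
  qed
  have lrec: "l (n + 2) + l n = mu / (1 - 1 / ((of_nat n + 1 + t)\<^sup>2 + hh)) * l (n + 1)" for n
  proof -
    have e: "of_int (- 1 - int n) - t = - (of_nat n + 1 + t)" by simp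
    have "mu * l (n + 1) = (1 - 1 / ((of_nat n + 1 + t)\<^sup>2 + hh)) * (l (n + 2) + l n)"
      using rec[of "- 1 - int n"] unfolding e power2_minus by (simp add: l_def algebra_simps)
    then show ?thesis using ne[of t n] t by (simp add: field_simps)
  qed
  have fl: "(\<forall>n. f n = 0) \<and> (\<forall>n. l n = 0)"
  proof (cases "mu < 2")
    case True
    have half: "h n = 0"
      if x: "x \<ge> 0" and h: "\<And>n. h (n + 2) + h n = mu / (1 - 1 / ((of_nat n + 1 + x)\<^sup>2 + hh)) * h (n + 1)" "h \<longlonglongrightarrow> 0"
      for h :: "nat \<Rightarrow> real" and x n
    proof -
      define q where "q n = (if n = 0 then 0 else 1 / ((of_nat n + x)\<^sup>2 + hh - 1))" for n :: nat
      have sq: "(of_nat n + x)\<^sup>2 \<ge> (of_nat n)\<^sup>2" for n :: nat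
        using x by (intro power_mono) auto
      have n1: "(of_nat n)\<^sup>2 \<ge> (1::real)" if "n \<noteq> 0" for n :: nat using that by simp
      \<comment> \<open>\<open>1/(1 - 1/s) = 1 + 1/(s - 1)\<close> displays the coefficient as a summable perturbation of \<open>mu\<close>.\<close>
      have q0: "q n \<ge> 0" for n
      proof (cases "n = 0")
        case False
        then have "(of_nat n + x)\<^sup>2 + hh - 1 \<ge> 0" using sq[of n] n1[of n] hh by linarith
        then show ?thesis by (simp add: q_def)
      qed (simp add: q_def)
      have "summable (\<lambda>n. inverse ((real n)\<^sup>2))"
        by (rule inverse_power_summable) auto
      then have "summable (\<lambda>n. (1 + 1 / hh) * inverse ((real n)\<^sup>2))" by (rule summable_mult)
      then have qs: "summable q"
      proof (rule summable_comparison_test[rotated], intro exI[of _ 1] allI impI)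
        fix n :: nat assume n: "n \<ge> 1"
        define s where "s = (real n)\<^sup>2"
        have s: "s \<ge> 1" using n by (simp add: s_def)
        have "q n \<le> 1 / (s + hh - 1)"
        proof -
          have "s + hh - 1 > 0" "(of_nat n + x)\<^sup>2 \<ge> s" using sq[of n] s hh by (auto simp: s_def)
          then have "1 / ((of_nat n + x)\<^sup>2 + hh - 1) \<le> 1 / (s + hh - 1)"
            by (intro divide_left_mono mult_pos_pos) auto
          then show ?thesis using n by (simp add: q_def)
        qed
        also have "\<dots> \<le> (1 + 1 / hh) * inverse s"
        proof -
          have "(hh + 1) * (s + hh - 1) = s * hh + ((s - 1) + hh * hh)" by (simp add: algebra_simps)
          moreover have "(s - 1) + hh * hh \<ge> 0" using s by (intro add_nonneg_nonneg) auto
          ultimately have "s * hh \<le> (hh + 1) * (s + hh - 1)" by linarith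
          then show ?thesis using s hh by (simp add: field_simps)
        qed
        finally show "norm (q n) \<le> (1 + 1 / hh) * inverse ((real n)\<^sup>2)"
          using q0[of n] by (simp add: s_def)
      qed
      have "h (n + 2) + h n = mu * (1 + q (n + 1)) * h (n + 1)" for n
      proof -
        define s where "s = (of_nat n + 1 + x)\<^sup>2 + hh"
        have "(of_nat (n + 1) + x)\<^sup>2 + hh > 1"
          using sq[of "n + 1"] n1[of "n + 1"] hh by linarith
        then have "s > 1" by (simp add: s_def add.commute)
        then have "1 / (1 - 1 / s) = 1 + 1 / (s - 1)" by (simp add: field_simps)
        then have "mu / (1 - 1 / s) = mu * (1 + 1 / (s - 1))"
          by (metis times_divide_eq_right mult.right_neutral)
        moreover have "q (n + 1) = 1 / (s - 1)" by (simp add: q_def s_def add.commute)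
        ultimately show ?thesis using h(1)[of n] by (simp add: s_def)
      qed
      then show ?thesis
        using bounded_recurrence_trivial[of mu q h n] True mu qs q0 h(2) by auto
    qed
    show ?thesis
      using half[OF _ frec flim] half[OF _ lrec llim] t by auto
  next
    case False
    then have mu2: "mu \<ge> 2" by simp
    \<comment> \<open>The root of \<open>z + 1/z = mu\<close> in \<open>{0<..1}\<close>.\<close>
    define z where "z = (mu - sqrt (mu\<^sup>2 - 4)) / 2"
    have mm: "mu\<^sup>2 \<ge> 4" using power_mono[OF mu2, of 2] by simp
    have s4: "(sqrt (mu\<^sup>2 - 4))\<^sup>2 = mu\<^sup>2 - 4" using mm by simp
    have zq: "z * (mu - z) = 1"
      using s4 by (simp add: z_def algebra_simps power2_eq_square add_divide_distrib diff_divide_distrib)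
    have "sqrt (mu\<^sup>2 - 4) < mu"
      using mu2 by (intro real_less_lsqrt) auto
    then have z0: "z > 0" by (simp add: z_def)
    have z1: "z \<le> 1"
    proof (rule ccontr)
      assume z1: "\<not> z \<le> 1"
      have "sqrt (mu\<^sup>2 - 4) \<ge> 0" using mm by simp
      then have "mu - z \<ge> z" by (simp add: z_def field_simps)
      then have "1 < mu - z" using z1 by simp
      then have "1 < z * (mu - z)" using z1 less_1_mult[of z "mu - z"] by simp
      then show False using zq by simp
    qed
    have zm: "z + 1 / z = mu" using zq z0 by (simp add: field_simps)
    define k where "k = (1 / z - z) / mu"
    have k: "k * mu = 1 / z - z" using mu2 by (simp add: k_def)
    obtain R where R: "f 1 = R * f 0" "0 \<le> R" "R \<le> 1"
      "f 0 \<noteq> 0 \<Longrightarrow> 0 < 1 - t \<Longrightarrow> (1 - t)\<^sup>2 + hh < 1 \<Longrightarrow>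
       R > shear_ratio z k (1 - t) - mu * ((1 - t)\<^sup>2 + hh) / (1 - ((1 - t)\<^sup>2 + hh))"
      by (rule decaying_ratio_bounds[OF z0 z1 zm k _ _ hh frec flim]) (use t in auto)
    obtain Q where Q: "l 1 = Q * l 0" "0 \<le> Q" "Q \<le> 1"
      "l 0 \<noteq> 0 \<Longrightarrow> 0 < t \<Longrightarrow> t\<^sup>2 + hh < 1 \<Longrightarrow>
       Q > shear_ratio z k t - mu * (t\<^sup>2 + hh) / (1 - (t\<^sup>2 + hh))"
      by (rule decaying_ratio_bounds[OF z0 z1 zm k _ _ hh lrec llim]) (use t in auto)
    define r1 where "r1 = 1 - 1 / ((1 - t)\<^sup>2 + hh)"
    define r0 where "r0 = 1 - 1 / (t\<^sup>2 + hh)"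
    have spos: "t\<^sup>2 + hh > 0" "(1 - t)\<^sup>2 + hh > 0" using hh by (auto intro: add_nonneg_pos)
    have r: "r1 < 1" "r0 < 1" using spos by (auto simp: r1_def r0_def)
    have e1: "(mu - r1 * R) * f 0 = r1 * l 0"
    proof -
      have "mu * g 1 = r1 * (g 2 + g 0)" using rec[of 1] by (simp add: r1_def)
      then show ?thesis using R(1) by (simp add: f_def l_def algebra_simps)
    qed
    have e0: "(mu - r0 * Q) * l 0 = r0 * f 0"
    proof -
      have "mu * g 0 = r0 * (g 1 + g (- 1))" using rec[of 0] by (simp add: r0_def)
      then show ?thesis using Q(1) by (simp add: f_def l_def algebra_simps)
    qed
    have b: "r1 * R \<le> 1" "r0 * Q \<le> 1"
      using mult_mono[of r1 1 R 1] mult_mono[of r0 1 Q 1] r R(2,3) Q(2,3) by auto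
    have "f 0 = 0 \<or> l 0 = 0"
    proof (rule ccontr)
      assume "\<not> (f 0 = 0 \<or> l 0 = 0)"
      then have nz: "f 0 \<noteq> 0" "l 0 \<noteq> 0" by auto
      have "((mu - r1 * R) * (mu - r0 * Q)) * (f 0 * l 0) = (r1 * r0) * (f 0 * l 0)"
        using arg_cong2[OF e1 e0, of "(*)"] by (simp add: algebra_simps)
      then have eq: "(mu - r1 * R) * (mu - r0 * Q) = r1 * r0" using nz by simp
      have ge1: "mu - r1 * R \<ge> 1" "mu - r0 * Q \<ge> 1" using b mu2 by auto
      have prod1: "(mu - r1 * R) * (mu - r0 * Q) \<ge> 1"
        using mult_mono[OF ge1] ge1 by simp
      then have "r1 * r0 \<ge> 1" using eq by simp
      then have neg: "r1 < 0" "r0 < 0"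
      proof -
        have "\<not> (r1 \<ge> 0)"
        proof
          assume "r1 \<ge> 0"
          then have "r1 * r0 \<le> r1 * 1" using r by (intro mult_left_mono) auto
          then show False using \<open>r1 * r0 \<ge> 1\<close> r by simp
        qed
        then show "r1 < 0" by simp
        then show "r0 < 0" using \<open>r1 * r0 \<ge> 1\<close> by (smt (verit) mult_nonpos_nonneg)
      qed
      define s1 where "s1 = (1 - t)\<^sup>2 + hh"
      define s0 where "s0 = t\<^sup>2 + hh"
      have s: "s1 < 1" "s0 < 1" "0 < s1" "0 < s0"
        using neg spos by (auto simp: r1_def r0_def s1_def s0_def field_simps)
      have t0: "t > 0"
      proof (rule ccontr)
        assume "\<not> t > 0" then have "t = 0" using t by simp
        then show False using s(1) hh by (simp add: s1_def)
      qed
      have k1: "0 \<le> k" "k < 1"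
      proof -
        have "1 / z \<ge> 1" using z0 z1 by simp
        then show "0 \<le> k" using z1 mu2 by (simp add: k_def)
        have "1 / z - z < mu" using zm z0 by linarith
        then show "k < 1" using mu2 by (simp add: k_def)
      qed
      have "R + mu * s1 / (1 - s1) > shear_ratio z k (1 - t)" "Q + mu * s0 / (1 - s0) > shear_ratio z k t"
        using R(4) Q(4) nz t t0 s by (auto simp: s1_def s0_def)
      moreover have "mu - r1 * R = (- r1) * (R + mu * s1 / (1 - s1))" "mu - r0 * Q = (- r0) * (Q + mu * s0 / (1 - s0))"
      proof -
        have r: "r1 = 1 - 1 / s1" "r0 = 1 - 1 / s0" by (simp_all add: r1_def r0_def s1_def s0_def)
        show "mu - r1 * R = (- r1) * (R + mu * s1 / (1 - s1))" "mu - r0 * Q = (- r0) * (Q + mu * s0 / (1 - s0))"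
          unfolding r using s by (simp_all add: field_simps)
      qed
      moreover have "shear_ratio z k t > 0" "shear_ratio z k (1 - t) > 0"
        using shear_ratio_pos t0 t z0 k1 by auto
      moreover have "shear_ratio z k t * shear_ratio z k (1 - t) \<ge> 1"
        using shear_ratio_product[OF t0 t(2) z0 z1] k unfolding zm by blast
      ultimately have "(R + mu * s1 / (1 - s1)) * (Q + mu * s0 / (1 - s0)) > 1"
        using mult_strict_mono[of "shear_ratio z k (1 - t)" "R + mu * s1 / (1 - s1)" "shear_ratio z k t" "Q + mu * s0 / (1 - s0)"]
        by (simp add: mult.commute)
      then have "(r1 * r0) * ((R + mu * s1 / (1 - s1)) * (Q + mu * s0 / (1 - s0))) > (r1 * r0) * 1"
        using neg by (intro mult_strict_left_mono mult_neg_neg) auto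
      moreover have "(mu - r1 * R) * (mu - r0 * Q) = (r1 * r0) * ((R + mu * s1 / (1 - s1)) * (Q + mu * s0 / (1 - s0)))"
        using \<open>mu - r1 * R = _\<close> \<open>mu - r0 * Q = _\<close> by simp
      ultimately show False using eq by simp
    qed
    then have z00: "f 0 = 0" "l 0 = 0" using e0 e1 b mu2 by auto
    have "h n = 0"
      if x: "x \<ge> 0" and h: "\<And>n. h (n + 2) + h n = mu / (1 - 1 / ((of_nat n + 1 + x)\<^sup>2 + hh)) * h (n + 1)"
        "h 1 = 0" "h 0 = 0"
      for h :: "nat \<Rightarrow> real" and x n
    proof -
      have "h n = 0 \<and> h (n + 1) = 0" for n
      proof (induction n)
        case (Suc n)
        then show ?case using h(1)[of n] by simp
      qed (use h in auto)
      then show ?thesis by blast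
    qed
    from this[OF _ frec] this[OF _ lrec] show ?thesis
      using t z00 R(1) Q(1) by auto
  qed
  show ?thesis
  proof (cases "n \<ge> 1")
    case True
    then show ?thesis using fl[THEN conjunct1, rule_format, of "nat (n - 1)"] by (simp add: f_def)
  next
    case False
    then show ?thesis using fl[THEN conjunct2, rule_format, of "nat (- n)"] by (simp add: l_def)
  qed
qed

text \<open>
  An integer shift moves \<open>t\<close> into \<open>{0..<1}\<close>, and \<open>(-1)^n * g n\<close> solves the recurrence for \<open>- mu\<close>.
\<close>

theorem neutral_chain_trivial:
  fixes g :: "int \<Rightarrow> real" and mu t hh :: real
  assumes hh: "hh > 0"
    and rec: "\<And>n. mu * g n = (1 - 1 / ((of_int n - t)\<^sup>2 + hh)) * (g (n + 1) + g (n - 1))"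
    and lim: "(\<lambda>n. g (int n)) \<longlonglongrightarrow> 0" "(\<lambda>n. g (- int n)) \<longlonglongrightarrow> 0"
  shows "g n = 0"
proof -
  define m where "m = \<lfloor>t\<rfloor>"
  define s :: "int \<Rightarrow> real" where "s n = (if mu > - 2 \<or> even n then 1 else - 1)" for n
  define mu' where "mu' = (if mu > - 2 then mu else - mu)"
  define h where "h n = s n * g (n + m)" for n
  have "h (n - m) = 0"
  proof (rule neutral_chain_trivial_normalised[of "t - m" hh mu'])
    show "0 \<le> t - m" "t - m < 1" unfolding m_def by linarith+
    show "hh > 0" by fact
    show "mu' > - 2" by (auto simp: mu'_def)
    show "mu' * h n = (1 - 1 / ((of_int n - (t - m))\<^sup>2 + hh)) * (h (n + 1) + h (n - 1))" for n
    proof -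
      define r where "r = 1 - 1 / ((of_int n - (t - m))\<^sup>2 + hh)"
      have shift: "s (n + 1) = (if mu > - 2 then s n else - s n)" "s (n - 1) = (if mu > - 2 then s n else - s n)"
        by (auto simp: s_def)
      have "mu * g (n + m) = r * (g (n + 1 + m) + g (n - 1 + m))"
        unfolding r_def using rec[of "n + m"] by (simp add: algebra_simps)
      then have "s n * (mu * g (n + m)) = s n * (r * (g (n + 1 + m) + g (n - 1 + m)))" by simp
      then have "mu' * h n = r * (h (n + 1) + h (n - 1))"
        using shift by (cases "mu > - 2") (simp_all add: mu'_def h_def algebra_simps)
      then show ?thesis by (simp add: r_def)
    qed
    have g0: "(\<lambda>n. \<bar>g (int n + k)\<bar>) \<longlonglongrightarrow> 0" for k
    proof -
      have "(\<lambda>n. g (int (n + nat k))) \<longlonglongrightarrow> 0"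
        using lim(1) by (rule LIMSEQ_ignore_initial_segment)
      moreover have "(\<lambda>n. g (int (n + nat (- k)) + k)) = (\<lambda>n. g (int (n + nat k)))"
        by (rule ext) (simp add: add.assoc)
      ultimately have "(\<lambda>n. g (int (n + nat (- k)) + k)) \<longlonglongrightarrow> 0" by simp
      then have "(\<lambda>n. g (int n + k)) \<longlonglongrightarrow> 0" by (rule LIMSEQ_offset)
      then show ?thesis by (rule tendsto_rabs_zero)
    qed
    have g1: "(\<lambda>n. \<bar>g (- int n + k)\<bar>) \<longlonglongrightarrow> 0" for k
    proof -
      have "(\<lambda>n. g (- int (n + nat (- k)))) \<longlonglongrightarrow> 0"
        using lim(2) LIMSEQ_ignore_initial_segment[of "\<lambda>n. g (- int n)"] by blast
      moreover have "(\<lambda>n. g (- int (n + nat k) + k)) = (\<lambda>n. g (- int (n + nat (- k))))"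
        by (rule ext, rule arg_cong[of _ _ g]) auto
      ultimately have "(\<lambda>n. g (- int (n + nat k) + k)) \<longlonglongrightarrow> 0" by simp
      then have "(\<lambda>n. g (- int n + k)) \<longlonglongrightarrow> 0"
        using LIMSEQ_offset[of "\<lambda>n. g (- int n + k)" "nat k"] by simp
      then show ?thesis by (rule tendsto_rabs_zero)
    qed
    have abs: "\<bar>h n\<bar> = \<bar>g (n + m)\<bar>" for n by (simp add: h_def s_def)
    show "(\<lambda>n. h (int n)) \<longlonglongrightarrow> 0" "(\<lambda>n. h (- int n)) \<longlonglongrightarrow> 0"
      using g0[of m] g1[of m] unfolding abs[symmetric] by (auto intro: tendsto_rabs_zero_cancel)
  qed
  then show ?thesis by (simp add: h_def s_def split: if_splits)
qed

section \<open>The linearised operator on the Fourier lattice\<close>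

definition seq_scale :: "complex \<Rightarrow> (int \<times> int \<Rightarrow> complex) \<Rightarrow> int \<times> int \<Rightarrow> complex" where
  "seq_scale c a = (\<lambda>k. c * a k)"

lemma seq_scale_apply [simp]: "seq_scale c a k = c * a k"
  by (simp add: seq_scale_def)

interpretation seq: complex_vector_space seq_scale
  by unfold_locales (auto simp: fun_eq_iff algebra_simps)

definition norm_sq :: "int \<times> int \<Rightarrow> int" where
  "norm_sq k = (fst k)\<^sup>2 + (snd k)\<^sup>2"

definition cross :: "int \<times> int \<Rightarrow> int \<times> int \<Rightarrow> int" where
  "cross p k = fst p * snd k - snd p * fst k"

text \<open>
  At \<open>k = 0\<close> division by zero gives the value \<open>1\<close>. It is harmless there, since the coefficient \<open>a 0\<close> of a
  mean-zero vorticity vanishes.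
\<close>

definition rho :: "int \<times> int \<Rightarrow> int \<times> int \<Rightarrow> real" where
  "rho p k = 1 - of_int (norm_sq p) / of_int (norm_sq k)"

text \<open>
  The operator is defined on all families; \<open>ell2_0\<close> below supplies the Hilbert space of mean-zero vorticities.
\<close>

definition lat_op :: "int \<times> int \<Rightarrow> (int \<times> int \<Rightarrow> complex) \<Rightarrow> int \<times> int \<Rightarrow> complex" where
  "lat_op p a = (\<lambda>k. of_int (cross p k) / 2 *
     (of_real (rho p (k + p)) * a (k + p) - of_real (rho p (k - p)) * a (k - p)))"

definition disk :: "int \<times> int \<Rightarrow> (int \<times> int) set" where
  "disk p = {k. 0 < norm_sq k \<and> norm_sq k < norm_sq p}"

definition ell2 :: "('k \<Rightarrow> complex) set" where
  "ell2 = {a. (\<lambda>k. (cmod (a k))\<^sup>2) summable_on UNIV}"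

definition ell2_0 :: "(int \<times> int \<Rightarrow> complex) set" where
  "ell2_0 = {a \<in> ell2. a 0 = 0}"

lemma norm_sq_nonneg: "norm_sq k \<ge> 0"
  by (simp add: norm_sq_def)

lemma norm_sq_eq_0_iff: "norm_sq k = 0 \<longleftrightarrow> k = 0"
  by (cases k) (simp add: norm_sq_def zero_prod_def)

lemma cross_shift [simp]: "cross p (k + p) = cross p k" "cross p (k - p) = cross p k"
  by (simp_all add: cross_def algebra_simps)

lemma cross_zero [simp]: "cross p 0 = 0"
  by (simp add: cross_def)

lemma lat_op_operator: "seq.operator (lat_op p)"
  by (rule seq.operatorI) (auto simp: lat_op_def fun_eq_iff algebra_simps)

lemma rho_bounds:
  "\<bar>rho p k\<bar> \<le> 1 + of_int (norm_sq p)"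
  "norm_sq k \<noteq> 0 \<Longrightarrow> rho p k \<noteq> 0 \<Longrightarrow> k \<notin> disk p \<Longrightarrow> rho p k \<ge> 1 / (1 + of_int (norm_sq p))"
  "k \<in> disk p \<Longrightarrow> rho p k < 0"
  "k \<notin> disk p \<Longrightarrow> rho p k \<ge> 0"
proof -
  define P where "P = real_of_int (norm_sq p)"
  define K where "K = real_of_int (norm_sq k)"
  have P: "P \<ge> 0" "K \<ge> 0" using norm_sq_nonneg by (auto simp: P_def K_def)
  have r: "rho p k = 1 - P / K" by (simp add: rho_def P_def K_def)
  have K1: "K = 0 \<or> K \<ge> 1" using norm_sq_nonneg[of k] by (auto simp: K_def)
  then have "P / K \<le> P" "P / K \<ge> 0" using P by (auto simp: divide_le_eq mult_le_cancel_left1)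
  then show "\<bar>rho p k\<bar> \<le> 1 + of_int (norm_sq p)" unfolding r P_def[symmetric] by linarith
  show "rho p k < 0" if "k \<in> disk p"
  proof -
    have "0 < K" "K < P" using that by (auto simp: disk_def P_def K_def)
    then show ?thesis by (simp add: r field_simps)
  qed
  show ge: "rho p k \<ge> 0" if "k \<notin> disk p"
  proof -
    have "K = 0 \<or> P \<le> K" using that K1 by (auto simp: disk_def P_def K_def)
    then show ?thesis using P by (auto simp: r divide_le_eq)
  qed
  show "rho p k \<ge> 1 / (1 + of_int (norm_sq p))" if k: "norm_sq k \<noteq> 0" "rho p k \<noteq> 0" "k \<notin> disk p"
  proof -
    have K0: "K > 0" using k(1) P(2) by (simp add: K_def)
    have "K \<noteq> P" using k(2) K0 by (auto simp: r)
    moreover have "K \<ge> P" using ge[OF k(3)] K0 by (simp add: r field_simps)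
    ultimately have "norm_sq k \<ge> norm_sq p + 1" by (simp add: P_def K_def)
    then have "K \<ge> 1 + P" by (simp add: P_def K_def)
    then have "P / K \<le> P / (1 + P)" using P by (intro divide_left_mono mult_pos_pos) auto
    also have "\<dots> = 1 - 1 / (1 + P)" using P by (simp add: field_simps)
    finally show ?thesis by (simp add: r P_def)
  qed
qed

definition chain :: "int \<times> int \<Rightarrow> int \<times> int \<Rightarrow> int \<Rightarrow> int \<times> int" where
  "chain p k n = (fst k + n * fst p, snd k + n * snd p)"

lemma chain_simps:
  "chain p k 0 = k" "chain p k (n + 1) = chain p k n + p" "chain p k (n - 1) = chain p k n - p"
  "cross p (chain p k n) = cross p k"
  by (auto simp: chain_def cross_def algebra_simps prod_eq_iff)

lemma chain_inj:
  assumes "p \<noteq> 0"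
  shows "inj (chain p k)"
  using assms by (auto simp: inj_def chain_def prod_eq_iff)

lemma cross_nonzero_imp: "cross p k \<noteq> 0 \<Longrightarrow> p \<noteq> 0"
  by (auto simp: cross_def)

text \<open>
  Decompose \<open>k + n p\<close> into components along and across \<open>p\<close>: then \<open>|k + n p|^2 / |p|^2 = (n - t)^2 + hh\<close>.
\<close>

lemma rho_chain:
  assumes "cross p k \<noteq> 0"
  defines "P \<equiv> real_of_int (norm_sq p)"
  defines "t \<equiv> - (of_int (fst k * fst p + snd k * snd p) / P)"
    and "hh \<equiv> (of_int (cross p k))\<^sup>2 / P\<^sup>2"
  shows "rho p (chain p k n) = 1 - 1 / ((of_int n - t)\<^sup>2 + hh)" and "hh > 0"
proof -
  have P: "P > 0"
    using assms(1) norm_sq_nonneg[of p] norm_sq_eq_0_iff[of p] cross_nonzero_imp[of p k]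
    by (auto simp: P_def)
  then show "hh > 0" using assms(1) by (simp add: hh_def)
  have "of_int (norm_sq (chain p k n)) * P = (of_int n * P + of_int (fst k * fst p + snd k * snd p))\<^sup>2 + (of_int (cross p k))\<^sup>2"
    by (simp add: P_def norm_sq_def chain_def cross_def power2_eq_square algebra_simps)
  also have "\<dots> = P\<^sup>2 * ((of_int n - t)\<^sup>2 + hh)"
  proof -
    have e: "of_int n * P + of_int (fst k * fst p + snd k * snd p) = P * (of_int n - t)"
      using P by (simp add: t_def field_simps)
    show ?thesis unfolding e hh_def using P by (simp add: power_mult_distrib distrib_left)
  qed
  finally have "of_int (norm_sq (chain p k n)) = P * ((of_int n - t)\<^sup>2 + hh)"
    using P by (simp add: power2_eq_square)
  then show "rho p (chain p k n) = 1 - 1 / ((of_int n - t)\<^sup>2 + hh)"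
    using P by (simp add: rho_def P_def[symmetric])
qed

lemma summable_on_comp_inj:
  fixes f :: "'a \<Rightarrow> 'b::banach"
  assumes "f summable_on UNIV" "inj h"
  shows "(\<lambda>x. f (h x)) summable_on UNIV"
  using summable_on_subset_banach[OF assms(1), of "range h"] summable_on_reindex[OF assms(2), of f]
  by (simp add: o_def)

lemma ell2_tendsto_zero:
  fixes h :: "nat \<Rightarrow> 'k"
  assumes "a \<in> ell2" "inj h"
  shows "(\<lambda>n. a (h n)) \<longlonglongrightarrow> 0"
proof -
  have "summable (\<lambda>n. (cmod (a (h n)))\<^sup>2)"
    using summable_on_comp_inj[OF _ assms(2), of "\<lambda>k. (cmod (a k))\<^sup>2"] assms(1)
    by (simp add: ell2_def summable_on_imp_summable)
  then have "(\<lambda>n. (cmod (a (h n)))\<^sup>2) \<longlonglongrightarrow> 0" by (rule summable_LIMSEQ_zero)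
  then have "(\<lambda>n. sqrt ((cmod (a (h n)))\<^sup>2)) \<longlonglongrightarrow> sqrt 0" by (rule tendsto_real_sqrt)
  then show ?thesis by (simp add: tendsto_norm_zero_iff)
qed

lemma ell2_comp_inj: "a \<in> ell2 \<Longrightarrow> inj h \<Longrightarrow> (\<lambda>n. a (h n)) \<in> ell2"
  using summable_on_comp_inj[of "\<lambda>k. (cmod (a k))\<^sup>2" h] by (simp add: ell2_def)

text \<open>
  Along the line \<open>k + \<int> p\<close> the factor \<open>p \<times> k\<close> is constant. Multiplying \<open>rho * a\<close> by \<open>\<i>^(-n)\<close> turns the
  difference of neighbours into a sum and the imaginary eigenvalue into a real parameter, so real and
  imaginary parts fall under \<open>neutral_chain_trivial\<close>. The equation is required only where \<open>rho\<close> is nonzero,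
  because limits of truncations satisfy it only there.
\<close>

lemma no_neutral_mode:
  assumes a: "a \<in> ell2" "\<And>k. rho p k = 0 \<Longrightarrow> a k = 0" "\<And>k. cross p k = 0 \<Longrightarrow> a k = 0"
    and eig: "\<And>k. rho p k \<noteq> 0 \<Longrightarrow> al * a k = lat_op p a k" and al: "Re al = 0"
  shows "a = 0"
proof (rule ext)
  fix k
  show "a k = 0 k"
  proof (cases "cross p k = 0 \<or> rho p k = 0")
    case False
    then have cr: "cross p k \<noteq> 0" and r: "rho p k \<noteq> 0" by auto
    note p0 = cross_nonzero_imp[OF cr]
    define c where "c = real_of_int (cross p k) / 2"
    have c: "c \<noteq> 0" using cr by (simp add: c_def)
    define be where "be = Im al"
    have al': "al = \<i> * of_real be" using al by (simp add: be_def complex_eq_iff)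
    define rr where "rr n = rho p (chain p k n)" for n
    define G where "G n = of_real (rr n) * a (chain p k n) * (\<i> powi (- n))" for n
    have e: "\<i> powi (- (n + 1)) = - \<i> * \<i> powi (- n)" "\<i> powi (- (n - 1)) = \<i> * \<i> powi (- n)" for n :: int
      using power_int_add[of \<i> "- n" "- 1"] power_int_add[of \<i> "- n" 1]
      by (simp_all add: algebra_simps power_int_minus)
    have rec: "of_real be * G n = of_real c * of_real (rr n) * (G (n + 1) + G (n - 1))" for n
    proof (cases "rr n = 0")
      case False
      have "\<i> * of_real be * a (chain p k n) = of_real c * (of_real (rr (n + 1)) * a (chain p k (n + 1)) - of_real (rr (n - 1)) * a (chain p k (n - 1)))"
        using eig[of "chain p k n"] False
        by (simp add: al' lat_op_def chain_simps rr_def c_def)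
      from arg_cong[OF this, of "\<lambda>x. (- \<i>) * of_real (rr n) * \<i> powi (- n) * x"]
      show ?thesis unfolding G_def e by (simp add: algebra_simps)
    qed (simp add: G_def)
    define mu where "mu = be / c"
    have rec': "of_real mu * G n = of_real (rr n) * (G (n + 1) + G (n - 1))" for n
      using arg_cong[OF rec[of n], of "\<lambda>x. x / of_real c"] c by (simp add: mu_def)
    have Gn: "cmod (G n) \<le> (1 + of_int (norm_sq p)) * cmod (a (chain p k n))" for n
      using rho_bounds(1)[of p "chain p k n"]
      by (simp add: G_def norm_mult rr_def norm_power_int mult_right_mono)
    have lim: "(\<lambda>n. G (h n)) \<longlonglongrightarrow> 0" if "inj h" for h :: "nat \<Rightarrow> int"
    proof -
      have "(\<lambda>n. a (chain p k (h n))) \<longlonglongrightarrow> 0"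
        using ell2_tendsto_zero[OF a(1), of "\<lambda>n. chain p k (h n)"]
          inj_compose[OF chain_inj[OF p0] that] by (simp add: o_def)
      then have "(\<lambda>n. (1 + of_int (norm_sq p)) * cmod (a (chain p k (h n)))) \<longlonglongrightarrow> 0"
        by (intro tendsto_mult_right_zero tendsto_norm_zero)
      then show ?thesis
        by (rule Lim_null_comparison[rotated]) (use Gn in auto)
    qed
    have inj: "inj int" "inj (\<lambda>n. - int n)" by (auto simp: inj_def)
    note rc = rho_chain[OF cr]
    have "Re (G 0) = 0"
    proof (rule neutral_chain_trivial[OF rc(2), of mu "\<lambda>n. Re (G n)"])
      show "mu * Re (G n) = (1 - 1 / ((of_int n - - (of_int (fst k * fst p + snd k * snd p) / of_int (norm_sq p)))\<^sup>2 +
          (of_int (cross p k))\<^sup>2 / (of_int (norm_sq p))\<^sup>2)) * (Re (G (n + 1)) + Re (G (n - 1)))" for n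
        using arg_cong[OF rec'[of n], of Re] unfolding rc(1)[symmetric] by (simp add: rr_def)
      show "(\<lambda>n. Re (G (int n))) \<longlonglongrightarrow> 0" "(\<lambda>n. Re (G (- int n))) \<longlonglongrightarrow> 0"
        using tendsto_Re[OF lim[OF inj(1)]] tendsto_Re[OF lim[OF inj(2)]] by auto
    qed
    moreover have "Im (G 0) = 0"
    proof (rule neutral_chain_trivial[OF rc(2), of mu "\<lambda>n. Im (G n)"])
      show "mu * Im (G n) = (1 - 1 / ((of_int n - - (of_int (fst k * fst p + snd k * snd p) / of_int (norm_sq p)))\<^sup>2 +
          (of_int (cross p k))\<^sup>2 / (of_int (norm_sq p))\<^sup>2)) * (Im (G (n + 1)) + Im (G (n - 1)))" for n
        using arg_cong[OF rec'[of n], of Im] unfolding rc(1)[symmetric] by (simp add: rr_def)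
      show "(\<lambda>n. Im (G (int n))) \<longlonglongrightarrow> 0" "(\<lambda>n. Im (G (- int n))) \<longlonglongrightarrow> 0"
        using tendsto_Im[OF lim[OF inj(1)]] tendsto_Im[OF lim[OF inj(2)]] by auto
    qed
    ultimately have "G 0 = 0" by (simp add: complex_eq_iff)
    then show ?thesis using r by (simp add: G_def rr_def chain_simps)
  next
    case True
    then have "a k = 0" using a(2)[of k] a(3)[of k] by blast
    then show ?thesis by simp
  qed
qed

section \<open>Finite truncations and their limit\<close>

declare split_paired_All [simp del] split_paired_Ex [simp del]

lemma sum_fun_apply: "(\<Sum>a\<in>A. f a) k = (\<Sum>a\<in>A. f a k)"
  by (induction A rule: infinite_finite_induct) auto

definition delta :: "int \<times> int \<Rightarrow> int \<times> int \<Rightarrow> complex" where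
  "delta j = (\<lambda>k. if k = j then 1 else 0)"

lemma inj_delta: "inj_on delta I"
  by (rule inj_onI) (metis delta_def zero_neq_one)

lemma span_delta:
  assumes "finite I"
  shows "seq.span (delta ` I) = {x. \<forall>k. k \<notin> I \<longrightarrow> x k = 0}"
proof
  show "seq.span (delta ` I) \<subseteq> {x. \<forall>k. k \<notin> I \<longrightarrow> x k = 0}"
    by (rule seq.span_minimal) (auto simp: delta_def intro!: seq.subspaceI)
  show "{x. \<forall>k. k \<notin> I \<longrightarrow> x k = 0} \<subseteq> seq.span (delta ` I)"
  proof
    fix x :: "int \<times> int \<Rightarrow> complex" assume "x \<in> {x. \<forall>k. k \<notin> I \<longrightarrow> x k = 0}"
    then have x: "x k = 0" if "k \<notin> I" for k using that by simp
    have "x = (\<Sum>j\<in>I. seq_scale (x j) (delta j))"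
      using x assms by (auto simp: fun_eq_iff sum_fun_apply delta_def if_distrib cong: if_cong)
    also have "\<dots> \<in> seq.span (delta ` I)"
      by (intro seq.span_sum seq.span_scale seq.span_base) auto
    finally show "x \<in> seq.span (delta ` I)" .
  qed
qed

lemma independent_delta:
  assumes "finite I"
  shows "seq.independent (delta ` I)"
proof (rule notI)
  assume "seq.dependent (delta ` I)"
  then obtain u j where u: "j \<in> I" "u (delta j) \<noteq> 0" "(\<Sum>v\<in>delta ` I. seq_scale (u v) v) = 0"
    using assms by (auto simp: seq.dependent_finite)
  have "0 = (\<Sum>i\<in>I. seq_scale (u (delta i)) (delta i)) j"
    using u(3) by (simp add: sum.reindex[OF inj_delta])
  also have "\<dots> = u (delta j)"
    using assms u(1) by (simp add: sum_fun_apply delta_def if_distrib cong: if_cong)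
  finally show False using u(2) by simp
qed

definition diag_form :: "(int \<times> int \<Rightarrow> real) \<Rightarrow> (int \<times> int) set \<Rightarrow> (int \<times> int \<Rightarrow> complex) \<Rightarrow>
    (int \<times> int \<Rightarrow> complex) \<Rightarrow> complex" where
  "diag_form w I x y = (\<Sum>k\<in>I. of_real (w k) * (x k * cnj (y k)))"

lemma hermitian_diag_form: "seq.hermitian (diag_form w I)"
  unfolding seq.hermitian_def diag_form_def
  by (auto simp: sum.distrib sum_distrib_left algebra_simps intro!: sum.cong)

lemma Re_diag_form: "Re (diag_form w I x x) = (\<Sum>k\<in>I. w k * (cmod (x k))\<^sup>2)"
  unfolding diag_form_def complex_norm_square[symmetric] by simp

text \<open>
  Points with \<open>rho = 0\<close> are left out to keep the form nondegenerate, points with \<open>cross = 0\<close> because \<open>L\<close>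
  vanishes there.
\<close>

definition lat_box :: "int \<times> int \<Rightarrow> nat \<Rightarrow> (int \<times> int) set" where
  "lat_box p M = {k. \<bar>fst k\<bar> \<le> int M \<and> \<bar>snd k\<bar> \<le> int M \<and> rho p k \<noteq> 0 \<and> cross p k \<noteq> 0}"

lemma finite_lat_box: "finite (lat_box p M)"
  by (rule finite_subset[of _ "{- int M..int M} \<times> {- int M..int M}"]) (auto simp: lat_box_def)

lemma in_lat_box_eventually:
  assumes "rho p k \<noteq> 0" "cross p k \<noteq> 0" "M \<ge> nat \<bar>fst k\<bar> + nat \<bar>snd k\<bar>"
  shows "k \<in> lat_box p M"
  using assms by (auto simp: lat_box_def)

lemma disk_coord_bound:
  assumes "k \<in> disk p"
  shows "\<bar>fst k\<bar> \<le> norm_sq p" "\<bar>snd k\<bar> \<le> norm_sq p"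
proof -
  have sq: "\<bar>x\<bar> \<le> x\<^sup>2" for x :: int
    using mult_left_mono[of 1 "\<bar>x\<bar>" "\<bar>x\<bar>"] by (cases "x = 0") (auto simp: power2_eq_square)
  show "\<bar>fst k\<bar> \<le> norm_sq p" "\<bar>snd k\<bar> \<le> norm_sq p"
    using assms sq[of "fst k"] sq[of "snd k"] zero_le_power2[of "fst k"] zero_le_power2[of "snd k"]
    by (auto simp: disk_def norm_sq_def)
qed

lemma finite_disk: "finite (disk p)"
proof (rule finite_subset)
  show "disk p \<subseteq> {- norm_sq p..norm_sq p} \<times> {- norm_sq p..norm_sq p}"
  proof
    fix k assume "k \<in> disk p"
    from disk_coord_bound[OF this] show "k \<in> {- norm_sq p..norm_sq p} \<times> {- norm_sq p..norm_sq p}"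
      by (simp add: mem_Times_iff abs_le_iff)
  qed
qed auto

text \<open>
  By coprimality a lattice point parallel to \<open>p\<close> is an integer multiple of \<open>p\<close>, hence not in the
  punctured disk.
\<close>

lemma disk_cross_nonzero:
  assumes "coprime (fst p) (snd p)" "k \<in> disk p"
  shows "cross p k \<noteq> 0"
proof
  assume "cross p k = 0"
  then have eq: "fst p * snd k = snd p * fst k" by (simp add: cross_def)
  then have "fst p dvd snd p * fst k" by (metis dvd_triv_left)
  then have "fst p dvd fst k" using assms(1) by (simp add: coprime_dvd_mult_right_iff)
  then obtain m where m: "fst k = fst p * m" by blast
  have "snd p dvd fst p * snd k" using eq by simp
  then have "snd p dvd snd k" using assms(1) by (simp add: coprime_commute coprime_dvd_mult_right_iff)
  then obtain l where l: "snd k = snd p * l" by blast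
  have "fst p * snd p * (l - m) = 0" using eq m l by (simp add: algebra_simps)
  then have "fst p = 0 \<or> snd p = 0 \<or> l = m" by auto
  then obtain j where j: "fst k = fst p * j" "snd k = snd p * j" using m l by (metis mult_zero_left)
  have "norm_sq k = norm_sq p * j\<^sup>2" by (simp add: norm_sq_def j power_mult_distrib algebra_simps)
  moreover have "j\<^sup>2 \<ge> 1" if "j \<noteq> 0" using that by (simp add: int_one_le_iff_zero_less)
  ultimately have "norm_sq k = 0 \<or> norm_sq k \<ge> norm_sq p"
    using norm_sq_nonneg[of p] mult_left_mono[of 1 "j\<^sup>2" "norm_sq p"] by (cases "j = 0") auto
  then show False using assms(2) by (auto simp: disk_def)
qed

lemma disk_subset_lat_box:
  assumes "coprime (fst p) (snd p)" "M \<ge> nat (norm_sq p)"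
  shows "disk p \<subseteq> lat_box p M"
proof
  fix k assume k: "k \<in> disk p"
  have "\<bar>fst k\<bar> \<le> int M" "\<bar>snd k\<bar> \<le> int M"
    using disk_coord_bound[OF k] assms(2) by linarith+
  then show "k \<in> lat_box p M"
    using disk_cross_nonzero[OF assms(1) k] rho_bounds(3)[OF k] by (simp add: lat_box_def)
qed

text \<open>
  The truncation of \<open>s * L - eps * rho\<close> to the box; the sign \<open>s\<close> exchanges the two half-planes, and the second
  term makes the operator strictly dissipative.
\<close>

definition trunc_op :: "real \<Rightarrow> real \<Rightarrow> int \<times> int \<Rightarrow> nat \<Rightarrow> (int \<times> int \<Rightarrow> complex) \<Rightarrow> int \<times> int \<Rightarrow> complex" where
  "trunc_op s eps p M x = (\<lambda>k. if k \<in> lat_box p M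
     then of_real s * lat_op p (\<lambda>j. if j \<in> lat_box p M then x j else 0) k - of_real (eps * rho p k) * x k
     else 0)"

lemma trunc_op_operator: "seq.operator (trunc_op s eps p M)"
proof (rule seq.operatorI)
  fix x y :: "int \<times> int \<Rightarrow> complex" and c
  define R where "R x = (\<lambda>j. if j \<in> lat_box p M then x j else (0::complex))" for x
  have R: "R (x + y) = R x + R y" "R (seq_scale c x) = seq_scale c (R x)"
    by (auto simp: R_def fun_eq_iff)
  have t: "trunc_op s eps p M x k = (if k \<in> lat_box p M
     then of_real s * lat_op p (R x) k - of_real (eps * rho p k) * x k else 0)" for x k
    unfolding trunc_op_def R_def by (rule refl)
  show "trunc_op s eps p M (x + y) = trunc_op s eps p M x + trunc_op s eps p M y"
    by (rule ext) (simp add: t R seq.operator_add[OF lat_op_operator] algebra_simps)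
  show "trunc_op s eps p M (seq_scale c x) = seq_scale c (trunc_op s eps p M x)"
    by (rule ext) (simp add: t R seq.operator_scale[OF lat_op_operator] algebra_simps)
qed

lemma trunc_op_supported:
  assumes "\<And>k. k \<notin> lat_box p M \<Longrightarrow> x k = 0" "k \<in> lat_box p M"
  shows "trunc_op s eps p M x k = of_real s * lat_op p x k - of_real (eps * rho p k) * x k"
proof -
  have "(\<lambda>j. if j \<in> lat_box p M then x j else 0) = x" using assms(1) by auto
  then show ?thesis using assms(2) by (simp add: trunc_op_def)
qed

text \<open>
  Shifting the summation index by \<open>p\<close> turns one half of the sum into the conjugate of the other.
\<close>

lemma finite_shift_skew:
  fixes g :: "int \<times> int \<Rightarrow> complex"
  assumes "finite I" "\<And>k. k \<notin> I \<Longrightarrow> g k = 0"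
  shows "Re (\<Sum>k\<in>I. of_int (cross p k) * (g (k + p) - g (k - p)) * cnj (g k)) = 0"
proof -
  define A where "A = (\<Sum>k\<in>I. of_int (cross p k) * (g (k + p) * cnj (g k)))"
  have "(\<Sum>k\<in>I. of_int (cross p k) * (g (k - p) * cnj (g k))) = (\<Sum>k\<in>{k\<in>I. k - p \<in> I}. of_int (cross p k) * (g (k - p) * cnj (g k)))"
    using assms by (intro sum.mono_neutral_right) auto
  also have "\<dots> = (\<Sum>k\<in>{k\<in>I. k + p \<in> I}. of_int (cross p k) * (g k * cnj (g (k + p))))"
    by (rule sum.reindex_bij_witness[of _ "\<lambda>k. k + p" "\<lambda>k. k - p"]) auto
  also have "\<dots> = (\<Sum>k\<in>I. of_int (cross p k) * (g k * cnj (g (k + p))))"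
    using assms by (intro sum.mono_neutral_left) auto
  also have "\<dots> = cnj A" by (simp add: A_def mult.commute)
  finally have "(\<Sum>k\<in>I. of_int (cross p k) * (g (k + p) - g (k - p)) * cnj (g k)) = A - cnj A"
    by (simp add: A_def sum_subtractf algebra_simps)
  then show ?thesis by simp
qed

lemma trunc_op_dissipative:
  assumes supp: "\<And>k. k \<notin> lat_box p M \<Longrightarrow> x k = 0" and "x \<noteq> 0" "eps > 0"
  shows "Re (diag_form (rho p) (lat_box p M) (trunc_op s eps p M x) x) < 0"
proof -
  define g where "g k = of_real (rho p k) * x k" for k
  let ?I = "lat_box p M"
  have "diag_form (rho p) ?I (trunc_op s eps p M x) x =
      (\<Sum>k\<in>?I. of_real (s / 2) * (of_int (cross p k) * (g (k + p) - g (k - p)) * cnj (g k)) - of_real eps * of_real ((cmod (g k))\<^sup>2))"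
    unfolding diag_form_def complex_norm_square
    by (rule sum.cong[OF refl])
       (simp add: trunc_op_supported[OF supp] lat_op_def g_def algebra_simps)
  also have "\<dots> = of_real (s / 2) * (\<Sum>k\<in>?I. of_int (cross p k) * (g (k + p) - g (k - p)) * cnj (g k)) - of_real (eps * (\<Sum>k\<in>?I. (cmod (g k))\<^sup>2))"
    by (simp add: sum_subtractf sum_distrib_left)
  finally have eq: "Re (diag_form (rho p) ?I (trunc_op s eps p M x) x) =
      s / 2 * Re (\<Sum>k\<in>?I. of_int (cross p k) * (g (k + p) - g (k - p)) * cnj (g k)) - eps * (\<Sum>k\<in>?I. (cmod (g k))\<^sup>2)"
    by simp
  have z: "Re (\<Sum>k\<in>?I. of_int (cross p k) * (g (k + p) - g (k - p)) * cnj (g k)) = 0"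
    by (rule finite_shift_skew[OF finite_lat_box]) (simp add: g_def supp)
  obtain k where k: "x k \<noteq> 0" using \<open>x \<noteq> 0\<close> by (auto simp: fun_eq_iff)
  then have kI: "k \<in> ?I" using supp by blast
  then have "rho p k \<noteq> 0" by (simp add: lat_box_def)
  then have "(cmod (g k))\<^sup>2 > 0" using k by (simp add: g_def)
  then have "(\<Sum>k\<in>?I. (cmod (g k))\<^sup>2) > 0"
    using finite_lat_box kI by (intro sum_pos2[of _ k]) auto
  then show ?thesis unfolding eq z using assms(3) by simp
qed

text \<open>
  If \<open>u\<close> has norm \<open>1\<close> on the disk and \<open>B u u \<le> 0\<close>, then the weights \<open>rho \<ge> 1/(1 + |p|^2)\<close> outside and
  \<open>\<bar>rho\<bar> \<le> 1 + |p|^2\<close> inside give this bound for the squared norm of \<open>u\<close>. It is independent of the box,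
  and so is the bound for the matrix entries below.
\<close>

definition flag_size :: "int \<times> int \<Rightarrow> real" where
  "flag_size p = 1 + (1 + of_int (norm_sq p))\<^sup>2"

definition flag_coeff_bound :: "int \<times> int \<Rightarrow> real" where
  "flag_coeff_bound p = (\<Sum>d\<in>disk p. (\<bar>of_int (cross p d)\<bar> + 1) * (1 + of_int (norm_sq p)) * flag_size p * flag_size p)"

definition approx_flag :: "int \<times> int \<Rightarrow> real \<Rightarrow> real \<Rightarrow> nat \<Rightarrow> (nat \<Rightarrow> int \<times> int \<Rightarrow> complex) \<Rightarrow> (nat \<Rightarrow> nat \<Rightarrow> complex) \<Rightarrow> bool" where
  "approx_flag p s eps M u T \<longleftrightarrow>
     (\<forall>i < card (disk p).
        (\<forall>k. k \<notin> lat_box p M \<longrightarrow> u i k = 0) \<and> (\<Sum>k\<in>lat_box p M. (cmod (u i k))\<^sup>2) \<le> flag_size p \<and>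
        (\<forall>j < card (disk p). diag_form (\<lambda>_. 1) (disk p) (u i) (u j) = (if i = j then 1 else 0)) \<and>
        Re (T i i) > 0 \<and> (\<forall>j\<le>i. cmod (T i j) \<le> flag_coeff_bound p) \<and>
        (\<forall>k\<in>lat_box p M. of_real s * lat_op p (u i) k - of_real (eps * rho p k) * u i k = (\<Sum>j\<le>i. T i j * u j k)))"

lemma flag_size_coord:
  assumes "finite I" "(\<Sum>k\<in>I. (cmod (x k))\<^sup>2) \<le> flag_size p" "\<And>k. k \<notin> I \<Longrightarrow> x k = 0"
  shows "cmod (x k) \<le> flag_size p"
proof (cases "k \<in> I")
  case True
  have "(cmod (x k))\<^sup>2 \<le> (\<Sum>k\<in>I. (cmod (x k))\<^sup>2)"
    using assms(1) True by (intro member_le_sum) auto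
  then have sq: "(cmod (x k))\<^sup>2 \<le> flag_size p" using assms(2) by linarith
  have one: "flag_size p \<ge> 1" by (simp add: flag_size_def)
  show ?thesis
  proof (rule ccontr)
    assume "\<not> ?thesis"
    then have l: "cmod (x k) > flag_size p" by simp
    then have "cmod (x k) * 1 < cmod (x k) * cmod (x k)"
      using one by (intro mult_strict_left_mono) auto
    then show False using sq l by (simp add: power2_eq_square)
  qed
next
  case False
  then show ?thesis using assms(3) by (simp add: flag_size_def)
qed

lemma lat_op_bound:
  assumes "\<And>k. cmod (x k) \<le> K"
  shows "cmod (lat_op p x k) \<le> \<bar>of_int (cross p k)\<bar> * (1 + of_int (norm_sq p)) * K"
proof -
  have b: "cmod (of_real (rho p j) * x j) \<le> (1 + of_int (norm_sq p)) * K" for j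
    unfolding norm_mult using rho_bounds(1)[of p j] assms[of j] norm_sq_nonneg[of p]
    by (intro mult_mono) auto
  have "cmod (of_real (rho p (k + p)) * x (k + p) - of_real (rho p (k - p)) * x (k - p)) \<le> 2 * ((1 + of_int (norm_sq p)) * K)"
    using norm_triangle_ineq4[of "of_real (rho p (k + p)) * x (k + p)" "of_real (rho p (k - p)) * x (k - p)"] b[of "k + p"] b[of "k - p"]
    by linarith
  then have "\<bar>of_int (cross p k)\<bar> / 2 * cmod (of_real (rho p (k + p)) * x (k + p) - of_real (rho p (k - p)) * x (k - p)) \<le> \<bar>of_int (cross p k)\<bar> / 2 * (2 * ((1 + of_int (norm_sq p)) * K))"
    by (rule mult_left_mono) simp
  then show ?thesis by (simp add: lat_op_def norm_mult norm_divide mult.assoc)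
qed

text \<open>
  \<open>orthonormal_unstable_flag\<close> applied to the truncated operator, with the weighted form on the box as \<open>B\<close>
  and the unweighted form on the disk as \<open>C\<close>. Orthonormality on the disk recovers the matrix of the flag
  as \<open>T i j = C (L (u i)) (u j)\<close>, which involves only finitely many coordinates and so is bounded.
\<close>

lemma approx_flag_exists:
  assumes cop: "coprime (fst p) (snd p)" and s: "\<bar>s\<bar> = 1" and eps: "0 < eps" "eps \<le> 1"
    and M: "M \<ge> nat (norm_sq p)"
  shows "\<exists>u T. approx_flag p s eps M u T"
proof -
  let ?I = "lat_box p M" and ?D = "disk p" and ?N = "card (disk p)"
  let ?B = "diag_form (rho p) ?I" and ?C = "diag_form (\<lambda>_. 1) ?D"
  let ?L = "trunc_op s eps p M"
  define P where "P = real_of_int (norm_sq p)"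
  have P0: "P \<ge> 0" using norm_sq_nonneg by (simp add: P_def)
  define V where "V = {x :: int \<times> int \<Rightarrow> complex. \<forall>k. k \<notin> ?I \<longrightarrow> x k = 0}"
  have VS: "V = seq.span (delta ` ?I)" using span_delta[OF finite_lat_box] by (simp add: V_def)
  have DI: "?D \<subseteq> ?I" by (rule disk_subset_lat_box[OF cop M])
  have BD: "Re (?B x x) = (\<Sum>k\<in>?D. rho p k * (cmod (x k))\<^sup>2) + (\<Sum>k\<in>?I - ?D. rho p k * (cmod (x k))\<^sup>2)" for x
    unfolding Re_diag_form using sum.subset_diff[OF DI finite_lat_box] by (simp add: add.commute)
  have out: "rho p k \<ge> 1 / (1 + P)" if "k \<in> ?I - ?D" for k
  proof -
    have "norm_sq k \<noteq> 0" using that norm_sq_eq_0_iff[of k] by (auto simp: lat_box_def)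
    then show ?thesis using rho_bounds(2)[of k p] that by (auto simp: lat_box_def P_def)
  qed
  have out0: "(\<Sum>k\<in>?I - ?D. rho p k * (cmod (x k))\<^sup>2) \<ge> 0" for x
    using rho_bounds(4) by (intro sum_nonneg mult_nonneg_nonneg) auto
  have "\<exists>u lam. (\<forall>i<?N. u i \<in> V \<and> Re (?B (u i) (u i)) \<le> 0 \<and> Re (lam i) > 0) \<and>
    (\<forall>i<?N. \<forall>j<?N. ?C (u i) (u j) = (if i = j then 1 else 0)) \<and> seq.triangular ?L u lam ?N"
  proof (rule seq.orthonormal_unstable_flag[where B = ?B and C = ?C and V = V and L = ?L and n = ?N
        and S = "delta ` ?I" and X = "delta ` ?D"])
    show "seq.hermitian ?B" "seq.hermitian ?C" by (rule hermitian_diag_form)+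
    show "finite (delta ` ?I)" using finite_lat_box by simp
    show "seq.operator ?L" by (rule trunc_op_operator)
    show "V \<subseteq> seq.span (delta ` ?I)" "seq.subspace V" using VS by auto
    show "?L y \<in> V" for y by (simp add: V_def trunc_op_def)
    show "Re (?B (?L y) y) < 0" if "y \<in> V" "y \<noteq> 0" for y
      using trunc_op_dissipative[OF _ that(2) eps(1)] that(1) by (simp add: V_def)
    show "delta ` ?D \<subseteq> V" using DI by (auto simp: V_def delta_def)
    show "seq.independent (delta ` ?D)" by (rule independent_delta[OF finite_disk])
    show "finite (delta ` ?D)" using finite_disk by simp
    show "card (delta ` ?D) = ?N" by (rule card_image[OF inj_delta])
    show "Re (?B x x) < 0" if x: "x \<in> seq.span (delta ` ?D)" "x \<noteq> 0" for x
    proof -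
      have x0: "x k = 0" if "k \<notin> ?D" for k using x(1) that span_delta[OF finite_disk] by auto
      obtain k where k: "x k \<noteq> 0" using x(2) by (auto simp: fun_eq_iff)
      then have "k \<in> ?D" using x0 by blast
      have "(\<Sum>k\<in>?D. rho p k * (cmod (x k))\<^sup>2) < (\<Sum>k\<in>?D. 0)"
      proof (rule sum_strict_mono_ex1[OF finite_disk])
        show "\<forall>k\<in>?D. rho p k * (cmod (x k))\<^sup>2 \<le> 0"
          by (intro ballI mult_nonpos_nonneg) (simp_all add: less_imp_le rho_bounds(3))
        show "\<exists>k\<in>?D. rho p k * (cmod (x k))\<^sup>2 < 0"
          using k \<open>k \<in> ?D\<close> rho_bounds(3)[of k p] by (intro bexI[of _ k] mult_neg_pos) simp_all
      qed
      moreover have "(\<Sum>k\<in>?I - ?D. rho p k * (cmod (x k))\<^sup>2) = 0"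
        using x0 by (intro sum.neutral) auto
      ultimately show ?thesis using BD[of x] by simp
    qed
    show "Re (?C x x) > 0" if "Re (?B x x) < 0" for x
    proof -
      have "(\<Sum>k\<in>?D. rho p k * (cmod (x k))\<^sup>2) < 0" using BD[of x] out0[of x] that by linarith
      then obtain k where "k \<in> ?D" "x k \<noteq> 0"
        by (metis (no_types, lifting) less_irrefl mult_zero_right norm_zero power_zero_numeral sum.neutral)
      then show ?thesis unfolding Re_diag_form
        using finite_disk by (intro sum_pos2[of _ k]) auto
    qed
  qed
  then obtain u lam where u: "\<And>i. i < ?N \<Longrightarrow> u i \<in> V" "\<And>i. i < ?N \<Longrightarrow> Re (?B (u i) (u i)) \<le> 0"
    "\<And>i. i < ?N \<Longrightarrow> Re (lam i) > 0"
    "\<And>i j. i < ?N \<Longrightarrow> j < ?N \<Longrightarrow> ?C (u i) (u j) = (if i = j then 1 else 0)"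
    "seq.triangular ?L u lam ?N" by blast
  define T where "T i j = ?C (?L (u i)) (u j)" for i j
  have u0: "u i k = 0" if "i < ?N" "k \<notin> ?I" for i k using u(1)[OF that(1)] that(2) by (simp add: V_def)
  have size: "(\<Sum>k\<in>?I. (cmod (u i k))\<^sup>2) \<le> flag_size p" if i: "i < ?N" for i
  proof -
    have D1: "(\<Sum>k\<in>?D. (cmod (u i k))\<^sup>2) = 1"
      using arg_cong[OF u(4)[OF i i], of Re] unfolding Re_diag_form by simp
    have "(\<Sum>k\<in>?I - ?D. (1 / (1 + P)) * (cmod (u i k))\<^sup>2) \<le> (\<Sum>k\<in>?I - ?D. rho p k * (cmod (u i k))\<^sup>2)"
      using out by (intro sum_mono mult_right_mono) auto
    also have "\<dots> \<le> - (\<Sum>k\<in>?D. rho p k * (cmod (u i k))\<^sup>2)"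
      using u(2)[OF i] BD[of "u i"] by linarith
    also have "\<dots> = (\<Sum>k\<in>?D. - rho p k * (cmod (u i k))\<^sup>2)" by (simp add: sum_negf)
    also have "\<dots> \<le> (\<Sum>k\<in>?D. (1 + P) * (cmod (u i k))\<^sup>2)"
    proof (intro sum_mono mult_right_mono)
      show "- rho p k \<le> 1 + P" for k using rho_bounds(1)[of p k] by (simp add: P_def abs_le_iff)
    qed auto
    also have "\<dots> = 1 + P" unfolding sum_distrib_left[symmetric] D1 by simp
    finally have "(1 / (1 + P)) * (\<Sum>k\<in>?I - ?D. (cmod (u i k))\<^sup>2) \<le> 1 + P"
      by (simp add: sum_distrib_left)
    then have "(\<Sum>k\<in>?I - ?D. (cmod (u i k))\<^sup>2) \<le> (1 + P)\<^sup>2"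
      using P0 by (simp add: field_simps power2_eq_square)
    then show ?thesis
      using D1 sum.subset_diff[OF DI finite_lat_box, of "\<lambda>k. (cmod (u i k))\<^sup>2"]
      by (simp add: flag_size_def P_def)
  qed
  note coord = flag_size_coord[OF finite_lat_box size u0]
  have Lu: "?L (u i) = (\<Sum>j\<le>i. seq_scale (T i j) (u j))" and Tii: "T i i = lam i" if i: "i < ?N" for i
  proof -
    have "?L (u i) - seq_scale (lam i) (u i) \<in> seq.span (u ` {..<i})"
      using u(5) i by (simp add: seq.triangular_def)
    then obtain c where c: "?L (u i) - seq_scale (lam i) (u i) = (\<Sum>j<i. seq_scale (c j) (u j))"
      unfolding seq.in_span_lessThan_iff by blast
    define c' where "c' = c(i := lam i)"
    have "?L (u i) = (\<Sum>j<i. seq_scale (c j) (u j)) + seq_scale (lam i) (u i)"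
      using c by (simp add: algebra_simps)
    also have "\<dots> = (\<Sum>j\<le>i. seq_scale (c' j) (u j))"
      by (simp add: c'_def lessThan_Suc_atMost[symmetric])
    finally have eq: "?L (u i) = (\<Sum>j\<le>i. seq_scale (c' j) (u j))" .
    have T: "T i j = c' j" if "j \<le> i" for j
    proof -
      have "T i j = (\<Sum>l\<le>i. c' l * ?C (u l) (u j))"
        unfolding T_def eq
        by (simp add: seq.herm_sum_left[OF hermitian_diag_form] seq.herm_scale_left[OF hermitian_diag_form])
      also have "\<dots> = (\<Sum>l\<le>i. if l = j then c' j else 0)"
        using u(4) i that by (intro sum.cong) auto
      also have "\<dots> = c' j" using that by simp
      finally show ?thesis .
    qed
    show "?L (u i) = (\<Sum>j\<le>i. seq_scale (T i j) (u j))" unfolding eq using T by (intro sum.cong) auto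
    show "T i i = lam i" using T[of i] by (simp add: c'_def)
  qed
  have Lk: "?L (u i) k = of_real s * lat_op p (u i) k - of_real (eps * rho p k) * u i k"
    if "i < ?N" "k \<in> ?I" for i k
    using trunc_op_supported[of p M "u i" k s eps] u0[OF that(1)] that(2) by blast
  have Tb: "cmod (T i j) \<le> flag_coeff_bound p" if i: "i < ?N" and j: "j \<le> i" for i j
  proof -
    have j': "j < ?N" using i j by simp
    have K: "flag_size p \<ge> 1" by (simp add: flag_size_def)
    have "cmod (T i j) \<le> (\<Sum>d\<in>?D. cmod (?L (u i) d) * cmod (u j d))"
      unfolding T_def diag_form_def by (rule order_trans[OF norm_sum]) (simp add: norm_mult)
    also have "\<dots> \<le> (\<Sum>d\<in>?D. ((\<bar>of_int (cross p d)\<bar> + 1) * (1 + P) * flag_size p) * flag_size p)"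
    proof (intro sum_mono mult_mono)
      fix d assume d: "d \<in> ?D"
      show "cmod (u j d) \<le> flag_size p" using coord[OF j' j'] .
      have "cmod (?L (u i) d) \<le> cmod (of_real s * lat_op p (u i) d) + cmod (of_real (eps * rho p d) * u i d)"
        unfolding Lk[OF i subsetD[OF DI d]] by (rule norm_triangle_ineq4)
      also have "cmod (of_real s * lat_op p (u i) d) \<le> \<bar>of_int (cross p d)\<bar> * (1 + P) * flag_size p"
        using lat_op_bound[OF coord[OF i i]] s by (simp add: norm_mult P_def)
      also have "cmod (of_real (eps * rho p d) * u i d) \<le> (1 * (1 + P)) * flag_size p"
        unfolding norm_mult norm_of_real abs_mult
        using eps rho_bounds(1)[of p d] coord[OF i i] P0
        by (intro mult_mono) (auto simp: P_def)
      finally show "cmod (?L (u i) d) \<le> (\<bar>of_int (cross p d)\<bar> + 1) * (1 + P) * flag_size p"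
        by (simp add: algebra_simps)
    qed (use P0 K in auto)
    finally show ?thesis by (simp add: flag_coeff_bound_def P_def)
  qed
  have "of_real s * lat_op p (u i) k - of_real (eps * rho p k) * u i k = (\<Sum>j\<le>i. T i j * u j k)"
    if "i < ?N" "k \<in> ?I" for i k
    using Lk[OF that] Lu[OF that(1)] by (simp add: sum_fun_apply)
  then have "approx_flag p s eps M u T"
    unfolding approx_flag_def using u0 size u(3,4) Tii Tb by auto
  then show ?thesis by blast
qed


text \<open>
  All entries of the flags and of their matrices are bounded, so a diagonal subsequence converges
  at every index. Each coordinate of \<open>L u\<close> involves two coordinates of \<open>u\<close>, so the equations pass to the limit.
\<close>

lemma flag_limit_exists:
  assumes cop: "coprime (fst p) (snd p)" and s: "\<bar>s\<bar> = 1"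
  shows "\<exists>u T. \<forall>i < card (disk p).
        u i \<in> ell2 \<and> (\<forall>k. cross p k = 0 \<or> rho p k = 0 \<longrightarrow> u i k = 0) \<and>
        (\<forall>j < card (disk p). diag_form (\<lambda>_. 1) (disk p) (u i) (u j) = (if i = j then 1 else 0)) \<and>
        Re (T i i) \<ge> 0 \<and>
        (\<forall>k. cross p k \<noteq> 0 \<and> rho p k \<noteq> 0 \<longrightarrow> of_real s * lat_op p (u i) k = (\<Sum>j\<le>i. T i j * u j k))"
proof -
  let ?N = "card (disk p)"
  define m where "m M = nat (norm_sq p) + M" for M
  define eps where "eps M = 1 / (real M + 1)" for M
  have ex: "\<exists>u T. approx_flag p s (eps M) (m M) u T" for M
    using approx_flag_exists[OF cop s, of "eps M" "m M"] by (simp add: eps_def m_def)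
  define U where "U M = (SOME u. \<exists>T. approx_flag p s (eps M) (m M) u T)" for M
  define T where "T M = (SOME T. approx_flag p s (eps M) (m M) (U M) T)" for M
  have "\<exists>T. approx_flag p s (eps M) (m M) (U M) T" for M
    unfolding U_def by (rule someI_ex[OF ex])
  then have "approx_flag p s (eps M) (m M) (U M) (T M)" for M
    unfolding T_def by (rule someI_ex)
  note af = this[unfolded approx_flag_def, rule_format]
  have supp: "U M i k = 0" if "i < ?N" "k \<notin> lat_box p (m M)" for M i k
    using af[OF that(1), of M] that(2) by blast
  have size: "(\<Sum>k\<in>lat_box p (m M). (cmod (U M i k))\<^sup>2) \<le> flag_size p" if "i < ?N" for M i
    using af[OF that, of M] by blast
  have orth: "diag_form (\<lambda>_. 1) (disk p) (U M i) (U M j) = (if i = j then 1 else 0)" if "i < ?N" "j < ?N" for M i j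
    using af[OF that(1), of M] that(2) by blast
  have Tpos: "Re (T M i i) > 0" if "i < ?N" for M i
    using af[OF that, of M] by blast
  have Tb: "cmod (T M i j) \<le> flag_coeff_bound p" if "i < ?N" "j \<le> i" for M i j
    using af[OF that(1), of M] that(2) by blast
  have eqn: "of_real s * lat_op p (U M i) k - of_real (eps M * rho p k) * U M i k = (\<Sum>j\<le>i. T M i j * U M j k)"
    if "i < ?N" "k \<in> lat_box p (m M)" for M i k
    using af[OF that(1), of M] that(2) by blast
  have Ub: "cmod (U M i k) \<le> flag_size p" if "i < ?N" for M i k
    by (rule flag_size_coord[OF finite_lat_box size[OF that] supp[OF that]])
  \<comment> \<open>All entries of flag and matrix as one function on a countable type.\<close>
  define f :: "nat \<Rightarrow> (nat \<times> (int \<times> int)) + (nat \<times> nat) \<Rightarrow> complex" where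
    "f M x = (case x of Inl ik \<Rightarrow> if fst ik < ?N then U M (fst ik) (snd ik) else 0
       | Inr ij \<Rightarrow> if fst ij < ?N \<and> snd ij \<le> fst ij then T M (fst ij) (snd ij) else 0)" for M x
  have K0: "flag_size p \<ge> 0" "flag_coeff_bound p \<ge> 0"
    using norm_sq_nonneg[of p]
    by (auto simp: flag_size_def flag_coeff_bound_def intro!: sum_nonneg mult_nonneg_nonneg add_nonneg_nonneg)
  have fb: "norm (f M x) \<le> flag_size p + flag_coeff_bound p" for M x
  proof (cases x)
    case (Inl ik)
    have "cmod (U M (fst ik) (snd ik)) \<le> flag_size p + flag_coeff_bound p" if "fst ik < ?N"
      using Ub[OF that, of M "snd ik"] K0 by linarith
    then show ?thesis using K0 Inl by (simp add: f_def)
  next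
    case (Inr ij)
    have "cmod (T M (fst ij) (snd ij)) \<le> flag_size p + flag_coeff_bound p" if "fst ij < ?N" "snd ij \<le> fst ij"
      using Tb[OF that, of M] K0 by linarith
    then show ?thesis using K0 Inr by (simp add: f_def)
  qed
  obtain r where r: "strict_mono r" "\<And>x. x \<in> UNIV \<Longrightarrow> \<exists>l. (\<lambda>n. f (r n) x) \<longlonglongrightarrow> l"
    by (rule function_convergent_subsequence[of UNIV f "flag_size p + flag_coeff_bound p"])
       (use fb in auto)
  define l where "l x = lim (\<lambda>n. f (r n) x)" for x
  have l: "(\<lambda>n. f (r n) x) \<longlonglongrightarrow> l x" for x
    using r(2)[of x] unfolding l_def by (metis UNIV_I limI)
  define u where "u i k = l (Inl (i, k))" for i k
  define S where "S i j = l (Inr (i, j))" for i j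
  have u: "(\<lambda>n. U (r n) i k) \<longlonglongrightarrow> u i k" if "i < ?N" for i k
    using l[of "Inl (i, k)"] that by (simp add: f_def u_def)
  have S: "(\<lambda>n. T (r n) i j) \<longlonglongrightarrow> S i j" if "i < ?N" "j \<le> i" for i j
    using l[of "Inr (i, j)"] that by (simp add: f_def S_def)
  have lop: "(\<lambda>n. lat_op p (U (r n) i) k) \<longlonglongrightarrow> lat_op p (u i) k" if "i < ?N" for i k
    unfolding lat_op_def using u[OF that] by (intro tendsto_intros)
  have rge: "r n \<ge> n" for n using r(1) by (rule seq_suble)
  have eps0: "(\<lambda>n. eps (r n)) \<longlonglongrightarrow> 0"
  proof -
    have "eps \<longlonglongrightarrow> 0"
      unfolding eps_def using LIMSEQ_Suc[OF lim_1_over_n] by (simp add: add.commute)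
    then show ?thesis using LIMSEQ_subseq_LIMSEQ[OF _ r(1), of eps 0] by (simp add: o_def)
  qed
  have "u i \<in> ell2" if i: "i < ?N" for i
  proof -
    have "(\<Sum>k\<in>F. (cmod (u i k))\<^sup>2) \<le> flag_size p" if F: "finite F" for F
    proof (rule LIMSEQ_le_const2)
      show "(\<lambda>n. \<Sum>k\<in>F. (cmod (U (r n) i k))\<^sup>2) \<longlonglongrightarrow> (\<Sum>k\<in>F. (cmod (u i k))\<^sup>2)"
        using u[OF i] by (intro tendsto_intros)
      show "\<exists>N. \<forall>n\<ge>N. (\<Sum>k\<in>F. (cmod (U (r n) i k))\<^sup>2) \<le> flag_size p"
      proof (intro exI allI impI)
        fix n
        have "(\<Sum>k\<in>F. (cmod (U (r n) i k))\<^sup>2) = (\<Sum>k\<in>F \<inter> lat_box p (m (r n)). (cmod (U (r n) i k))\<^sup>2)"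
          using F supp[OF i] by (intro sum.mono_neutral_right) auto
        also have "\<dots> \<le> (\<Sum>k\<in>lat_box p (m (r n)). (cmod (U (r n) i k))\<^sup>2)"
          using finite_lat_box by (intro sum_mono2) auto
        finally show "(\<Sum>k\<in>F. (cmod (U (r n) i k))\<^sup>2) \<le> flag_size p"
          using size[OF i, of "r n"] by linarith
      qed
    qed
    then have "(\<lambda>k. (cmod (u i k))\<^sup>2) summable_on UNIV"
      by (intro nonneg_bdd_above_summable_on bdd_aboveI2[where M = "flag_size p"]) auto
    then show ?thesis by (simp add: ell2_def)
  qed
  moreover have "u i k = 0" if i: "i < ?N" and k: "cross p k = 0 \<or> rho p k = 0" for i k
  proof -
    have "k \<notin> lat_box p M" for M using k by (auto simp: lat_box_def)
    then have "(\<lambda>n. U (r n) i k) = (\<lambda>_. 0)" using supp[OF i] by auto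
    then show ?thesis using u[OF i, of k] LIMSEQ_unique tendsto_const by metis
  qed
  moreover have "diag_form (\<lambda>_. 1) (disk p) (u i) (u j) = (if i = j then 1 else 0)"
    if i: "i < ?N" and j: "j < ?N" for i j
  proof -
    have "(\<lambda>n. diag_form (\<lambda>_. 1) (disk p) (U (r n) i) (U (r n) j)) \<longlonglongrightarrow> diag_form (\<lambda>_. 1) (disk p) (u i) (u j)"
      unfolding diag_form_def using u[OF i] u[OF j] by (intro tendsto_intros)
    then have "(\<lambda>n. if i = j then 1 else 0) \<longlonglongrightarrow> diag_form (\<lambda>_. 1) (disk p) (u i) (u j)"
      unfolding orth[OF i j] .
    then show ?thesis by (rule LIMSEQ_unique[OF _ tendsto_const])
  qed
  moreover have "Re (S i i) \<ge> 0" if i: "i < ?N" for i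
    using tendsto_Re[OF S[OF i order_refl]] Tpos[OF i]
    by (intro LIMSEQ_le_const) (auto intro: less_imp_le)
  moreover have "of_real s * lat_op p (u i) k = (\<Sum>j\<le>i. S i j * u j k)"
    if i: "i < ?N" and k: "cross p k \<noteq> 0 \<and> rho p k \<noteq> 0" for i k
  proof (rule LIMSEQ_unique)
    have "(\<lambda>n. of_real s * lat_op p (U (r n) i) k - of_real (eps (r n) * rho p k) * U (r n) i k) \<longlonglongrightarrow>
        of_real s * lat_op p (u i) k - of_real (0 * rho p k) * u i k"
      using lop[OF i] eps0 u[OF i] by (intro tendsto_intros)
    then show "(\<lambda>n. of_real s * lat_op p (U (r n) i) k - of_real (eps (r n) * rho p k) * U (r n) i k) \<longlonglongrightarrow>
        of_real s * lat_op p (u i) k" by simp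
    have lim: "(\<lambda>n. \<Sum>j\<le>i. T (r n) i j * U (r n) j k) \<longlonglongrightarrow> (\<Sum>j\<le>i. S i j * u j k)"
      using S[OF i] u i by (intro tendsto_sum tendsto_mult) auto
    have "eventually (\<lambda>n. (\<Sum>j\<le>i. T (r n) i j * U (r n) j k) =
        of_real s * lat_op p (U (r n) i) k - of_real (eps (r n) * rho p k) * U (r n) i k) sequentially"
    proof (rule eventually_sequentiallyI)
      fix n assume n: "n \<ge> nat \<bar>fst k\<bar> + nat \<bar>snd k\<bar>"
      have "m (r n) \<ge> nat \<bar>fst k\<bar> + nat \<bar>snd k\<bar>" using n rge[of n] by (simp add: m_def)
      then have "k \<in> lat_box p (m (r n))" using k by (intro in_lat_box_eventually) auto
      from eqn[OF i this] show "(\<Sum>j\<le>i. T (r n) i j * U (r n) j k) =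
        of_real s * lat_op p (U (r n) i) k - of_real (eps (r n) * rho p k) * U (r n) i k" by simp
    qed
    then show "(\<lambda>n. of_real s * lat_op p (U (r n) i) k - of_real (eps (r n) * rho p k) * U (r n) i k) \<longlonglongrightarrow> (\<Sum>j\<le>i. S i j * u j k)"
      using lim by (rule Lim_transform_eventually[rotated])
  qed
  ultimately show ?thesis by blast
qed

section \<open>Unstable subspaces of the lattice operator\<close>

lemma ell2_add:
  assumes "a \<in> ell2" "b \<in> ell2"
  shows "a + b \<in> ell2"
proof -
  have bound: "(cmod ((a + b) k))\<^sup>2 \<le> 2 * (cmod (a k))\<^sup>2 + 2 * (cmod (b k))\<^sup>2" for k
  proof -
    have "(cmod ((a + b) k))\<^sup>2 \<le> (cmod (a k) + cmod (b k))\<^sup>2"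
      using norm_triangle_ineq[of "a k" "b k"] by (intro power_mono) auto
    also have "\<dots> \<le> 2 * (cmod (a k))\<^sup>2 + 2 * (cmod (b k))\<^sup>2"
      using sum_squares_bound[of "cmod (a k)" "cmod (b k)"] by (simp add: power2_sum)
    finally show ?thesis .
  qed
  have "(\<lambda>k. 2 * (cmod (a k))\<^sup>2 + 2 * (cmod (b k))\<^sup>2) summable_on UNIV"
    using assms by (intro summable_on_add summable_on_cmult_right) (auto simp: ell2_def)
  then have "(\<lambda>k. (cmod ((a + b) k))\<^sup>2) summable_on UNIV"
    by (rule summable_on_comparison_test) (use bound in auto)
  then show ?thesis by (simp add: ell2_def)
qed

lemma ell2_scale: "a \<in> ell2 \<Longrightarrow> (\<lambda>k. c * a k) \<in> ell2"
  by (auto simp: ell2_def norm_mult power_mult_distrib intro: summable_on_cmult_right)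

lemma ell2_finite_support:
  assumes "finite Z" "\<And>k. k \<notin> Z \<Longrightarrow> a k = 0"
  shows "a \<in> ell2"
proof -
  have "finite {k \<in> UNIV. (cmod (a k))\<^sup>2 \<noteq> 0}"
    by (rule finite_subset[OF _ assms(1)]) (use assms(2) in auto)
  then show ?thesis unfolding ell2_def by (simp add: finite_nonzero_values_imp_summable_on)
qed

lemma ell2_subspace: "seq.subspace ell2"
  by (rule seq.subspaceI)
     (auto simp: ell2_add seq_scale_def ell2_scale intro: ell2_finite_support[of "{}"])

lemma ell2_0_subspace: "seq.subspace ell2_0"
  using ell2_subspace unfolding seq.subspace_def ell2_0_def by auto

lemma (in complex_vector_space) span_gen_eigenspaces_no_other_eigenvector:
  assumes L: "operator L" and H: "subspace H" and b: "b \<notin> A"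
    and x: "x \<in> span (\<Union>a\<in>A. gen_eigenspace L H a)" and eig: "L x = b *c x"
  shows "x = 0"
proof -
  let ?E = "gen_eigenspace L H"
  have "\<exists>A' f. finite A' \<and> A' \<subseteq> A \<and> (\<forall>a\<in>A'. f a \<in> ?E a) \<and> x = (\<Sum>a\<in>A'. f a)"
    using x
  proof (induction rule: span_induct_alt)
    case base
    have "finite {} \<and> {} \<subseteq> A \<and> (\<forall>a\<in>{}. (\<lambda>_. 0) a \<in> ?E a) \<and> 0 = (\<Sum>a\<in>{}. (\<lambda>_. 0) a)" by simp
    then show ?case by blast
  next
    case (step c z y)
    then obtain A' f where f: "finite A'" "A' \<subseteq> A" "\<And>a. a \<in> A' \<Longrightarrow> f a \<in> ?E a" "y = (\<Sum>a\<in>A'. f a)"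
      by blast
    obtain a where a: "a \<in> A" "z \<in> ?E a" using step(1) by blast
    define g where "g d = (if d \<in> A' then f d else 0) + (if d = a then c *c z else 0)" for d
    have sub: "subspace (?E d)" for d by (rule gen_eigenspace_subspace[OF L H])
    have gE: "g d \<in> ?E d" for d
      unfolding g_def using f(3)[of d] a(2) sub[of d] by (auto intro: subspace_add subspace_0 subspace_scale)
    have "(\<Sum>d\<in>insert a A'. g d) = (\<Sum>d\<in>insert a A'. if d \<in> A' then f d else 0) + (\<Sum>d\<in>insert a A'. if d = a then c *c z else 0)"
      by (simp only: g_def sum.distrib)
    also have "(\<Sum>d\<in>insert a A'. if d = a then c *c z else 0) = c *c z"
      using f(1) by simp
    also have "(\<Sum>d\<in>insert a A'. if d \<in> A' then f d else 0) = (\<Sum>d\<in>A'. f d)"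
      using f(1) by (intro sum.mono_neutral_cong_right) auto
    finally have "c *c z + y = (\<Sum>d\<in>insert a A'. g d)" using f(4) by (simp add: add.commute)
    then show ?case using f(1,2) a(1) gE by (intro exI[of _ "insert a A'"] exI[of _ g]) auto
  qed
  then obtain A' f where f: "finite A'" "A' \<subseteq> A" "\<And>a. a \<in> A' \<Longrightarrow> f a \<in> ?E a" "x = (\<Sum>a\<in>A'. f a)"
    by blast
  note M = operator_shift[OF L, of b]
  have "f a = 0" if a: "a \<in> A'" for a
  proof -
    have "L (f a) - b *c f a = 0"
    proof (rule gen_eigenspace_zero_sum[OF L H f(1) _ _ a])
      show "L (f a) - b *c f a \<in> ?E a" if "a \<in> A'" for a
        using f(3)[OF that] gen_ker_shift[OF L H] unfolding gen_eigenspace_def by blast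
      show "(\<Sum>a\<in>A'. L (f a) - b *c f a) = 0"
        using operator_sum[OF M, of f A'] eig unfolding f(4)[symmetric] by simp
    qed
    moreover obtain n where "f a \<in> gen_ker L H a n"
      using f(3)[OF a] unfolding gen_eigenspace_def by blast
    ultimately show ?thesis
      using gen_ker_no_other_eigenvector[OF L H, of "f a" a n b] f(2) a b by auto
  qed
  then show ?thesis using f(4) by simp
qed

lemma (in complex_vector_space) triangularI:
  assumes "\<And>i. i < n \<Longrightarrow> L (w i) = (\<Sum>j\<le>i. T i j *c w j)"
  shows "triangular L w (\<lambda>i. T i i) n"
  unfolding triangular_def
proof (intro allI impI)
  fix i assume "i < n"
  then have "L (w i) - T i i *c w i = (\<Sum>j<i. T i j *c w j)"
    by (simp add: assms lessThan_Suc_atMost[symmetric])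
  then show "L (w i) - T i i *c w i \<in> span (w ` {..<i})"
    unfolding in_span_lessThan_iff by blast
qed

text \<open>
  The pairing matrix \<open>C (y i) (u j)\<close> is triangular with nonzero diagonal.
\<close>

lemma (in complex_vector_space) independent_triangular_pairing:
  fixes n :: nat
  assumes C: "hermitian C" and diag: "\<And>i. i < n \<Longrightarrow> C (y i) (u i) \<noteq> 0"
    and upper: "\<And>i j. i < j \<Longrightarrow> j < n \<Longrightarrow> C (y i) (u j) = 0"
  shows "independent (y ` {..<n}) \<and> card (y ` {..<n}) = n"
  using diag upper
proof (induction n)
  case (Suc n)
  then have IH: "independent (y ` {..<n})" "card (y ` {..<n}) = n" by auto
  have new: "y n \<notin> span (y ` {..<n})"
  proof
    assume "y n \<in> span (y ` {..<n})"
    then obtain c where "y n = (\<Sum>i<n. c i *c y i)" unfolding in_span_lessThan_iff by blast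
    then have "C (y n) (u n) = (\<Sum>i<n. c i * C (y i) (u n))"
      by (simp add: herm_sum_left[OF C] herm_scale_left[OF C])
    also have "\<dots> = 0" using Suc.prems(2) by simp
    finally show False using Suc.prems(1) by simp
  qed
  then have fresh: "y n \<notin> y ` {..<n}" using span_base[of "y n" "y ` {..<n}"] by auto
  have "card (insert (y n) (y ` {..<n})) = Suc n"
    unfolding card_insert_disjoint[OF finite_imageI[OF finite_lessThan] fresh] IH(2) ..
  then show ?case
    unfolding lessThan_Suc image_insert
    using independent_insertI[OF new IH(1)] by (intro conjI)
qed (use independent_empty in simp)

text \<open>
  \<open>lat_op\<close> sees its argument only through \<open>rho * a\<close>.
\<close>

lemma lat_op_cong:
  assumes "\<And>k. rho p k \<noteq> 0 \<Longrightarrow> a k = b k"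
  shows "lat_op p a = lat_op p b"
proof -
  have "of_real (rho p k) * a k = of_real (rho p k) * b k" for k
    using assms[of k] by (cases "rho p k = 0") auto
  then show ?thesis by (simp only: lat_op_def)
qed

lemma finite_rho_zero: "finite {k. rho p k = 0}"
proof (rule finite_subset)
  show "{k. rho p k = 0} \<subseteq> {- norm_sq p..norm_sq p} \<times> {- norm_sq p..norm_sq p}"
  proof
    fix k assume "k \<in> {k. rho p k = 0}"
    then have "norm_sq k = norm_sq p"
      by (cases "norm_sq k = 0") (auto simp: rho_def)
    moreover have sq: "\<bar>x\<bar> \<le> x\<^sup>2" for x :: int
      using mult_left_mono[of 1 "\<bar>x\<bar>" "\<bar>x\<bar>"] by (cases "x = 0") (auto simp: power2_eq_square)
    ultimately have "\<bar>fst k\<bar> \<le> norm_sq p" "\<bar>snd k\<bar> \<le> norm_sq p"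
      using sq[of "fst k"] sq[of "snd k"] zero_le_power2[of "fst k"] zero_le_power2[of "snd k"]
      unfolding norm_sq_def by linarith+
    then show "k \<in> {- norm_sq p..norm_sq p} \<times> {- norm_sq p..norm_sq p}"
      by (simp add: mem_Times_iff abs_le_iff)
  qed
qed auto

text \<open>
  The limit flag \<open>u\<close> has diagonal entries with \<open>Re \<ge> 0\<close>. If one of them were imaginary, the first such entry
  would differ from all earlier ones, and solving a triangular system would produce an eigenvector \<open>x\<close>
  for it, excluded by \<open>no_neutral_mode\<close>.

  The vectors \<open>u i\<close> satisfy the eigenvalue equations only where \<open>rho\<close> is nonzero. Applying \<open>L\<close> once more repairs
  this: \<open>L\<close> does not see the coordinates with \<open>rho = 0\<close>, so \<open>y i = s * L (u i)\<close> satisfies them everywhere. The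
  diagonal entries being nonzero, the \<open>y i\<close> are still independent.
\<close>

theorem unstable_flag_exists:
  assumes cop: "coprime (fst p) (snd p)" and s: "\<bar>s\<bar> = 1"
  shows "\<exists>y lam. (\<forall>i < card (disk p). y i \<in> ell2_0 \<and> lat_op p (y i) \<in> ell2_0 \<and> s * Re (lam i) > 0) \<and>
    seq.triangular (lat_op p) y lam (card (disk p)) \<and>
    seq.independent (y ` {..<card (disk p)}) \<and> card (y ` {..<card (disk p)}) = card (disk p)"
proof -
  let ?N = "card (disk p)" and ?C = "diag_form (\<lambda>_. 1) (disk p)"
  obtain u T where uT: "\<forall>i < ?N.
        u i \<in> ell2 \<and> (\<forall>k. cross p k = 0 \<or> rho p k = 0 \<longrightarrow> u i k = 0) \<and>
        (\<forall>j < ?N. ?C (u i) (u j) = (if i = j then 1 else 0)) \<and>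
        Re (T i i) \<ge> 0 \<and>
        (\<forall>k. cross p k \<noteq> 0 \<and> rho p k \<noteq> 0 \<longrightarrow> of_real s * lat_op p (u i) k = (\<Sum>j\<le>i. T i j * u j k))"
    using flag_limit_exists[OF cop s] by blast
  have u2: "u i \<in> ell2" if "i < ?N" for i using uT that by blast
  have u0: "u i k = 0" if "i < ?N" "cross p k = 0 \<or> rho p k = 0" for i k using uT that by blast
  have orth: "?C (u i) (u j) = (if i = j then 1 else 0)" if "i < ?N" "j < ?N" for i j using uT that by blast
  have Tge: "Re (T i i) \<ge> 0" if "i < ?N" for i using uT that by blast
  have eqn: "of_real s * lat_op p (u i) k = (\<Sum>j\<le>i. T i j * u j k)"
    if "i < ?N" "cross p k \<noteq> 0" "rho p k \<noteq> 0" for i k using uT that by blast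
  have ss: "s * s = 1" using s by (auto simp: abs_if split: if_splits)
  have css: "of_real s * (of_real s * z) = z" for z :: complex
    using ss by (simp add: mult.assoc[symmetric] of_real_mult[symmetric] del: of_real_mult)
  \<comment> \<open>\<open>Lt\<close> is \<open>Ls\<close> with its values at zeros of \<open>rho\<close> discarded; \<open>u\<close> is an exact flag for \<open>Lt\<close>.\<close>
  define Ls where "Ls x = seq_scale (of_real s) (lat_op p x)" for x
  define Lt where "Lt x k = (if rho p k = 0 then 0 else Ls x k)" for x k
  have Ls: "seq.operator Ls"
    by (rule seq.operatorI)
       (auto simp: Ls_def seq.operator_add[OF lat_op_operator] seq.operator_scale[OF lat_op_operator]
         fun_eq_iff algebra_simps)
  have Lt: "seq.operator Lt"
    by (rule seq.operatorI; rule ext) (simp_all add: Lt_def seq.operator_add[OF Ls] seq.operator_scale[OF Ls])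
  have Ltu: "Lt (u i) = (\<Sum>j\<le>i. seq_scale (T i j) (u j))" if i: "i < ?N" for i
  proof (rule ext)
    fix k
    have z: "(\<Sum>j\<le>i. T i j * u j k) = 0" if "cross p k = 0 \<or> rho p k = 0"
      using u0[OF _ that] i by (intro sum.neutral) auto
    show "Lt (u i) k = (\<Sum>j\<le>i. seq_scale (T i j) (u j)) k"
      using z eqn[OF i, of k]
      by (cases "rho p k = 0"; cases "cross p k = 0")
         (simp_all add: Lt_def Ls_def sum_fun_apply, simp add: lat_op_def)
  qed
  have tri: "seq.triangular Lt u (\<lambda>i. T i i) ?N"
    by (rule seq.triangularI) (rule Ltu)
  have Tpos: "Re (T i i) > 0" if "i < ?N" for i
    using that
  proof (induction i rule: less_induct)
    case (less i)
    show ?case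
    proof (rule ccontr)
      assume "\<not> Re (T i i) > 0"
      then have T0: "Re (T i i) = 0" using Tge[OF less.prems] by simp
      define w where "w = Lt (u i) - seq_scale (T i i) (u i)"
      have "w \<in> seq.span (u ` {..<i})"
        using tri less.prems unfolding seq.triangular_def w_def by blast
      moreover have "seq.triangular Lt u (\<lambda>i. T i i) i"
        using tri less.prems by (simp add: seq.triangular_def)
      moreover have "T j j \<noteq> T i i" if "j < i" for j
        using less.IH[OF that] less.prems that T0 by auto
      ultimately obtain z where z: "z \<in> seq.span (u ` {..<i})" "Lt z - seq_scale (T i i) z = w"
        using seq.triangular_solve[OF Lt, of u "\<lambda>i. T i i" i "T i i" w] by auto
      define x where "x = u i - z"
      have "Lt x - seq_scale (T i i) x = (Lt (u i) - seq_scale (T i i) (u i)) - (Lt z - seq_scale (T i i) z)"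
        unfolding x_def by (simp add: seq.operator_diff[OF Lt] seq.scale_right_diff_distrib)
      then have Lx: "Lt x = seq_scale (T i i) x" unfolding z(2) w_def by simp
      define V where "V = {x \<in> ell2. \<forall>k. cross p k = 0 \<or> rho p k = 0 \<longrightarrow> x k = 0}"
      have V: "seq.subspace V"
        using ell2_subspace unfolding V_def seq.subspace_def by auto
      have uV: "u j \<in> V" if "j < ?N" for j using u2[OF that] u0[OF that] by (simp add: V_def)
      have "seq.span (u ` {..<i}) \<subseteq> V"
        using uV less.prems by (intro seq.span_minimal V) auto
      then have xV: "x \<in> V" unfolding x_def using uV[OF less.prems] z(1) seq.subspace_diff[OF V] by blast
      have "x = 0"
      proof (rule no_neutral_mode[where p = p and al = "of_real s * T i i"])
        show "x \<in> ell2" "\<And>k. rho p k = 0 \<Longrightarrow> x k = 0" "\<And>k. cross p k = 0 \<Longrightarrow> x k = 0"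
          using xV unfolding V_def by blast+
        show "of_real s * T i i * x k = lat_op p x k" if "rho p k \<noteq> 0" for k
        proof -
          have "of_real s * lat_op p x k = T i i * x k"
            using fun_cong[OF Lx, of k] that by (simp add: Lt_def Ls_def)
          then show ?thesis using css[of "lat_op p x k"] by (simp add: mult.assoc)
        qed
        show "Re (of_real s * T i i) = 0" using T0 by simp
      qed
      then have "u i = z" by (simp add: x_def)
      then obtain c where c: "u i = (\<Sum>j<i. seq_scale (c j) (u j))"
        using z(1) unfolding seq.in_span_lessThan_iff by blast
      have "?C (u i) (u i) = (\<Sum>j<i. c j * ?C (u j) (u i))"
        by (subst c) (simp add: seq.herm_sum_left[OF hermitian_diag_form] seq.herm_scale_left[OF hermitian_diag_form])
      also have "\<dots> = 0" using orth less.prems by (intro sum.neutral) auto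
      finally show False using orth[OF less.prems less.prems] by simp
    qed
  qed
  define y where "y i = Ls (u i)" for i
  have yLt: "rho p k \<noteq> 0 \<Longrightarrow> y i k = Lt (u i) k" for i k by (simp add: y_def Lt_def)
  have Lsy: "Ls (y i) = (\<Sum>j\<le>i. seq_scale (T i j) (y j))" if i: "i < ?N" for i
  proof -
    have "Ls (y i) = Ls (Lt (u i))"
      unfolding Ls_def using lat_op_cong[of p "y i" "Lt (u i)"] yLt by simp
    also have "\<dots> = (\<Sum>j\<le>i. seq_scale (T i j) (y j))"
      unfolding Ltu[OF i] by (simp add: seq.operator_sum[OF Ls] seq.operator_scale[OF Ls] y_def)
    finally show ?thesis .
  qed
  have Ly: "lat_op p (y i) = (\<Sum>j\<le>i. seq_scale (of_real s * T i j) (y j))" if i: "i < ?N" for i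
  proof (rule ext)
    fix k
    have "lat_op p (y i) k = of_real s * Ls (y i) k" by (simp add: Ls_def css)
    then show "lat_op p (y i) k = (\<Sum>j\<le>i. seq_scale (of_real s * T i j) (y j)) k"
      unfolding Lsy[OF i] by (simp add: sum_fun_apply sum_distrib_left mult.assoc)
  qed
  have y2: "y i \<in> ell2_0" if i: "i < ?N" for i
  proof -
    have "Lt (u i) \<in> ell2"
      unfolding Ltu[OF i] using u2 i by (intro seq.subspace_sum seq.subspace_scale ell2_subspace) auto
    moreover have "y i - Lt (u i) \<in> ell2"
      by (rule ell2_finite_support[OF finite_rho_zero[of p]]) (use yLt in auto)
    ultimately have "Lt (u i) + (y i - Lt (u i)) \<in> ell2" by (rule ell2_add)
    moreover have "y i 0 = 0" by (simp add: y_def Ls_def lat_op_def)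
    ultimately show ?thesis by (simp add: ell2_0_def)
  qed
  have Ly2: "lat_op p (y i) \<in> ell2_0" if i: "i < ?N" for i
    unfolding Ly[OF i] using y2 i by (intro seq.subspace_sum seq.subspace_scale ell2_0_subspace) auto
  have Cy: "?C (y i) (u j) = (\<Sum>l\<le>i. T i l * ?C (u l) (u j))" if i: "i < ?N" for i j
  proof -
    have "?C (y i) (u j) = ?C (Lt (u i)) (u j)"
      unfolding diag_form_def using rho_bounds(3)[of _ p] yLt by (intro sum.cong) fastforce+
    then show ?thesis
      unfolding Ltu[OF i] by (simp add: seq.herm_sum_left[OF hermitian_diag_form] seq.herm_scale_left[OF hermitian_diag_form])
  qed
  have "seq.independent (y ` {..<?N}) \<and> card (y ` {..<?N}) = ?N"
  proof (rule seq.independent_triangular_pairing[OF hermitian_diag_form])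
    fix i assume i: "i < ?N"
    have "?C (y i) (u i) = (\<Sum>l\<le>i. if l = i then T i i else 0)"
      unfolding Cy[OF i] using orth i by (intro sum.cong) auto
    then show "?C (y i) (u i) \<noteq> 0" using Tpos[OF i] by auto
  next
    fix i j assume ij: "i < j" "j < ?N"
    have i: "i < ?N" using ij by simp
    show "?C (y i) (u j) = 0"
      unfolding Cy[OF i] using orth ij by (intro sum.neutral) auto
  qed
  moreover have "seq.triangular (lat_op p) y (\<lambda>i. of_real s * T i i) ?N"
    by (rule seq.triangularI[where T = "\<lambda>i j. of_real s * T i j"]) (rule Ly)
  moreover have "s * Re (of_real s * T i i) > 0" if "i < ?N" for i
  proof -
    have "s * Re (of_real s * T i i) = (s * s) * Re (T i i)" by (simp add: mult.assoc)
    then have "s * Re (of_real s * T i i) = Re (T i i)" unfolding ss by (simp only: mult_1)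
    then show ?thesis using Tpos[OF that] by (simp only:)
  qed
  ultimately show ?thesis
    using y2 Ly2 by (intro exI[of _ y] exI[of _ "\<lambda>i. of_real s * T i i"]) auto
qed

lemma ell2_product_summable:
  fixes a b :: "'k \<Rightarrow> complex"
  assumes "a \<in> ell2" "b \<in> ell2"
  shows "(\<lambda>k. a k * b k) summable_on UNIV"
proof (rule abs_summable_summable)
  have "(\<lambda>k. (cmod (a k))\<^sup>2 + (cmod (b k))\<^sup>2) summable_on UNIV"
    using assms by (intro summable_on_add) (auto simp: ell2_def)
  then show "(\<lambda>k. norm (a k * b k)) summable_on UNIV"
  proof (rule summable_on_comparison_test)
    fix k
    have "2 * (cmod (a k) * cmod (b k)) \<le> (cmod (a k))\<^sup>2 + (cmod (b k))\<^sup>2"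
      using sum_squares_bound[of "cmod (a k)" "cmod (b k)"] by (simp add: mult.assoc)
    moreover have "0 \<le> cmod (a k) * cmod (b k)" by simp
    ultimately show "norm (a k * b k) \<le> (cmod (a k))\<^sup>2 + (cmod (b k))\<^sup>2"
      unfolding norm_mult by linarith
  qed auto
qed

lemma ell2_cnj: "a \<in> ell2 \<Longrightarrow> (\<lambda>k. cnj (a k)) \<in> ell2"
  by (simp add: ell2_def)

lemma ell2_bounded_mult:
  assumes "a \<in> ell2" "\<And>k. cmod (w k) \<le> K"
  shows "(\<lambda>k. w k * a k) \<in> ell2"
proof -
  have "(\<lambda>k. K\<^sup>2 * (cmod (a k))\<^sup>2) summable_on UNIV"
    using assms(1) by (intro summable_on_cmult_right) (simp add: ell2_def)
  then have "(\<lambda>k. (cmod (w k * a k))\<^sup>2) summable_on UNIV"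
  proof (rule summable_on_comparison_test)
    show "(cmod (w k * a k))\<^sup>2 \<le> K\<^sup>2 * (cmod (a k))\<^sup>2" for k
      unfolding norm_mult power_mult_distrib using assms(2)[of k]
      by (intro mult_right_mono power_mono) auto
  qed auto
  then show ?thesis by (simp add: ell2_def)
qed

lemma infsum_difference:
  fixes f g :: "'k \<Rightarrow> complex"
  assumes "f summable_on A" "g summable_on A"
  shows "(\<Sum>\<^sub>\<infinity>k\<in>A. f k - g k) = infsum f A - infsum g A"
  using infsum_add[OF assms(1) summable_on_uminus[THEN iffD2, OF assms(2)]] by (simp add: infsum_uminus)

text \<open>
  The form \<open>B\<close> restricted to one line \<open>k + \<int> p\<close>. There \<open>p \<times> k\<close> is constant and \<open>L\<close> is bounded, so all sums
  converge absolutely, while on the whole lattice \<open>L x\<close> need not be summable.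
\<close>

definition chain_form :: "int \<times> int \<Rightarrow> int \<times> int \<Rightarrow> (int \<times> int \<Rightarrow> complex) \<Rightarrow> (int \<times> int \<Rightarrow> complex) \<Rightarrow> complex" where
  "chain_form p k x y = (\<Sum>\<^sub>\<infinity>n. of_real (rho p (chain p k n)) * (x (chain p k n) * cnj (y (chain p k n))))"

context
  fixes p k :: "int \<times> int"
  assumes cr: "cross p k \<noteq> 0"
begin

lemma chain_ell2: "x \<in> ell2 \<Longrightarrow> (\<lambda>n. x (chain p k n)) \<in> ell2"
  by (rule ell2_comp_inj[OF _ chain_inj[OF cross_nonzero_imp[OF cr]]])

lemma chain_weighted_ell2: "x \<in> ell2 \<Longrightarrow> (\<lambda>n. of_real (rho p (chain p k n)) * x (chain p k n)) \<in> ell2"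
  by (rule ell2_bounded_mult[OF chain_ell2, of _ _ "1 + of_int (norm_sq p)"]) (use rho_bounds(1) in auto)

lemma chain_form_summable:
  assumes "x \<in> ell2" "y \<in> ell2"
  shows "(\<lambda>n. of_real (rho p (chain p k n)) * (x (chain p k n) * cnj (y (chain p k n)))) summable_on UNIV"
  using ell2_product_summable[OF chain_weighted_ell2[OF assms(1)] ell2_cnj[OF chain_ell2[OF assms(2)]]]
  by (simp add: mult.assoc)

lemma chain_form_cnj: "chain_form p k y x = cnj (chain_form p k x y)"
  unfolding chain_form_def infsum_cnj[symmetric] by (simp add: mult.commute)

lemma chain_form_add:
  "x \<in> ell2 \<Longrightarrow> x' \<in> ell2 \<Longrightarrow> y \<in> ell2 \<Longrightarrow> chain_form p k (x + x') y = chain_form p k x y + chain_form p k x' y"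
  unfolding chain_form_def
  by (subst infsum_add[symmetric]) (simp_all add: chain_form_summable distrib_left distrib_right)

lemma chain_form_scale: "chain_form p k (seq_scale c x) y = c * chain_form p k x y"
  unfolding chain_form_def by (subst infsum_cmult_right'[symmetric]) (simp add: mult.left_commute mult.assoc)

lemma chain_form_zero: "chain_form p k 0 y = 0"
  by (simp add: chain_form_def)

lemma chain_form_skew:
  assumes x: "x \<in> ell2" and y: "y \<in> ell2"
  shows "chain_form p k (lat_op p x) y + chain_form p k x (lat_op p y) = 0"
proof -
  define c :: complex where "c = of_int (cross p k) / 2"
  define g where "g n = of_real (rho p (chain p k n)) * x (chain p k n)" for n
  define h where "h n = of_real (rho p (chain p k n)) * y (chain p k n)" for n
  have g: "g \<in> ell2" and h: "h \<in> ell2"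
    using chain_weighted_ell2[OF x] chain_weighted_ell2[OF y] by (simp_all add: g_def[abs_def] h_def[abs_def])
  have inj: "inj (\<lambda>n::int. n + 1)" "inj (\<lambda>n::int. n - 1)" by (auto simp: inj_def)
  have bij: "bij (\<lambda>n::int. n + 1)" "bij (\<lambda>n::int. n - 1)"
    by (rule bij_betw_byWitness[of _ "\<lambda>n. n - 1"]; auto) (rule bij_betw_byWitness[of _ "\<lambda>n. n + 1"]; auto)
  have s1: "(\<lambda>n. g (n + 1) * cnj (h n)) summable_on UNIV" and s2: "(\<lambda>n. g (n - 1) * cnj (h n)) summable_on UNIV"
    using ell2_product_summable[OF ell2_comp_inj[OF g inj(1)] ell2_cnj[OF h]]
      ell2_product_summable[OF ell2_comp_inj[OF g inj(2)] ell2_cnj[OF h]] by auto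
  have t1: "(\<lambda>n. g n * cnj (h (n + 1))) summable_on UNIV" and t2: "(\<lambda>n. g n * cnj (h (n - 1))) summable_on UNIV"
    using ell2_product_summable[OF g ell2_cnj[OF ell2_comp_inj[OF h inj(1)]]]
      ell2_product_summable[OF g ell2_cnj[OF ell2_comp_inj[OF h inj(2)]]] by auto
  have e1: "(\<Sum>\<^sub>\<infinity>n. g n * cnj (h (n + 1))) = (\<Sum>\<^sub>\<infinity>n. g (n - 1) * cnj (h n))"
    using infsum_reindex_bij_betw[OF bij(1), of "\<lambda>n. g (n - 1) * cnj (h n)"] by simp
  have e2: "(\<Sum>\<^sub>\<infinity>n. g n * cnj (h (n - 1))) = (\<Sum>\<^sub>\<infinity>n. g (n + 1) * cnj (h n))"
    using infsum_reindex_bij_betw[OF bij(2), of "\<lambda>n. g (n + 1) * cnj (h n)"] by simp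
  have lop: "lat_op p z (chain p k n) = c * (of_real (rho p (chain p k (n + 1))) * z (chain p k (n + 1)) - of_real (rho p (chain p k (n - 1))) * z (chain p k (n - 1)))" for z n
    by (simp add: lat_op_def chain_simps c_def)
  have "chain_form p k (lat_op p x) y = (\<Sum>\<^sub>\<infinity>n. c * (g (n + 1) * cnj (h n) - g (n - 1) * cnj (h n)))"
    unfolding chain_form_def lop g_def h_def by (simp add: algebra_simps)
  also have "\<dots> = c * ((\<Sum>\<^sub>\<infinity>n. g (n + 1) * cnj (h n)) - (\<Sum>\<^sub>\<infinity>n. g (n - 1) * cnj (h n)))"
    by (simp add: infsum_cmult_right' infsum_difference[OF s1 s2])
  finally have L: "chain_form p k (lat_op p x) y = c * ((\<Sum>\<^sub>\<infinity>n. g (n + 1) * cnj (h n)) - (\<Sum>\<^sub>\<infinity>n. g (n - 1) * cnj (h n)))" .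
  have "cnj c = c" by (simp add: c_def)
  then have "chain_form p k x (lat_op p y) = (\<Sum>\<^sub>\<infinity>n. c * (g n * cnj (h (n + 1)) - g n * cnj (h (n - 1))))"
    unfolding chain_form_def lop g_def h_def by (simp add: algebra_simps)
  also have "\<dots> = c * ((\<Sum>\<^sub>\<infinity>n. g n * cnj (h (n + 1))) - (\<Sum>\<^sub>\<infinity>n. g n * cnj (h (n - 1))))"
    by (simp add: infsum_cmult_right' infsum_difference[OF t1 t2])
  finally show ?thesis unfolding L e1 e2 by (simp add: algebra_simps)
qed

text \<open>
  For eigenvectors, skewness reads \<open>(a + cnj b) * B x y = 0\<close>; induction over the orders of \<open>x\<close> and \<open>y\<close> reduces
  generalised eigenvectors to this case.
\<close>

lemma chain_form_neutral_gen_ker: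
  assumes "a + cnj b \<noteq> 0"
  shows "x \<in> seq.gen_ker (lat_op p) ell2_0 a m \<Longrightarrow> y \<in> seq.gen_ker (lat_op p) ell2_0 b n \<Longrightarrow> chain_form p k x y = 0"
proof (induction "m + n" arbitrary: m n x y rule: less_induct)
  case less
  note sub = seq.gen_ker_subset[OF lat_op_operator ell2_0_subspace]
  have x2: "x \<in> ell2" and y2: "y \<in> ell2"
    using less.prems sub unfolding ell2_0_def by blast+
  show ?case
  proof (cases "m = 0 \<or> n = 0")
    case True
    then have "x = 0 \<or> y = 0" using less.prems by auto
    then show ?thesis using chain_form_zero chain_form_cnj[of 0 x] by auto
  next
    case False
    then obtain m' n' where mn: "m = Suc m'" "n = Suc n'" by (metis not0_implies_Suc)
    define x' where "x' = lat_op p x - seq_scale a x"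
    define y' where "y' = lat_op p y - seq_scale b y"
    have x': "x' \<in> seq.gen_ker (lat_op p) ell2_0 a m'" and y': "y' \<in> seq.gen_ker (lat_op p) ell2_0 b n'"
      using less.prems mn by (auto simp: x'_def y'_def)
    have x'2: "x' \<in> ell2" and y'2: "y' \<in> ell2" using x' y' sub unfolding ell2_0_def by blast+
    have zx: "chain_form p k x' y = 0" using less.hyps[OF _ x' less.prems(2)] mn by simp
    have "chain_form p k x y' = 0" using less.hyps[OF _ less.prems(1) y'] mn by simp
    then have zy: "chain_form p k y' x = 0" using chain_form_cnj[of y' x] by simp
    have ax: "seq_scale a x \<in> ell2" and "seq_scale b y \<in> ell2"
      using x2 y2 by (simp_all add: seq_scale_def ell2_scale)
    have "lat_op p x = seq_scale a x + x'" by (simp add: x'_def)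
    then have Lx: "chain_form p k (lat_op p x) y = a * chain_form p k x y"
      using chain_form_add[OF ax x'2 y2] zx by (simp add: chain_form_scale)
    have "lat_op p y = seq_scale b y + y'" by (simp add: y'_def)
    then have "chain_form p k (lat_op p y) x = b * chain_form p k y x"
      using chain_form_add[OF \<open>seq_scale b y \<in> ell2\<close> y'2 x2] zy by (simp add: chain_form_scale)
    then have Ly: "chain_form p k x (lat_op p y) = cnj b * chain_form p k x y"
      using chain_form_cnj[of x "lat_op p y"] chain_form_cnj[of x y] by simp
    have "(a + cnj b) * chain_form p k x y = 0"
      using chain_form_skew[OF x2 y2] unfolding Lx Ly by (simp add: distrib_right)
    then show ?thesis using assms by simp
  qed
qed

lemma chain_form_neutral:
  fixes s :: real
  assumes "x \<in> seq.span (\<Union>a\<in>{a. s * Re a > 0}. seq.gen_eigenspace (lat_op p) ell2_0 a)"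
    and "y \<in> seq.span (\<Union>a\<in>{a. s * Re a > 0}. seq.gen_eigenspace (lat_op p) ell2_0 a)"
  shows "chain_form p k x y = 0"
proof -
  let ?U = "\<Union>a\<in>{a. s * Re a > 0}. seq.gen_eigenspace (lat_op p) ell2_0 a"
  have U2: "?U \<subseteq> ell2"
    using seq.gen_ker_subset[OF lat_op_operator ell2_0_subspace]
    unfolding seq.gen_eigenspace_def ell2_0_def by blast
  then have S2: "seq.span ?U \<subseteq> ell2" by (rule seq.span_minimal) (rule ell2_subspace)
  have base: "chain_form p k x y = 0" if "x \<in> ?U" "y \<in> ?U" for x y
  proof -
    obtain a b where ab: "s * Re a > 0" "s * Re b > 0" "x \<in> seq.gen_eigenspace (lat_op p) ell2_0 a"
      "y \<in> seq.gen_eigenspace (lat_op p) ell2_0 b" using \<open>x \<in> ?U\<close> \<open>y \<in> ?U\<close> by blast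
    obtain m n where "x \<in> seq.gen_ker (lat_op p) ell2_0 a m" "y \<in> seq.gen_ker (lat_op p) ell2_0 b n"
      using ab(3,4) unfolding seq.gen_eigenspace_def by blast
    moreover have "a + cnj b \<noteq> 0"
    proof
      assume "a + cnj b = 0"
      from arg_cong[OF this, of "\<lambda>z. s * Re z"] have "s * Re a + s * Re b = 0" by (simp add: distrib_left)
      then show False using ab(1,2) by simp
    qed
    ultimately show ?thesis by (rule chain_form_neutral_gen_ker[rotated 1])
  qed
  have left: "x \<in> ell2 \<and> chain_form p k x y = 0"
    if y: "y \<in> ell2" and U: "\<And>z. z \<in> ?U \<Longrightarrow> chain_form p k z y = 0" and x: "x \<in> seq.span ?U" for x y
    using x
  proof (induction rule: seq.span_induct_alt)
    case base
    have "(0 :: int \<times> int \<Rightarrow> complex) \<in> ell2" by (rule ell2_finite_support[of "{}"]) auto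
    then show ?case using chain_form_zero by (intro conjI)
  next
    case (step c z w)
    have z: "z \<in> ell2" by (rule subsetD[OF U2 step(1)])
    then have cz: "seq_scale c z \<in> ell2" by (simp add: ell2_scale seq_scale_def)
    have w: "w \<in> ell2" "chain_form p k w y = 0" using step(2) by auto
    have "chain_form p k (seq_scale c z + w) y = 0"
      unfolding chain_form_add[OF cz w(1) y] chain_form_scale w(2) U[OF step(1)] by simp
    then show ?case using ell2_add[OF cz w(1)] by (intro conjI)
  qed
  have "chain_form p k y x = 0"
  proof (rule left[THEN conjunct2, OF _ _ assms(2)])
    show "x \<in> ell2" by (rule subsetD[OF S2 assms(1)])
    fix z assume z: "z \<in> ?U"
    have "chain_form p k x z = 0"
      by (rule left[THEN conjunct2, OF subsetD[OF U2 z] base[OF _ z] assms(1)])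
    then show "chain_form p k z x = 0" using chain_form_cnj[of z x] by simp
  qed
  then show ?thesis using chain_form_cnj[of x y] by simp
qed

end

text \<open>
  On each line the form of \<open>x\<close> is \<open>0\<close>, but off the disk it is a sum of nonnegative terms. Hence \<open>rho * x = 0\<close>
  wherever \<open>cross p k\<close> is nonzero, so \<open>L x = 0\<close>; and \<open>0\<close> is not an eigenvalue in the open half-plane.
\<close>

theorem unstable_vanishing_on_disk:
  fixes s :: real
  assumes x: "x \<in> seq.span (\<Union>a\<in>{a. s * Re a > 0}. seq.gen_eigenspace (lat_op p) ell2_0 a)"
    and disk: "\<And>k. k \<in> disk p \<Longrightarrow> x k = 0"
  shows "x = 0"
proof -
  let ?U = "\<Union>a\<in>{a. s * Re a > 0}. seq.gen_eigenspace (lat_op p) ell2_0 a"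
  have "?U \<subseteq> ell2"
    using seq.gen_ker_subset[OF lat_op_operator ell2_0_subspace]
    unfolding seq.gen_eigenspace_def ell2_0_def by blast
  then have "seq.span ?U \<subseteq> ell2" by (rule seq.span_minimal) (rule ell2_subspace)
  then have x2: "x \<in> ell2" using x by blast
  have g0: "of_real (rho p k) * x k = 0" if k: "cross p k \<noteq> 0" for k
  proof -
    define f where "f n = rho p (chain p k n) * (cmod (x (chain p k n)))\<^sup>2" for n
    have ff: "of_real (rho p (chain p k n)) * (x (chain p k n) * cnj (x (chain p k n))) = of_real (f n)" for n
      by (simp add: f_def complex_norm_square del: of_real_power)
    have sumc: "(\<lambda>n. complex_of_real (f n)) summable_on UNIV"
      using chain_form_summable[OF k x2 x2] unfolding ff .
    have fs: "f summable_on UNIV" using summable_on_Re[OF sumc] by simp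
    have "(\<Sum>\<^sub>\<infinity>n. complex_of_real (f n)) = 0"
      using chain_form_neutral[OF k x x] unfolding chain_form_def ff .
    then have "infsum f UNIV = 0" using infsum_Re[OF sumc] by simp
    moreover have "f n \<ge> 0" for n
    proof (cases "chain p k n \<in> disk p")
      case False
      then show ?thesis using rho_bounds(4)[OF False] by (simp add: f_def)
    qed (simp add: f_def disk)
    ultimately have "f 0 = 0" using nonneg_infsum_le_0D[of f UNIV 0] fs by simp
    then show ?thesis by (auto simp: f_def chain_simps)
  qed
  have "lat_op p x = 0"
  proof (rule ext)
    fix k
    show "lat_op p x k = 0 k"
    proof (cases "cross p k = 0")
      case False
      then have "of_real (rho p (k + p)) * x (k + p) = 0" "of_real (rho p (k - p)) * x (k - p) = 0"
        by (intro g0; simp)+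
      then show ?thesis unfolding lat_op_def by (simp only: diff_0_right mult_zero_right zero_fun_def)
    qed (simp add: lat_op_def)
  qed
  then show ?thesis
    by (intro seq.span_gen_eigenspaces_no_other_eigenvector[OF lat_op_operator ell2_0_subspace _ x, of 0]) auto
qed

section \<open>Fourier coefficients on the torus\<close>

definition square :: "(real \<times> real) set" where
  "square = {-pi..pi} \<times> {-pi..pi}"

lemma square_cbox: "square = cbox (-pi, -pi) (pi, pi)"
  by (simp add: square_def cbox_Pair_eq)

lemma square_closed: "compact square" "square \<in> sets lborel"
  unfolding square_cbox by auto

lemma torus_eq: "torus = restrict_space lborel square"
  by (simp add: torus_def square_def)

lemma space_torus: "space torus = square"
  by (simp add: torus_eq space_restrict_space)

lemma integral_torus:
  fixes f :: "real \<times> real \<Rightarrow> 'b::{banach, second_countable_topology}"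
  shows "(\<integral>z. f z \<partial>torus) = (\<integral>z. indicator square z *\<^sub>R f z \<partial>lborel)"
  unfolding torus_eq by (rule integral_restrict_space) (use square_closed in auto)

lemma emeasure_torus_space: "emeasure torus (space torus) = ennreal (4 * pi\<^sup>2)"
proof -
  have "emeasure torus (space torus) = emeasure lborel square"
    unfolding space_torus unfolding torus_eq
    by (rule emeasure_restrict_space) (use square_closed in auto)
  also have "\<dots> = ennreal (4 * pi\<^sup>2)"
    unfolding square_cbox
    by (subst emeasure_lborel_cbox)
       (auto simp: Basis_prod_def power2_eq_square algebra_simps)
  finally show ?thesis .
qed

interpretation torus: finite_measure torus
  by (rule finite_measureI) (simp add: emeasure_torus_space)

lemma measure_torus_space: "measure torus (space torus) = 4 * pi\<^sup>2"
  by (simp add: measure_def emeasure_torus_space)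

lemma continuous_measurable_torus:
  fixes f :: "real \<times> real \<Rightarrow> 'b::topological_space"
  shows "continuous_on UNIV f \<Longrightarrow> f \<in> borel_measurable torus"
  unfolding torus_def using borel_measurable_continuous_onI[of f] by (simp add: measurable_restrict_space1)

lemma continuous_bounded_square:
  fixes f :: "real \<times> real \<Rightarrow> complex"
  assumes "continuous_on UNIV f"
  obtains C where "C \<ge> 0" "\<And>z. z \<in> square \<Longrightarrow> cmod (f z) \<le> C"
proof -
  have "bounded (f ` square)"
    using compact_continuous_image[OF continuous_on_subset[OF assms] square_closed(1)]
      compact_imp_bounded by auto
  then obtain C where "\<forall>w\<in>f ` square. norm w \<le> C" by (auto simp: bounded_iff)
  then show ?thesis using that[of "max C 0"] by force
qed

lemma continuous_integrable_torus:
  fixes f :: "real \<times> real \<Rightarrow> complex"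
  assumes "continuous_on UNIV f"
  shows "integrable torus f"
proof -
  obtain C where "\<And>z. z \<in> square \<Longrightarrow> cmod (f z) \<le> C" using continuous_bounded_square[OF assms] by blast
  then have "AE z in torus. norm (f z) \<le> C" by (intro AE_I2) (simp add: space_torus)
  then show ?thesis
    by (rule torus.integrable_const_bound) (rule continuous_measurable_torus[OF assms])
qed

lemma integrable_mult_continuous:
  fixes f \<theta> :: "real \<times> real \<Rightarrow> complex"
  assumes f: "integrable torus f" and \<theta>: "continuous_on UNIV \<theta>"
  shows "integrable torus (\<lambda>z. f z * \<theta> z)"
proof -
  obtain C where C: "C \<ge> 0" "\<And>z. z \<in> square \<Longrightarrow> cmod (\<theta> z) \<le> C" using continuous_bounded_square[OF \<theta>] by blast
  have "integrable torus (\<lambda>z. of_real C * f z)" using f by simp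
  then show ?thesis
  proof (rule Bochner_Integration.integrable_bound)
    show "(\<lambda>z. f z * \<theta> z) \<in> borel_measurable torus"
      using f continuous_measurable_torus[OF \<theta>] by (intro borel_measurable_times) auto
    show "AE z in torus. norm (f z * \<theta> z) \<le> norm (of_real C * f z)"
      using C by (intro AE_I2) (simp add: space_torus norm_mult mult.commute[of "cmod (f _)"] mult_right_mono)
  qed
qed

lemma square_integrable_integrable:
  assumes "square_integrable f"
  shows "integrable torus f"
proof -
  have "integrable torus (\<lambda>z. 1 + (norm (f z))\<^sup>2)"
    using assms by (simp add: square_integrable_def)
  then show ?thesis
  proof (rule Bochner_Integration.integrable_bound)
    show "f \<in> borel_measurable torus" using assms by (simp add: square_integrable_def)
    have "x \<le> 1 + x\<^sup>2" for x :: real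
      using sum_squares_bound[of x 1] zero_le_power2[of x] by (simp add: power2_eq_square) (smt (verit) zero_le_square)
    then show "AE z in torus. norm (f z) \<le> norm (1 + (norm (f z))\<^sup>2)"
      by (intro AE_I2) (simp add: abs_of_nonneg)
  qed
qed

lemma continuous_square_integrable:
  fixes f :: "real \<times> real \<Rightarrow> complex"
  assumes "continuous_on UNIV f"
  shows "square_integrable f"
proof -
  have "continuous_on UNIV (\<lambda>z. complex_of_real ((norm (f z))\<^sup>2))"
    using assms by (intro continuous_intros)
  from continuous_integrable_torus[OF this] have "integrable torus (\<lambda>z. (norm (f z))\<^sup>2)"
    unfolding complex_of_real_integrable_eq .
  then show ?thesis using continuous_measurable_torus[OF assms] by (simp add: square_integrable_def)
qed

definition fexp :: "int \<times> int \<Rightarrow> real \<times> real \<Rightarrow> complex" where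
  "fexp k z = cis (of_int (fst k) * fst z + of_int (snd k) * snd z)"

lemma fexp_simps: "fexp 0 z = 1" "fexp (j + k) z = fexp j z * fexp k z" "cnj (fexp k z) = fexp (- k) z"
  "cmod (fexp k z) = 1"
  by (simp_all add: fexp_def cis_mult cis_cnj algebra_simps)

lemma continuous_fexp: "continuous_on S (fexp k)"
  unfolding fexp_def by (intro continuous_intros)

lemma fexp_trig: "fexp k = (\<lambda>z. (\<lambda>(x, y). 1 * complex_of_real (cos (of_int (fst k) * x + of_int (snd k) * y))) z
    + (\<lambda>(x, y). \<i> * complex_of_real (sin (of_int (fst k) * x + of_int (snd k) * y))) z)"
  by (auto simp: fun_eq_iff fexp_def complex_eq_iff)

lift_definition em :: "int \<times> int \<Rightarrow> test_fun" is fexp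
proof (intro conjI allI)
  fix k :: "int \<times> int" and n
  have per: "cis (t + of_int m * (2 * pi)) = cis t" for t m
    by (metis cis_mult cis_multiple_2pi[of "of_int m"] Ints_of_int mult.commute mult.right_neutral)
  show "periodic2 (fexp k)"
    unfolding periodic2_def fexp_def
  proof (intro allI conjI)
    fix x y :: real
    show "cis (of_int (fst k) * fst (x + 2 * pi, y) + of_int (snd k) * snd (x + 2 * pi, y)) = cis (of_int (fst k) * fst (x, y) + of_int (snd k) * snd (x, y))"
      using per[of "of_int (fst k) * x + of_int (snd k) * y" "fst k"] by (simp add: algebra_simps)
    show "cis (of_int (fst k) * fst (x, y + 2 * pi) + of_int (snd k) * snd (x, y + 2 * pi)) = cis (of_int (fst k) * fst (x, y) + of_int (snd k) * snd (x, y))"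
      using per[of "of_int (fst k) * x + of_int (snd k) * y" "snd k"] by (simp add: algebra_simps)
  qed
  show "C_class n (fexp k)"
    unfolding fexp_trig by (intro C_class_add C_class_trig)
qed

lemma test_continuous: "continuous_on S (Rep_test_fun \<theta>)"
  using Rep_test_fun[of \<theta>] C_class_continuous[of 0] continuous_on_subset by blast

lemma test_deriv:
  shows test_dx_deriv: "((\<lambda>s. Rep_test_fun \<theta> (s, y)) has_vector_derivative Rep_test_fun (test_dx \<theta>) (x, y)) (at x)"
    and test_dy_deriv: "((\<lambda>s. Rep_test_fun \<theta> (x, s)) has_vector_derivative Rep_test_fun (test_dy \<theta>) (x, y)) (at y)"
proof -
  have "C_class (Suc 0) (Rep_test_fun \<theta>)" using Rep_test_fun[of \<theta>] by blast
  then obtain fx fy where f: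
    "\<And>x y. ((\<lambda>s. Rep_test_fun \<theta> (s, y)) has_vector_derivative fx (x, y)) (at x)"
    "\<And>x y. ((\<lambda>s. Rep_test_fun \<theta> (x, s)) has_vector_derivative fy (x, y)) (at y)" by auto
  show "((\<lambda>s. Rep_test_fun \<theta> (s, y)) has_vector_derivative Rep_test_fun (test_dx \<theta>) (x, y)) (at x)"
    using f(1)[of y x] by (simp add: test_dx.rep_eq vector_derivative_at[OF f(1)])
  show "((\<lambda>s. Rep_test_fun \<theta> (x, s)) has_vector_derivative Rep_test_fun (test_dy \<theta>) (x, y)) (at y)"
    using f(2)[of x y] by (simp add: test_dy.rep_eq vector_derivative_at[OF f(2)])
qed

lemma test_periodic:
  "Rep_test_fun \<theta> (x + 2 * pi, y) = Rep_test_fun \<theta> (x, y)"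
  "Rep_test_fun \<theta> (x, y + 2 * pi) = Rep_test_fun \<theta> (x, y)"
  using Rep_test_fun[of \<theta>] by (auto simp: periodic2_def)

lemma integral_torus_iterated:
  fixes f :: "real \<times> real \<Rightarrow> complex"
  assumes "continuous_on UNIV f"
  shows "(\<integral>z. f z \<partial>torus) = (\<integral>x. indicator {-pi..pi} x *\<^sub>R (\<integral>y. indicator {-pi..pi} y *\<^sub>R f (x, y) \<partial>lborel) \<partial>lborel)"
    and "(\<integral>z. f z \<partial>torus) = (\<integral>y. indicator {-pi..pi} y *\<^sub>R (\<integral>x. indicator {-pi..pi} x *\<^sub>R f (x, y) \<partial>lborel) \<partial>lborel)"
proof -
  define g where "g z = indicator square z *\<^sub>R f z" for z
  have "integrable lborel g"
    using continuous_integrable_torus[OF assms] integrable_restrict_space[of square lborel f] square_closed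
    unfolding torus_eq g_def[abs_def] by simp
  then have int: "integrable (lborel \<Otimes>\<^sub>M lborel) g" by (simp add: lborel_prod)
  have tor: "(\<integral>z. f z \<partial>torus) = integral\<^sup>L (lborel \<Otimes>\<^sub>M lborel) g"
    unfolding integral_torus g_def[abs_def] by (simp add: lborel_prod)
  have g1: "g (x, y) = indicator {-pi..pi} x *\<^sub>R (indicator {-pi..pi} y *\<^sub>R f (x, y))" for x y
    by (auto simp: g_def square_def indicator_def)
  have g2: "g (x, y) = indicator {-pi..pi} y *\<^sub>R (indicator {-pi..pi} x *\<^sub>R f (x, y))" for x y
    by (auto simp: g_def square_def indicator_def)
  show "(\<integral>z. f z \<partial>torus) = (\<integral>x. indicator {-pi..pi} x *\<^sub>R (\<integral>y. indicator {-pi..pi} y *\<^sub>R f (x, y) \<partial>lborel) \<partial>lborel)"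
  proof -
    have "(\<integral>y. g (x, y) \<partial>lborel) = indicator {-pi..pi} x *\<^sub>R (\<integral>y. indicator {-pi..pi} y *\<^sub>R f (x, y) \<partial>lborel)" for x
      by (cases "x \<in> {-pi..pi}") (simp_all add: g1)
    then show ?thesis using lborel_pair.integral_fst'[OF int] unfolding tor by simp
  qed
  have "integrable (lborel \<Otimes>\<^sub>M lborel) (case_prod (\<lambda>x y. g (x, y)))" using int by simp
  show "(\<integral>z. f z \<partial>torus) = (\<integral>y. indicator {-pi..pi} y *\<^sub>R (\<integral>x. indicator {-pi..pi} x *\<^sub>R f (x, y) \<partial>lborel) \<partial>lborel)"
  proof -
    have "(\<integral>x. g (x, y) \<partial>lborel) = indicator {-pi..pi} y *\<^sub>R (\<integral>x. indicator {-pi..pi} x *\<^sub>R f (x, y) \<partial>lborel)" for y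
      by (cases "y \<in> {-pi..pi}") (simp_all add: g2)
    then show ?thesis
      using lborel_pair.integral_snd[OF \<open>integrable (lborel \<Otimes>\<^sub>M lborel) (case_prod (\<lambda>x y. g (x, y)))\<close>]
      unfolding tor by simp
  qed
qed

lemma integral_test_dx: "(\<integral>z. Rep_test_fun (test_dx \<theta>) z \<partial>torus) = 0"
proof -
  have "(\<integral>x. indicator {-pi..pi} x *\<^sub>R Rep_test_fun (test_dx \<theta>) (x, y) \<partial>lborel) = 0" for y
  proof -
    have "(\<integral>x. indicator {-pi..pi} x *\<^sub>R Rep_test_fun (test_dx \<theta>) (x, y) \<partial>lborel) = Rep_test_fun \<theta> (pi, y) - Rep_test_fun \<theta> (- pi, y)"
    proof (rule integral_FTC_Icc[where F = "\<lambda>x. Rep_test_fun \<theta> (x, y)"])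
      show "continuous_on {- pi..pi} (\<lambda>x. Rep_test_fun (test_dx \<theta>) (x, y))"
        by (intro continuous_on_compose2[OF test_continuous[of UNIV]] continuous_intros) auto
      show "((\<lambda>x. Rep_test_fun \<theta> (x, y)) has_vector_derivative Rep_test_fun (test_dx \<theta>) (x, y)) (at x within {- pi..pi})" for x
        by (rule has_vector_derivative_at_within[OF test_dx_deriv])
    qed simp
    also have "\<dots> = 0" using test_periodic(1)[of \<theta> "- pi" y] by simp
    finally show ?thesis .
  qed
  then show ?thesis using integral_torus_iterated(2)[OF test_continuous, of "test_dx \<theta>"] by simp
qed

lemma integral_test_dy: "(\<integral>z. Rep_test_fun (test_dy \<theta>) z \<partial>torus) = 0"
proof -
  have "(\<integral>y. indicator {-pi..pi} y *\<^sub>R Rep_test_fun (test_dy \<theta>) (x, y) \<partial>lborel) = 0" for x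
  proof -
    have "(\<integral>y. indicator {-pi..pi} y *\<^sub>R Rep_test_fun (test_dy \<theta>) (x, y) \<partial>lborel) = Rep_test_fun \<theta> (x, pi) - Rep_test_fun \<theta> (x, - pi)"
    proof (rule integral_FTC_Icc[where F = "\<lambda>y. Rep_test_fun \<theta> (x, y)"])
      show "continuous_on {- pi..pi} (\<lambda>y. Rep_test_fun (test_dy \<theta>) (x, y))"
        by (intro continuous_on_compose2[OF test_continuous[of UNIV]] continuous_intros) auto
      show "((\<lambda>y. Rep_test_fun \<theta> (x, y)) has_vector_derivative Rep_test_fun (test_dy \<theta>) (x, y)) (at y within {- pi..pi})" for y
        by (rule has_vector_derivative_at_within[OF test_dy_deriv])
    qed simp
    also have "\<dots> = 0" using test_periodic(2)[of \<theta> x "- pi"] by simp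
    finally show ?thesis .
  qed
  then show ?thesis using integral_torus_iterated(1)[OF test_continuous, of "test_dy \<theta>"] by simp
qed

lemma Rep_test_mult: "Rep_test_fun (f * g) z = Rep_test_fun f z * Rep_test_fun g z"
  by (simp add: times_test_fun.rep_eq)

lemma Rep_test_add: "Rep_test_fun (f + g) z = Rep_test_fun f z + Rep_test_fun g z"
  by (simp add: plus_test_fun.rep_eq)

lemma Rep_test_dx_mult: "Rep_test_fun (test_dx (f * g)) z =
    Rep_test_fun f z * Rep_test_fun (test_dx g) z + Rep_test_fun (test_dx f) z * Rep_test_fun g z"
proof (cases z)
  case (Pair x y)
  show ?thesis
    using has_vector_derivative_mult[OF test_dx_deriv[of f y x] test_dx_deriv[of g y x]]
      test_dx_deriv[of "f * g" y x] vector_derivative_unique_at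
    unfolding Pair Rep_test_mult by blast
qed

lemma Rep_test_dy_mult: "Rep_test_fun (test_dy (f * g)) z =
    Rep_test_fun f z * Rep_test_fun (test_dy g) z + Rep_test_fun (test_dy f) z * Rep_test_fun g z"
proof (cases z)
  case (Pair x y)
  show ?thesis
    using has_vector_derivative_mult[OF test_dy_deriv[of f x y] test_dy_deriv[of g x y]]
      test_dy_deriv[of "f * g" x y] vector_derivative_unique_at
    unfolding Pair Rep_test_mult by blast
qed

lemma cis_linear_deriv: "((\<lambda>s. cis (a * s + b)) has_vector_derivative \<i> * of_real a * cis (a * x + b)) (at x)"
proof -
  have "((\<lambda>s. \<i> * complex_of_real (a * s + b)) has_vector_derivative \<i> * of_real a) (at x)"
    unfolding has_vector_derivative_def
    by (auto intro!: derivative_eq_intros simp: scaleR_conv_of_real algebra_simps)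
  from field_vector_diff_chain_at[OF this DERIV_exp]
  show ?thesis by (simp add: o_def cis_conv_exp)
qed

lemma Rep_test_dx_em: "Rep_test_fun (test_dx (em k)) z = \<i> * of_int (fst k) * fexp k z"
proof (cases z)
  case (Pair x y)
  have "((\<lambda>s. fexp k (s, y)) has_vector_derivative \<i> * of_int (fst k) * fexp k (x, y)) (at x)"
    using cis_linear_deriv[of "of_int (fst k)" "of_int (snd k) * y" x] by (simp add: fexp_def)
  then show ?thesis
    using test_dx_deriv[of "em k" y x] vector_derivative_unique_at unfolding Pair em.rep_eq by blast
qed

lemma Rep_test_dy_em: "Rep_test_fun (test_dy (em k)) z = \<i> * of_int (snd k) * fexp k z"
proof (cases z)
  case (Pair x y)
  have "((\<lambda>s. fexp k (x, s)) has_vector_derivative \<i> * of_int (snd k) * fexp k (x, y)) (at y)"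
    using cis_linear_deriv[of "of_int (snd k)" "of_int (fst k) * x" y] by (simp add: fexp_def add.commute)
  then show ?thesis
    using test_dy_deriv[of "em k" x y] vector_derivative_unique_at unfolding Pair em.rep_eq by blast
qed

text \<open>
  No complex conjugation: \<open>pairing k\<close> is the distribution given by the function \<open>fexp k\<close>, so \<open>dist_of w\<close> is the
  sum of the \<open>coef w k * pairing k\<close>.
\<close>

definition pairing :: "int \<times> int \<Rightarrow> test_fun \<Rightarrow> complex" where
  "pairing k \<theta> = (\<integral>z. fexp k z * Rep_test_fun \<theta> z \<partial>torus)"

lemma pairing_integrable: "integrable torus (\<lambda>z. fexp k z * Rep_test_fun \<theta> z)"
  by (intro continuous_integrable_torus continuous_on_mult continuous_fexp test_continuous)

lemma pairing_dx: "pairing k (test_dx \<theta>) = - \<i> * of_int (fst k) * pairing k \<theta>"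
proof -
  have "0 = (\<integral>z. Rep_test_fun (test_dx (em k * \<theta>)) z \<partial>torus)" by (simp add: integral_test_dx)
  also have "\<dots> = (\<integral>z. fexp k z * Rep_test_fun (test_dx \<theta>) z + \<i> * of_int (fst k) * (fexp k z * Rep_test_fun \<theta> z) \<partial>torus)"
    unfolding Rep_test_dx_mult Rep_test_dx_em em.rep_eq by (simp add: mult.assoc)
  also have "\<dots> = pairing k (test_dx \<theta>) + \<i> * of_int (fst k) * pairing k \<theta>"
    unfolding pairing_def using pairing_integrable by (subst Bochner_Integration.integral_add) auto
  finally show ?thesis by (simp add: algebra_simps add_eq_0_iff)
qed

lemma pairing_dy: "pairing k (test_dy \<theta>) = - \<i> * of_int (snd k) * pairing k \<theta>"
proof -
  have "0 = (\<integral>z. Rep_test_fun (test_dy (em k * \<theta>)) z \<partial>torus)" by (simp add: integral_test_dy)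
  also have "\<dots> = (\<integral>z. fexp k z * Rep_test_fun (test_dy \<theta>) z + \<i> * of_int (snd k) * (fexp k z * Rep_test_fun \<theta> z) \<partial>torus)"
    unfolding Rep_test_dy_mult Rep_test_dy_em em.rep_eq by (simp add: mult.assoc)
  also have "\<dots> = pairing k (test_dy \<theta>) + \<i> * of_int (snd k) * pairing k \<theta>"
    unfolding pairing_def using pairing_integrable by (subst Bochner_Integration.integral_add) auto
  finally show ?thesis by (simp add: algebra_simps add_eq_0_iff)
qed

lemma integral_fexp: "(\<integral>z. fexp k z \<partial>torus) = (if k = 0 then 4 * pi\<^sup>2 else 0)"
proof (cases "k = 0")
  case True
  then show ?thesis by (simp add: fexp_simps measure_torus_space scaleR_conv_of_real)
next
  case False
  have "\<i> * of_int (fst k) * (\<integral>z. fexp k z \<partial>torus) = 0"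
    using integral_test_dx[of "em k"] unfolding Rep_test_dx_em by simp
  moreover have "\<i> * of_int (snd k) * (\<integral>z. fexp k z \<partial>torus) = 0"
    using integral_test_dy[of "em k"] unfolding Rep_test_dy_em by simp
  moreover have "fst k \<noteq> 0 \<or> snd k \<noteq> 0" using False by (auto simp: prod_eq_iff)
  ultimately show ?thesis using False by auto
qed

lemma pairing_em: "pairing j (em k) = (if k = - j then 4 * pi\<^sup>2 else 0)"
proof -
  have "pairing j (em k) = (\<integral>z. fexp (j + k) z \<partial>torus)" by (simp add: pairing_def em.rep_eq fexp_simps)
  moreover have "j + k = 0 \<longleftrightarrow> k = - j" by (metis add.commute add_eq_0_iff)
  ultimately show ?thesis by (simp add: integral_fexp)
qed

definition fcoeff :: "(real \<times> real \<Rightarrow> complex) \<Rightarrow> int \<times> int \<Rightarrow> complex" where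
  "fcoeff f k = (\<integral>z. f z * fexp (- k) z \<partial>torus) / (4 * pi\<^sup>2)"

lemma trig_norm:
  assumes "finite A"
  shows "(\<integral>z. (cmod (\<Sum>k\<in>A. a k * fexp k z))\<^sup>2 \<partial>torus) = 4 * pi\<^sup>2 * (\<Sum>k\<in>A. (cmod (a k))\<^sup>2)"
proof -
  have i1: "integrable torus (\<lambda>z. a j * cnj (a k) * fexp (j - k) z)" for j k
    by (intro integrable_mult_right continuous_integrable_torus continuous_fexp)
  have e: "complex_of_real ((cmod (\<Sum>k\<in>A. a k * fexp k z))\<^sup>2) = (\<Sum>j\<in>A. \<Sum>k\<in>A. a j * cnj (a k) * fexp (j - k) z)" for z
  proof -
    have "complex_of_real ((cmod (\<Sum>k\<in>A. a k * fexp k z))\<^sup>2) = (\<Sum>j\<in>A. a j * fexp j z) * cnj (\<Sum>k\<in>A. a k * fexp k z)"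
      by (rule complex_norm_square)
    also have "\<dots> = (\<Sum>j\<in>A. \<Sum>k\<in>A. (a j * fexp j z) * (cnj (a k) * fexp (- k) z))"
      by (simp add: sum_product fexp_simps)
    also have "\<dots> = (\<Sum>j\<in>A. \<Sum>k\<in>A. a j * cnj (a k) * fexp (j - k) z)"
      using fexp_simps(2)[of _ "- _" z] by (intro sum.cong refl) (simp add: mult_ac)
    finally show ?thesis .
  qed
  have "complex_of_real (\<integral>z. (cmod (\<Sum>k\<in>A. a k * fexp k z))\<^sup>2 \<partial>torus) = (\<integral>z. (\<Sum>j\<in>A. \<Sum>k\<in>A. a j * cnj (a k) * fexp (j - k) z) \<partial>torus)"
    unfolding e[symmetric] by (rule integral_complex_of_real[symmetric])
  also have "\<dots> = (\<Sum>j\<in>A. \<Sum>k\<in>A. a j * cnj (a k) * (\<integral>z. fexp (j - k) z \<partial>torus))"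
    using i1 by (simp add: Bochner_Integration.integral_sum)
  also have "\<dots> = (\<Sum>j\<in>A. \<Sum>k\<in>A. if k = j then a j * cnj (a j) * (4 * pi\<^sup>2) else 0)"
    unfolding integral_fexp by (intro sum.cong refl) auto
  also have "\<dots> = (\<Sum>j\<in>A. of_real (4 * pi\<^sup>2 * (cmod (a j))\<^sup>2))"
    using assms by (intro sum.cong refl) (simp add: complex_norm_square mult.commute del: of_real_power)
  finally have "complex_of_real (\<integral>z. (cmod (\<Sum>k\<in>A. a k * fexp k z))\<^sup>2 \<partial>torus) = of_real (4 * pi\<^sup>2 * (\<Sum>k\<in>A. (cmod (a k))\<^sup>2))"
    by (simp add: sum_distrib_left)
  then show ?thesis by (simp only: of_real_eq_iff)
qed

lemma bessel:
  assumes f: "square_integrable f" and A: "finite A"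
  shows "4 * pi\<^sup>2 * (\<Sum>k\<in>A. (cmod (fcoeff f k))\<^sup>2) \<le> (\<integral>z. (cmod (f z))\<^sup>2 \<partial>torus)"
proof -
  define c where "c = fcoeff f"
  define S where "S z = (\<Sum>k\<in>A. c k * fexp k z)" for z
  have fi: "integrable torus f" by (rule square_integrable_integrable[OF f])
  have Sc: "continuous_on UNIV S" unfolding S_def by (intro continuous_intros continuous_fexp)
  have S2: "integrable torus (\<lambda>z. (cmod (S z))\<^sup>2)"
    using continuous_square_integrable[OF Sc] by (simp add: square_integrable_def)
  have f2: "integrable torus (\<lambda>z. (cmod (f z))\<^sup>2)" using f by (simp add: square_integrable_def)
  have fS: "integrable torus (\<lambda>z. f z * cnj (S z))"
    using Sc by (intro integrable_mult_continuous[OF fi] continuous_intros)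
  have "(\<integral>z. f z * cnj (S z) \<partial>torus) = (\<integral>z. (\<Sum>k\<in>A. cnj (c k) * (f z * fexp (- k) z)) \<partial>torus)"
    by (simp add: S_def fexp_simps sum_distrib_left mult_ac)
  also have "\<dots> = (\<Sum>k\<in>A. cnj (c k) * (\<integral>z. f z * fexp (- k) z \<partial>torus))"
    using integrable_mult_continuous[OF fi continuous_fexp] by (simp add: Bochner_Integration.integral_sum)
  also have "\<dots> = (\<Sum>k\<in>A. of_real (4 * pi\<^sup>2 * (cmod (c k))\<^sup>2))"
  proof (rule sum.cong[OF refl])
    fix k
    have "(\<integral>z. f z * fexp (- k) z \<partial>torus) = c k * (4 * pi\<^sup>2)" by (simp add: c_def fcoeff_def)
    then show "cnj (c k) * (\<integral>z. f z * fexp (- k) z \<partial>torus) = of_real (4 * pi\<^sup>2 * (cmod (c k))\<^sup>2)"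
      using complex_norm_square[of "c k"] by (simp add: mult_ac del: of_real_power)
  qed
  finally have inner: "Re (\<integral>z. f z * cnj (S z) \<partial>torus) = 4 * pi\<^sup>2 * (\<Sum>k\<in>A. (cmod (c k))\<^sup>2)"
    by (simp add: sum_distrib_left)
  define h where "h z = Re (f z * cnj (S z))" for z
  have h: "integrable torus h" "integral\<^sup>L torus h = Re (\<integral>z. f z * cnj (S z) \<partial>torus)"
    using integrable_Re[OF fS] integral_Re[OF fS] by (simp_all only: h_def[abs_def])
  have e: "(cmod (f z - S z))\<^sup>2 = (cmod (f z))\<^sup>2 - 2 * h z + (cmod (S z))\<^sup>2" for z
    unfolding cmod_power2 h_def by (simp add: power2_eq_square algebra_simps)
  have "0 \<le> (\<integral>z. (cmod (f z - S z))\<^sup>2 \<partial>torus)" by simp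
  also have "\<dots> = (\<integral>z. (cmod (f z))\<^sup>2 \<partial>torus) - 2 * Re (\<integral>z. f z * cnj (S z) \<partial>torus) + (\<integral>z. (cmod (S z))\<^sup>2 \<partial>torus)"
    unfolding e h(2)[symmetric] using f2 S2 h(1) by simp
  also have "(\<integral>z. (cmod (S z))\<^sup>2 \<partial>torus) = 4 * pi\<^sup>2 * (\<Sum>k\<in>A. (cmod (c k))\<^sup>2)"
    unfolding S_def by (rule trig_norm[OF A])
  finally show ?thesis unfolding inner by (simp add: c_def)
qed

lemma fcoeff_ell2:
  assumes "square_integrable f"
  shows "fcoeff f \<in> ell2"
proof -
  define C where "C = (\<integral>z. (cmod (f z))\<^sup>2 \<partial>torus) / (4 * pi\<^sup>2)"
  have "(\<Sum>k\<in>A. (cmod (fcoeff f k))\<^sup>2) \<le> C" if "finite A" for A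
    using bessel[OF assms that] by (simp add: C_def field_simps)
  then have "(\<lambda>k. (cmod (fcoeff f k))\<^sup>2) summable_on UNIV"
    by (intro nonneg_bdd_above_summable_on bdd_aboveI2[where M = C]) auto
  then show ?thesis by (simp add: ell2_def)
qed

lemma pairing_ell2: "(\<lambda>k. pairing k \<theta>) \<in> ell2"
proof -
  have inj: "inj (\<lambda>k :: int \<times> int. - k)" by (simp add: inj_def)
  have "fcoeff (Rep_test_fun \<theta>) \<in> ell2"
    by (intro fcoeff_ell2 continuous_square_integrable test_continuous)
  from ell2_scale[OF ell2_comp_inj[OF this inj], of "4 * pi\<^sup>2"]
  show ?thesis by (simp add: fcoeff_def pairing_def mult.commute)
qed

section \<open>Uniqueness of Fourier coefficients\<close>

inductive_set trig_span :: "(real \<times> real \<Rightarrow> complex) set" where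
  "fexp k \<in> trig_span"
| "f \<in> trig_span \<Longrightarrow> (\<lambda>z. c * f z) \<in> trig_span"
| "f \<in> trig_span \<Longrightarrow> g \<in> trig_span \<Longrightarrow> (\<lambda>z. f z + g z) \<in> trig_span"

lemma trig_span_continuous: "f \<in> trig_span \<Longrightarrow> continuous_on UNIV f"
  by (induction rule: trig_span.induct) (auto intro!: continuous_intros continuous_fexp)

lemma trig_span_mult:
  assumes "f \<in> trig_span" "g \<in> trig_span"
  shows "(\<lambda>z. f z * g z) \<in> trig_span"
  using assms(1)
proof (induction rule: trig_span.induct)
  case (1 j)
  show ?case
    using assms(2)
  proof (induction rule: trig_span.induct)
    case (1 k)
    have "(\<lambda>z. fexp j z * fexp k z) = fexp (j + k)" by (simp add: fun_eq_iff fexp_simps)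
    then show ?case by (simp add: trig_span.intros)
  next
    case (2 g c)
    have "(\<lambda>z. fexp j z * (c * g z)) = (\<lambda>z. c * (fexp j z * g z))" by (simp add: fun_eq_iff)
    then show ?case using trig_span.intros(2)[OF 2(2), of c] by simp
  next
    case (3 g h)
    then show ?case using trig_span.intros(3)[OF 3(3,4)] by (simp add: distrib_left)
  qed
next
  case (2 f c)
  then show ?case using trig_span.intros(2)[OF 2(2), of c] by (simp add: mult.assoc)
next
  case (3 f h)
  then show ?case using trig_span.intros(3)[OF 3(3,4)] by (simp add: distrib_right)
qed

lemma trig_span_const: "(\<lambda>_. c) \<in> trig_span"
  using trig_span.intros(2)[OF trig_span.intros(1)[of 0], of c] by (simp add: fexp_simps)

text \<open>
  The torus as a subset of a Euclidean space, where polynomials are dense in the continuous functions;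
  their pullbacks are trigonometric polynomials.
\<close>

definition torus_embed :: "real \<times> real \<Rightarrow> complex \<times> complex" where
  "torus_embed z = (cis (fst z), cis (snd z))"

lemma continuous_torus_embed: "continuous_on S torus_embed"
  unfolding torus_embed_def by (intro continuous_intros)

lemma trig_span_coords:
  "(\<lambda>z. complex_of_real (cos (fst z))) \<in> trig_span" "(\<lambda>z. complex_of_real (sin (fst z))) \<in> trig_span"
  "(\<lambda>z. complex_of_real (cos (snd z))) \<in> trig_span" "(\<lambda>z. complex_of_real (sin (snd z))) \<in> trig_span"
proof -
  have c: "(\<lambda>z. a * fexp k z + b * fexp (- k) z) \<in> trig_span" for a b k
    by (intro trig_span.intros)
  have "(\<lambda>z. complex_of_real (cos (fst z))) = (\<lambda>z. 1 / 2 * fexp (1, 0) z + 1 / 2 * fexp (- (1, 0)) z)"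
    "(\<lambda>z. complex_of_real (sin (fst z))) = (\<lambda>z. - (\<i> / 2) * fexp (1, 0) z + \<i> / 2 * fexp (- (1, 0)) z)"
    "(\<lambda>z. complex_of_real (cos (snd z))) = (\<lambda>z. 1 / 2 * fexp (0, 1) z + 1 / 2 * fexp (- (0, 1)) z)"
    "(\<lambda>z. complex_of_real (sin (snd z))) = (\<lambda>z. - (\<i> / 2) * fexp (0, 1) z + \<i> / 2 * fexp (- (0, 1)) z)"
    by (auto simp: fun_eq_iff fexp_def complex_eq_iff)
  then show "(\<lambda>z. complex_of_real (cos (fst z))) \<in> trig_span" "(\<lambda>z. complex_of_real (sin (fst z))) \<in> trig_span"
    "(\<lambda>z. complex_of_real (cos (snd z))) \<in> trig_span" "(\<lambda>z. complex_of_real (sin (snd z))) \<in> trig_span"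
    by (simp_all only: c)
qed

lemma polynomial_torus_embed:
  fixes g :: "complex \<times> complex \<Rightarrow> real"
  assumes "real_polynomial_function g"
  shows "(\<lambda>z. complex_of_real (g (torus_embed z))) \<in> trig_span"
  using assms
proof (induction rule: real_polynomial_function.induct)
  case (linear g)
  interpret g: bounded_linear g by fact
  have e: "torus_embed z = cos (fst z) *\<^sub>R (1, 0) + sin (fst z) *\<^sub>R (\<i>, 0) + cos (snd z) *\<^sub>R (0, 1) + sin (snd z) *\<^sub>R (0, \<i>)" for z
    by (simp add: torus_embed_def complex_eq_iff)
  have "(\<lambda>z. complex_of_real (g (torus_embed z))) = (\<lambda>z. of_real (g (1, 0)) * of_real (cos (fst z)) + of_real (g (\<i>, 0)) * of_real (sin (fst z))
     + of_real (g (0, 1)) * of_real (cos (snd z)) + of_real (g (0, \<i>)) * of_real (sin (snd z)))"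
    unfolding e g.add g.scaleR by (simp add: fun_eq_iff mult.commute)
  also have "\<dots> \<in> trig_span"
    by (intro trig_span.intros(2,3) trig_span_coords)
  finally show ?case .
next
  case (const c)
  show ?case by (rule trig_span_const)
next
  case (add g h)
  then show ?case using trig_span.intros(3)[OF add.IH] by simp
next
  case (mult g h)
  then show ?case using trig_span_mult[OF mult.IH] by simp
qed

lemma integral_zero_trig_span:
  assumes f: "integrable torus f" "\<And>k. (\<integral>z. f z * fexp k z \<partial>torus) = 0" and g: "g \<in> trig_span"
  shows "(\<integral>z. f z * g z \<partial>torus) = 0"
  using g
proof (induction rule: trig_span.induct)
  case (2 g c)
  have "(\<integral>z. f z * (c * g z) \<partial>torus) = c * (\<integral>z. f z * g z \<partial>torus)"
    by (simp add: mult.left_commute)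
  then show ?case using 2 by simp
next
  case (3 g h)
  have "(\<integral>z. f z * (g z + h z) \<partial>torus) = (\<integral>z. f z * g z \<partial>torus) + (\<integral>z. f z * h z \<partial>torus)"
    unfolding distrib_left
    by (intro Bochner_Integration.integral_add integrable_mult_continuous[OF f(1)] trig_span_continuous 3)
  then show ?case using 3 by simp
qed (rule f(2))

lemma integral_zero_continuous:
  fixes h :: "complex \<times> complex \<Rightarrow> real"
  assumes f: "integrable torus f" "\<And>k. (\<integral>z. f z * fexp k z \<partial>torus) = 0" and h: "continuous_on UNIV h"
  shows "(\<integral>z. f z * of_real (h (torus_embed z)) \<partial>torus) = 0"
proof -
  define S :: "(complex \<times> complex) set" where "S = sphere 0 1 \<times> sphere 0 1"
  have S: "compact S" "\<And>z. torus_embed z \<in> S"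
    by (auto simp: S_def compact_Times torus_embed_def)
  have hS: "continuous_on S h" using h continuous_on_subset by blast
  have hE: "continuous_on UNIV (\<lambda>z. complex_of_real (h (torus_embed z)))"
    by (intro continuous_intros continuous_on_compose2[OF h continuous_torus_embed]) auto
  define N where "N = (\<integral>z. cmod (f z) \<partial>torus)"
  have N: "N \<ge> 0" by (simp add: N_def)
  have "cmod (\<integral>z. f z * of_real (h (torus_embed z)) \<partial>torus) \<le> e" if e: "e > 0" for e
  proof -
    define d where "d = e / (N + 1)"
    have d: "d > 0" using e N by (simp add: d_def)
    obtain g where g: "real_polynomial_function g" "\<And>w. w \<in> S \<Longrightarrow> \<bar>h w - g w\<bar> < d"
      using Stone_Weierstrass_real_polynomial_function[OF S(1) hS d] by blast
    define G where "G z = complex_of_real (g (torus_embed z))" for z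
    have G: "G \<in> trig_span" unfolding G_def[abs_def] by (rule polynomial_torus_embed[OF g(1)])
    note Gc = trig_span_continuous[OF G]
    define D where "D z = of_real (h (torus_embed z)) - G z" for z
    have Dc: "continuous_on UNIV D" unfolding D_def by (intro continuous_intros hE Gc)
    have Db: "cmod (D z) \<le> d" for z
      using g(2)[OF S(2)[of z]] unfolding D_def G_def of_real_diff[symmetric] norm_of_real by simp
    have "(\<integral>z. f z * of_real (h (torus_embed z)) \<partial>torus) = (\<integral>z. f z * D z + f z * G z \<partial>torus)"
      by (simp add: D_def algebra_simps)
    also have "\<dots> = (\<integral>z. f z * D z \<partial>torus) + (\<integral>z. f z * G z \<partial>torus)"
      by (intro Bochner_Integration.integral_add integrable_mult_continuous[OF f(1)] Dc Gc)
    finally have "(\<integral>z. f z * of_real (h (torus_embed z)) \<partial>torus) = (\<integral>z. f z * D z \<partial>torus)"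
      using integral_zero_trig_span[OF f G] by simp
    also have "cmod \<dots> \<le> (\<integral>z. cmod (f z * D z) \<partial>torus)" by (rule integral_norm_bound)
    also have "\<dots> \<le> (\<integral>z. d * cmod (f z) \<partial>torus)"
    proof (rule integral_mono)
      show "integrable torus (\<lambda>z. cmod (f z * D z))"
        by (intro integrable_norm integrable_mult_continuous[OF f(1)] Dc)
      show "integrable torus (\<lambda>z. d * cmod (f z))" using f(1) by simp
      show "cmod (f z * D z) \<le> d * cmod (f z)" for z
        using mult_left_mono[OF Db[of z], of "cmod (f z)"] by (simp add: norm_mult mult.commute)
    qed
    also have "\<dots> = d * N" by (simp add: N_def)
    also have "\<dots> \<le> e" using e N by (simp add: d_def field_simps)
    finally show ?thesis .
  qed
  then have "cmod (\<integral>z. f z * of_real (h (torus_embed z)) \<partial>torus) \<le> 0" by (rule field_le_epsilon[of _ 0, simplified]) 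
  then show ?thesis by simp
qed

definition open_square :: "(real \<times> real) set" where
  "open_square = {-pi<..<pi} \<times> {-pi<..<pi}"

lemma cis_inj_square:
  assumes "cis x = cis y" "- pi \<le> x" "x \<le> pi" "- pi < y" "y < pi"
  shows "x = y"
proof -
  have "cis (x - y) = 1" using assms(1) by (simp add: cis_divide[symmetric])
  then have "cos (x - y) = 1" by (simp add: complex_eq_iff)
  then obtain n :: int where n: "x - y = of_int n * 2 * pi" by (auto simp: cos_one_2pi_int)
  have "\<bar>of_int n * 2 * pi\<bar> < 2 * pi" using assms(2-5) unfolding n[symmetric] by (simp add: abs_less_iff)
  then have "\<bar>real_of_int n\<bar> < 1" using pi_gt_zero by (simp add: abs_mult)
  then have "n = 0" by linarith
  then show ?thesis using n by simp
qed

text \<open>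
  The indicator of \<open>K\<close> is the pointwise limit of continuous functions of the distance to the image of \<open>K\<close>
  in the torus. The open square is where the embedding of the closed square is injective.
\<close>

lemma integral_zero_compact:
  assumes f: "integrable torus f" "\<And>k. (\<integral>z. f z * fexp k z \<partial>torus) = 0"
    and K: "compact K" "K \<subseteq> open_square" "K \<noteq> {}"
  shows "(\<integral>z. indicator K z *\<^sub>R f z \<partial>torus) = 0"
proof -
  define C where "C = torus_embed ` K"
  have C: "closed C" "C \<noteq> {}"
    using compact_continuous_image[OF continuous_torus_embed K(1)] compact_imp_closed K(3) by (auto simp: C_def)
  have CK: "torus_embed z \<in> C \<longleftrightarrow> z \<in> K" if z: "z \<in> square" for z
  proof
    assume "torus_embed z \<in> C"
    then obtain w where w: "w \<in> K" "torus_embed z = torus_embed w" by (auto simp: C_def)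
    have wo: "w \<in> open_square" using w(1) K(2) by blast
    have "fst z = fst w"
      using w(2) wo z by (intro cis_inj_square) (auto simp: torus_embed_def open_square_def square_def)
    moreover have "snd z = snd w"
      using w(2) wo z by (intro cis_inj_square) (auto simp: torus_embed_def open_square_def square_def)
    ultimately have "z = w" by (rule prod_eqI)
    then show "z \<in> K" using w(1) by simp
  qed (simp add: C_def)
  define h where "h n w = max 0 (1 - real n * infdist w C)" for n :: nat and w
  have hc: "continuous_on UNIV (h n)" for n
    unfolding h_def by (intro continuous_intros)
  have hE: "continuous_on UNIV (\<lambda>z. complex_of_real (h n (torus_embed z)))" for n
    by (intro continuous_intros continuous_on_compose2[OF hc continuous_torus_embed]) auto
  have hlim: "(\<lambda>n. h n (torus_embed z)) \<longlonglongrightarrow> indicator K z" if z: "z \<in> square" for z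
  proof (cases "z \<in> K")
    case True
    then have "infdist (torus_embed z) C = 0" using CK[OF z] by simp
    then show ?thesis using True by (simp add: h_def)
  next
    case False
    define e where "e = infdist (torus_embed z) C"
    have "e \<noteq> 0" using in_closed_iff_infdist_zero[OF C] CK[OF z] False by (simp add: e_def)
    then have e: "e > 0" using infdist_nonneg[of "torus_embed z" C] by (simp add: e_def)
    obtain m :: nat where m: "1 < real m * e" using ex_less_of_nat_mult[OF e] by blast
    have "eventually (\<lambda>n. h n (torus_embed z) = 0) sequentially"
    proof (rule eventually_sequentiallyI[of m])
      fix n assume "n \<ge> m"
      then have "real m * e \<le> real n * e" using e by (intro mult_right_mono) auto
      then show "h n (torus_embed z) = 0" using m unfolding h_def e_def[symmetric] by simp
    qed
    then show ?thesis using False by (simp add: tendsto_eventually)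
  qed
  have "(\<lambda>n. \<integral>z. f z * of_real (h n (torus_embed z)) \<partial>torus) \<longlonglongrightarrow> (\<integral>z. indicator K z *\<^sub>R f z \<partial>torus)"
  proof (rule integral_dominated_convergence[where w = "\<lambda>z. cmod (f z)"])
    show "integrable torus (\<lambda>z. cmod (f z))" using f(1) by simp
    show "(\<lambda>z. f z * of_real (h n (torus_embed z))) \<in> borel_measurable torus" for n
      using integrable_mult_continuous[OF f(1) hE[of n]] by auto
    have "K \<in> sets borel" using K(1) by (simp add: compact_imp_closed)
    then have "K \<inter> square \<in> sets torus"
      using square_closed unfolding torus_eq by (auto simp: sets_restrict_space)
    moreover have "K \<inter> square = K" using K(2) by (auto simp: open_square_def square_def)
    ultimately show "(\<lambda>z. indicator K z *\<^sub>R f z) \<in> borel_measurable torus"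
      using f(1) by (intro borel_measurable_scaleR borel_measurable_indicator) auto
    show "AE z in torus. (\<lambda>n. f z * of_real (h n (torus_embed z))) \<longlonglongrightarrow> indicator K z *\<^sub>R f z"
    proof (rule AE_I2)
      fix z assume "z \<in> space torus"
      then have "(\<lambda>n. complex_of_real (h n (torus_embed z))) \<longlonglongrightarrow> of_real (indicator K z)"
        using hlim by (intro tendsto_of_real) (simp add: space_torus)
      from tendsto_mult_left[OF this, of "f z"]
      show "(\<lambda>n. f z * of_real (h n (torus_embed z))) \<longlonglongrightarrow> indicator K z *\<^sub>R f z"
        by (simp add: scaleR_conv_of_real mult.commute)
    qed
    have "0 \<le> h n w \<and> h n w \<le> 1" for n w
      using infdist_nonneg[of w C] by (simp add: h_def)
    then show "AE z in torus. norm (f z * of_real (h n (torus_embed z))) \<le> cmod (f z)" for n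
      by (intro AE_I2) (simp add: norm_mult mult_left_le)
  qed
  moreover have "(\<lambda>n. \<integral>z. f z * of_real (h n (torus_embed z)) \<partial>torus) = (\<lambda>_. 0)"
    using integral_zero_continuous[OF f hc] by auto
  ultimately show ?thesis by (simp add: LIMSEQ_const_iff)
qed

text \<open>
  The positive and negative parts of \<open>g\<close> are densities of two measures that agree on the quadrants
  \<open>{..a}\<close>, an intersection-stable generator, hence they agree.
\<close>

lemma AE_zero_from_atMost:
  fixes g :: "real \<times> real \<Rightarrow> real"
  assumes g: "integrable lborel g" and zero: "\<And>a. (\<integral>z. indicator {..a} z *\<^sub>R g z \<partial>lborel) = 0"
  shows "AE z in lborel. g z = 0"
proof -
  have gm [measurable]: "g \<in> borel_measurable lborel" using g by auto
  define P where "P = density lborel (\<lambda>z. ennreal (max 0 (g z)))"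
  define Q where "Q = density lborel (\<lambda>z. ennreal (max 0 (- g z)))"
  have int: "integrable lborel (\<lambda>z. max 0 (g z))" "integrable lborel (\<lambda>z. max 0 (- g z))"
    using g by auto
  have eP: "emeasure P {..a} = ennreal (\<integral>z. indicator {..a} z *\<^sub>R max 0 (g z) \<partial>lborel)" for a
  proof -
    have "emeasure P {..a} = (\<integral>\<^sup>+z. ennreal (indicator {..a} z *\<^sub>R max 0 (g z)) \<partial>lborel)"
      unfolding P_def by (subst emeasure_density) (auto intro!: nn_integral_cong simp: indicator_def)
    also have "\<dots> = ennreal (\<integral>z. indicator {..a} z *\<^sub>R max 0 (g z) \<partial>lborel)"
      using int(1) by (intro nn_integral_eq_integral integrable_mult_indicator) auto
    finally show ?thesis .
  qed
  have eQ: "emeasure Q {..a} = ennreal (\<integral>z. indicator {..a} z *\<^sub>R max 0 (- g z) \<partial>lborel)" for a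
  proof -
    have "emeasure Q {..a} = (\<integral>\<^sup>+z. ennreal (indicator {..a} z *\<^sub>R max 0 (- g z)) \<partial>lborel)"
      unfolding Q_def by (subst emeasure_density) (auto intro!: nn_integral_cong simp: indicator_def)
    also have "\<dots> = ennreal (\<integral>z. indicator {..a} z *\<^sub>R max 0 (- g z) \<partial>lborel)"
      using int(2) by (intro nn_integral_eq_integral integrable_mult_indicator) auto
    finally show ?thesis .
  qed
  have PQ: "P = Q"
  proof (rule measure_eqI_generator_eq[where \<Omega> = UNIV and E = "range (\<lambda>a. {..a})" and A = "\<lambda>n. {..(real n, real n)}"])
    show "Int_stable (range (\<lambda>a :: real \<times> real. {..a}))"
    proof (rule Int_stableI)
      fix a b assume "a \<in> range (\<lambda>a :: real \<times> real. {..a})" "b \<in> range (\<lambda>a :: real \<times> real. {..a})"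
      then obtain x y :: "real \<times> real" where xy: "a = {..x}" "b = {..y}" by blast
      have "a \<inter> b = {..inf x y}" unfolding xy by auto
      then show "a \<inter> b \<in> range (\<lambda>a :: real \<times> real. {..a})" by blast
    qed
    show "emeasure P X = emeasure Q X" if "X \<in> range (\<lambda>a. {..a})" for X
    proof -
      obtain a where X: "X = {..a}" using \<open>X \<in> _\<close> by blast
      have m: "indicator {..a} z *\<^sub>R g z = indicator {..a} z *\<^sub>R max 0 (g z) - indicator {..a} z *\<^sub>R max 0 (- g z)" for z
        by (simp add: indicator_def max_def)
      have "(\<integral>z. indicator {..a} z *\<^sub>R max 0 (g z) \<partial>lborel) - (\<integral>z. indicator {..a} z *\<^sub>R max 0 (- g z) \<partial>lborel) = 0"
      proof -
        have "integrable lborel (\<lambda>z. indicator {..a} z *\<^sub>R max 0 (g z))"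
          "integrable lborel (\<lambda>z. indicator {..a} z *\<^sub>R max 0 (- g z))"
          by (rule integrable_mult_indicator[OF _ int(1)] integrable_mult_indicator[OF _ int(2)]; simp)+
        from Bochner_Integration.integral_diff[OF this] show ?thesis
          using zero[of a] unfolding m by simp
      qed
      then show ?thesis unfolding X eP eQ by simp
    qed
    show "sets P = sigma_sets UNIV (range (\<lambda>a. {..a}))" "sets Q = sigma_sets UNIV (range (\<lambda>a. {..a}))"
      by (simp_all add: P_def Q_def) (simp_all add: borel_eq_atMost)
    show "(\<Union>n. {..(real n, real n)}) = (UNIV :: (real \<times> real) set)"
    proof (rule UNIV_eq_I[symmetric])
      fix z :: "real \<times> real"
      obtain n where n: "max (fst z) (snd z) \<le> real n" using real_arch_simple by blast
      then have "z \<in> {..(real n, real n)}" by (simp add: less_eq_prod_def)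
      then show "z \<in> (\<Union>n. {..(real n, real n)})" by blast
    qed
    show "emeasure P {..(real n, real n)} \<noteq> \<infinity>" for n by (simp add: eP)
  qed auto
  have "AE z in lborel. ennreal (max 0 (g z)) = ennreal (max 0 (- g z))"
  proof (rule finite_density_unique[THEN iffD1])
    show "(\<integral>\<^sup>+z. ennreal (max 0 (g z)) \<partial>lborel) \<noteq> \<infinity>"
      using int(1) by (subst nn_integral_eq_integral) auto
    show "density lborel (\<lambda>z. ennreal (max 0 (g z))) = density lborel (\<lambda>z. ennreal (max 0 (- g z)))"
      using PQ unfolding P_def Q_def .
  qed auto
  then show ?thesis
  proof (rule AE_mp, intro AE_I2 impI)
    fix z assume "ennreal (max 0 (g z)) = ennreal (max 0 (- g z))"
    then have "max 0 (g z) = max 0 (- g z)" by (subst (asm) ennreal_inj) auto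
    then show "g z = 0" by (simp add: max_def split: if_splits)
  qed
qed

lemma square_boundary_null: "AE z in lborel. z \<in> square \<longrightarrow> z \<in> open_square"
proof -
  have osq: "open_square = box (-pi, -pi) (pi, pi)"
    by (auto simp: open_square_def mem_box Basis_prod_def)
  have "emeasure lborel (cbox (-pi, -pi) (pi, pi) - box (-pi, -pi) (pi, pi) :: (real \<times> real) set) = 0"
    by (subst emeasure_Diff) (auto simp: box_subset_cbox emeasure_lborel_cbox_eq emeasure_lborel_box_eq Basis_prod_def)
  then have "square - open_square \<in> null_sets lborel"
    unfolding osq square_cbox by (intro null_setsI) auto
  then show ?thesis by (rule AE_I'[where N = "square - open_square"]) auto
qed

text \<open>
  The integrals of \<open>f\<close> over compact subsets of the open square vanish; quadrants intersected with the
  square are exhausted by such sets, up to the boundary, which is a null set.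
\<close>

theorem fourier_uniqueness:
  assumes f: "integrable torus f" "\<And>k. (\<integral>z. f z * fexp k z \<partial>torus) = 0"
  shows "AE z in torus. f z = 0"
proof -
  define F where "F z = indicator open_square z *\<^sub>R f z" for z
  define F0 where "F0 z = indicator square z *\<^sub>R f z" for z
  have F0: "integrable lborel F0"
    using f(1) integrable_restrict_space[of square lborel f] square_closed
    unfolding torus_eq F0_def[abs_def] by simp
  have osq: "open_square \<in> sets lborel" by (simp add: open_square_def borel_Times)
  have Feq: "F z = indicator open_square z *\<^sub>R F0 z" for z
    by (auto simp: F_def F0_def indicator_def open_square_def square_def)
  have F: "integrable lborel F"
    unfolding Feq[abs_def] by (rule integrable_mult_indicator[OF osq F0])
  have zero: "(\<integral>z. indicator {..a} z *\<^sub>R F z \<partial>lborel) = 0" for a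
  proof -
    define d where "d n = pi - 1 / (real n + 1)" for n
    define K where "K n = cbox (- d n, - d n) (d n, d n) \<inter> {..a}" for n
    have dpi: "d n < pi" for n by (simp add: d_def)
    have K: "compact (K n)" "K n \<subseteq> open_square" for n
    proof -
      show "compact (K n)" unfolding K_def by (intro compact_Int_closed compact_cbox closed_eucl_atMost)
      show "K n \<subseteq> open_square"
        using dpi[of n] by (auto simp: K_def cbox_Pair_eq open_square_def)
    qed
    have int: "(\<integral>z. indicator (K n) z *\<^sub>R F z \<partial>lborel) = 0" for n
    proof (cases "K n = {}")
      case False
      have "indicator (K n) z *\<^sub>R F z = indicator square z *\<^sub>R (indicator (K n) z *\<^sub>R f z)" for z
        using K(2)[of n] by (auto simp: F_def indicator_def open_square_def square_def)
      then show ?thesis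
        using integral_zero_compact[OF f K False] unfolding integral_torus by simp
    qed simp
    have "(\<lambda>n. \<integral>z. indicator (K n) z *\<^sub>R F z \<partial>lborel) \<longlonglongrightarrow> (\<integral>z. indicator {..a} z *\<^sub>R F z \<partial>lborel)"
    proof (rule integral_dominated_convergence[where w = "\<lambda>z. cmod (F z)"])
      show "integrable lborel (\<lambda>z. cmod (F z))" using F by simp
      show "(\<lambda>z. indicator {..a} z *\<^sub>R F z) \<in> borel_measurable lborel"
        using F by (intro borel_measurable_scaleR borel_measurable_indicator) auto
      show "(\<lambda>z. indicator (K n) z *\<^sub>R F z) \<in> borel_measurable lborel" for n
        using F compact_imp_closed[OF K(1)[of n]] by (intro borel_measurable_scaleR borel_measurable_indicator) auto
      show "AE z in lborel. (\<lambda>n. indicator (K n) z *\<^sub>R F z) \<longlonglongrightarrow> indicator {..a} z *\<^sub>R F z"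
      proof (rule AE_I2)
        fix z :: "real \<times> real"
        show "(\<lambda>n. indicator (K n) z *\<^sub>R F z) \<longlonglongrightarrow> indicator {..a} z *\<^sub>R F z"
        proof (cases "z \<in> open_square")
          case True
          define e where "e = pi - max \<bar>fst z\<bar> \<bar>snd z\<bar>"
          have e: "e > 0" using True by (auto simp: e_def open_square_def abs_less_iff)
          obtain m :: nat where m: "1 < real m * e" using ex_less_of_nat_mult[OF e] by blast
          have "eventually (\<lambda>n. indicator (K n) z *\<^sub>R F z = indicator {..a} z *\<^sub>R F z) sequentially"
          proof (rule eventually_sequentiallyI[of m])
            fix n assume "n \<ge> m"
            then have "real m * e \<le> (real n + 1) * e" using e by (intro mult_right_mono) auto
            then have "1 \<le> (real n + 1) * e" using m by linarith
            then have "1 / (real n + 1) \<le> e" by (simp add: field_simps)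
            moreover have "e \<le> pi - \<bar>fst z\<bar>" "e \<le> pi - \<bar>snd z\<bar>" by (auto simp: e_def)
            ultimately have "\<bar>fst z\<bar> \<le> d n" "\<bar>snd z\<bar> \<le> d n" unfolding d_def by linarith+
            then have "z \<in> cbox (- d n, - d n) (d n, d n)"
              by (cases z) (auto simp: cbox_Pair_eq abs_le_iff)
            then show "indicator (K n) z *\<^sub>R F z = indicator {..a} z *\<^sub>R F z"
              by (simp add: K_def indicator_def)
          qed
          then show ?thesis by (rule tendsto_eventually)
        qed (simp add: F_def)
      qed
      show "AE z in lborel. norm (indicator (K n) z *\<^sub>R F z) \<le> cmod (F z)" for n
        by (intro AE_I2) (simp add: indicator_def)
    qed
    then show ?thesis unfolding int by (simp add: LIMSEQ_const_iff)
  qed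
  have zi: "integrable lborel (\<lambda>z. indicator {..a} z *\<^sub>R F z)" for a
    by (rule integrable_mult_indicator[OF _ F]) simp
  have "AE z in lborel. Re (F z) = 0"
  proof (rule AE_zero_from_atMost)
    show "integrable lborel (\<lambda>z. Re (F z))" using F by simp
    show "(\<integral>z. indicator {..a} z *\<^sub>R Re (F z) \<partial>lborel) = 0" for a
      using integral_Re[OF zi[of a]] zero[of a] by simp
  qed
  moreover have "AE z in lborel. Im (F z) = 0"
  proof (rule AE_zero_from_atMost)
    show "integrable lborel (\<lambda>z. Im (F z))" using F by simp
    show "(\<integral>z. indicator {..a} z *\<^sub>R Im (F z) \<partial>lborel) = 0" for a
      using integral_Im[OF zi[of a]] zero[of a] by simp
  qed
  ultimately have "AE z in lborel. z \<in> square \<longrightarrow> f z = 0"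
    using square_boundary_null
  proof eventually_elim
    case (elim z)
    then show ?case by (auto simp: F_def complex_eq_iff)
  qed
  then show ?thesis
    unfolding torus_eq by (subst AE_restrict_space_iff) (use square_closed in auto)
qed

section \<open>The Riesz-Fischer theorem\<close>

lemma real_mult_le_weighted:
  fixes x e :: real
  assumes "e > 0"
  shows "2 * x \<le> e + x\<^sup>2 / e"
proof -
  have "0 \<le> (x - e)\<^sup>2 / e" using assms by simp
  also have "\<dots> = x\<^sup>2 / e - 2 * x + e" using assms by (simp add: field_simps power2_eq_square)
  finally show ?thesis by simp
qed

text \<open>
  The blocks \<open>B (n + 1) - B n\<close> have rapidly decreasing norm. Their partial sums will converge almost everywhere,
  which an arbitrary enumeration of the lattice does not guarantee.
\<close>

lemma ell2_exhaustion:
  fixes a :: "int \<times> int \<Rightarrow> complex"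
  assumes "a \<in> ell2"
  obtains B where "\<And>n. finite (B n)" "\<And>n. B n \<subseteq> B (Suc n)" "B 0 = {}" "(\<Union>n. B n) = UNIV"
    "\<And>n. (\<Sum>k\<in>B (Suc (Suc n)) - B (Suc n). (cmod (a k))\<^sup>2) \<le> (1 / 4) ^ n"
proof -
  define g where "g k = (cmod (a k))\<^sup>2" for k
  have g: "g summable_on UNIV" "\<And>k. g k \<ge> 0" using assms by (auto simp: g_def[abs_def] ell2_def)
  have "\<exists>A. finite A \<and> (\<forall>F. finite F \<and> F \<inter> A = {} \<longrightarrow> sum g F \<le> (1 / 4) ^ n)" for n :: nat
  proof -
    have "(1 / 4 :: real) ^ n > 0" by simp
    then obtain A where A: "finite A" "dist (sum g A) (infsum g UNIV) \<le> (1 / 4) ^ n"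
      using infsum_finite_approximation[OF g(1)] by blast
    have "sum g F \<le> (1 / 4) ^ n" if F: "finite F" "F \<inter> A = {}" for F
    proof -
      have "sum g F + sum g A = sum g (F \<union> A)" using F A(1) by (simp add: sum.union_disjoint)
      also have "\<dots> \<le> infsum g UNIV" using F(1) A(1) g by (intro finite_sum_le_infsum) auto
      finally show ?thesis using A(2) by (simp add: dist_real_def)
    qed
    then show ?thesis using A(1) by blast
  qed
  then obtain A where A: "\<And>n. finite (A n)" "\<And>n F. finite F \<Longrightarrow> F \<inter> A n = {} \<Longrightarrow> sum g F \<le> (1 / 4) ^ n"
    by metis
  define B where "B n = (\<Union>m<n. A m \<union> {k. \<bar>fst k\<bar> \<le> int m \<and> \<bar>snd k\<bar> \<le> int m})" for n
  have fin: "finite (B n)" for n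
  proof -
    have "{k :: int \<times> int. \<bar>fst k\<bar> \<le> int m \<and> \<bar>snd k\<bar> \<le> int m} \<subseteq> {- int m..int m} \<times> {- int m..int m}" for m
      by (auto simp: abs_le_iff)
    then have "finite {k :: int \<times> int. \<bar>fst k\<bar> \<le> int m \<and> \<bar>snd k\<bar> \<le> int m}" for m
      by (rule finite_subset) simp
    then show ?thesis using A(1) by (auto simp: B_def)
  qed
  show ?thesis
  proof (rule that[of B])
    show "finite (B n)" for n by (rule fin)
    show "B n \<subseteq> B (Suc n)" for n unfolding B_def by (rule UN_mono) auto
    show "B 0 = {}" by (simp add: B_def)
    show "(\<Union>n. B n) = UNIV"
    proof (rule UNIV_eq_I[symmetric])
      fix k :: "int \<times> int"
      have "k \<in> B (Suc (nat (max \<bar>fst k\<bar> \<bar>snd k\<bar>)))"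
        unfolding B_def by (rule UN_I[of "nat (max \<bar>fst k\<bar> \<bar>snd k\<bar>)"]) auto
      then show "k \<in> (\<Union>n. B n)" by blast
    qed
    fix n
    have "A n \<subseteq> B (Suc n)" by (auto simp: B_def)
    then show "(\<Sum>k\<in>B (Suc (Suc n)) - B (Suc n). (cmod (a k))\<^sup>2) \<le> (1 / 4) ^ n"
      using A(2)[of "B (Suc (Suc n)) - B (Suc n)" n] fin unfolding g_def by blast
  qed
qed

text \<open>
  The \<open>L\<^sup>1\<close> norms of the blocks \<open>d n\<close> are summable, so their sum \<open>f\<close> converges almost everywhere and can be
  integrated term by term against a bounded function; Fatou's lemma bounds its \<open>L\<^sup>2\<close> norm.
\<close>

theorem riesz_fischer:
  assumes a: "a \<in> ell2"
  shows "\<exists>f. square_integrable f \<and>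
    (\<forall>\<theta>. ((\<lambda>k. a k * pairing k \<theta>) has_sum (\<integral>z. f z * Rep_test_fun \<theta> z \<partial>torus)) UNIV)"
proof -
  obtain B where B: "\<And>n. finite (B n)" "\<And>n. B n \<subseteq> B (Suc n)" "B 0 = {}" "(\<Union>n. B n) = UNIV"
    "\<And>n. (\<Sum>k\<in>B (Suc (Suc n)) - B (Suc n). (cmod (a k))\<^sup>2) \<le> (1 / 4) ^ n"
    using ell2_exhaustion[OF a] by blast
  define D where "D n = B (Suc n) - B n" for n
  define d where "d n z = (\<Sum>k\<in>D n. a k * fexp k z)" for n z
  have Dfin: "finite (D n)" for n using B(1) by (simp add: D_def)
  have dc: "continuous_on S (d n)" for n S unfolding d_def by (intro continuous_intros continuous_fexp)
  have dm [measurable]: "d n \<in> borel_measurable torus" for n by (rule continuous_measurable_torus[OF dc])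
  have di: "integrable torus (d n)" for n by (rule continuous_integrable_torus[OF dc])
  have d2i: "integrable torus (\<lambda>z. (cmod (d n z))\<^sup>2)" for n
    using continuous_square_integrable[OF dc] by (simp add: square_integrable_def)
  have sumB: "(\<Sum>i<n. \<Sum>k\<in>D i. h k) = (\<Sum>k\<in>B n. h k)" for n and h :: "int \<times> int \<Rightarrow> complex"
  proof (induction n)
    case (Suc n)
    have "(\<Sum>k\<in>B (Suc n). h k) = (\<Sum>k\<in>D n. h k) + (\<Sum>k\<in>B n. h k)"
      unfolding D_def using sum.subset_diff[OF B(2)[of n] B(1)[of "Suc n"]] .
    then show ?case using Suc by simp
  qed (simp add: B(3))
  define C where "C = 4 * pi\<^sup>2"
  have C: "C > 0" by (simp add: C_def)
  have L1: "(\<integral>z. cmod (d (Suc n) z) \<partial>torus) \<le> C * (1 / 2) ^ n" for n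
  proof -
    \<comment> \<open>The weighted inequality \<open>2 x \<le> e + x^2/e\<close> stands in for Cauchy-Schwarz against the constant \<open>1\<close>;
      \<open>e\<close> is chosen as the bound for the \<open>L\<^sup>2\<close> norm of the block.\<close>
    define e :: real where "e = (1 / 2) ^ n"
    have e: "e > 0" by (simp add: e_def)
    have "(\<integral>z. cmod (d (Suc n) z) \<partial>torus) \<le> (\<integral>z. e / 2 + (cmod (d (Suc n) z))\<^sup>2 / (2 * e) \<partial>torus)"
    proof (rule integral_mono)
      show "integrable torus (\<lambda>z. cmod (d (Suc n) z))" using di by simp
      show "integrable torus (\<lambda>z. e / 2 + (cmod (d (Suc n) z))\<^sup>2 / (2 * e))" using d2i by simp
      show "cmod (d (Suc n) z) \<le> e / 2 + (cmod (d (Suc n) z))\<^sup>2 / (2 * e)" for z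
        using real_mult_le_weighted[OF e, of "cmod (d (Suc n) z)"] by (simp add: field_simps)
    qed
    also have "\<dots> = e / 2 * C + (\<integral>z. (cmod (d (Suc n) z))\<^sup>2 \<partial>torus) / (2 * e)"
      using d2i by (simp add: measure_torus_space C_def)
    also have "(\<integral>z. (cmod (d (Suc n) z))\<^sup>2 \<partial>torus) = C * (\<Sum>k\<in>D (Suc n). (cmod (a k))\<^sup>2)"
      unfolding d_def C_def by (rule trig_norm[OF Dfin])
    also have "e / 2 * C + C * (\<Sum>k\<in>D (Suc n). (cmod (a k))\<^sup>2) / (2 * e) \<le> e / 2 * C + C * (e * e) / (2 * e)"
    proof -
      have "(\<Sum>k\<in>D (Suc n). (cmod (a k))\<^sup>2) \<le> e * e"
        using B(5)[of n] unfolding D_def e_def power_mult_distrib[symmetric] by simp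
      then show ?thesis using e C by (intro add_left_mono divide_right_mono mult_left_mono) auto
    qed
    also have "\<dots> = C * e" using e by (simp add: field_simps)
    finally show ?thesis by (simp add: e_def)
  qed
  have sumL1: "summable (\<lambda>n. \<integral>z. cmod (d n z) \<partial>torus)"
  proof -
    have "summable (\<lambda>n. C * (1 / 2 :: real) ^ n)" by (intro summable_mult summable_geometric) simp
    then have "summable (\<lambda>n. \<integral>z. cmod (d (Suc n) z) \<partial>torus)"
      by (rule summable_comparison_test[rotated]) (use L1 in \<open>auto intro!: exI[of _ 0]\<close>)
    then show ?thesis
      by (rule summable_Suc_iff[of "\<lambda>n. \<integral>z. cmod (d n z) \<partial>torus", THEN iffD1])
  qed
  have AEs: "AE z in torus. summable (\<lambda>n. cmod (d n z))"
  proof -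
    have "(\<integral>\<^sup>+z. (\<Sum>n. ennreal (cmod (d n z))) \<partial>torus) = (\<Sum>n. \<integral>\<^sup>+z. ennreal (cmod (d n z)) \<partial>torus)"
      by (rule nn_integral_suminf) measurable
    also have "\<dots> = (\<Sum>n. ennreal (\<integral>z. cmod (d n z) \<partial>torus))"
      using di by (intro suminf_cong nn_integral_eq_integral) auto
    also have "\<dots> \<noteq> \<infinity>" using sumL1 by (subst suminf_ennreal2) auto
    finally have "AE z in torus. (\<Sum>n. ennreal (cmod (d n z))) \<noteq> \<infinity>"
      by (intro nn_integral_PInf_AE) measurable
    then show ?thesis
      by (rule AE_mp) (auto intro!: AE_I2 summable_suminf_not_top)
  qed
  define f where "f z = (\<Sum>n. d n z)" for z
  have fm [measurable]: "f \<in> borel_measurable torus" unfolding f_def[abs_def] by measurable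
  define Sn where "Sn n z = (\<Sum>i<n. d i z)" for n z
  have SnB: "Sn n z = (\<Sum>k\<in>B n. a k * fexp k z)" for n z unfolding Sn_def d_def by (rule sumB)
  have Slim: "AE z in torus. (\<lambda>n. Sn n z) \<longlonglongrightarrow> f z"
    using AEs
  proof (rule AE_mp, intro AE_I2 impI)
    fix z assume "summable (\<lambda>n. cmod (d n z))"
    then have "summable (\<lambda>n. d n z)" by (rule summable_norm_cancel)
    then show "(\<lambda>n. Sn n z) \<longlonglongrightarrow> f z" unfolding Sn_def f_def by (rule summable_LIMSEQ)
  qed
  have S2: "(\<integral>\<^sup>+z. ennreal ((cmod (Sn n z))\<^sup>2) \<partial>torus) \<le> ennreal (C * infsum (\<lambda>k. (cmod (a k))\<^sup>2) UNIV)" for n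
  proof -
    have Sc: "continuous_on UNIV (Sn n)" unfolding SnB[abs_def] by (intro continuous_intros continuous_fexp)
    have "(\<integral>\<^sup>+z. ennreal ((cmod (Sn n z))\<^sup>2) \<partial>torus) = ennreal (\<integral>z. (cmod (Sn n z))\<^sup>2 \<partial>torus)"
      using continuous_square_integrable[OF Sc] by (intro nn_integral_eq_integral) (auto simp: square_integrable_def)
    also have "(\<integral>z. (cmod (Sn n z))\<^sup>2 \<partial>torus) = C * (\<Sum>k\<in>B n. (cmod (a k))\<^sup>2)"
      unfolding SnB C_def by (rule trig_norm[OF B(1)])
    also have "(\<Sum>k\<in>B n. (cmod (a k))\<^sup>2) \<le> infsum (\<lambda>k. (cmod (a k))\<^sup>2) UNIV"
      using a B(1) by (intro finite_sum_le_infsum) (auto simp: ell2_def)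
    finally show ?thesis using C by (simp add: ennreal_leI mult_left_mono)
  qed
  have "square_integrable f"
  proof -
    have Sm [measurable]: "Sn n \<in> borel_measurable torus" for n unfolding Sn_def[abs_def] by measurable
    have "(\<integral>\<^sup>+z. ennreal ((cmod (f z))\<^sup>2) \<partial>torus) = (\<integral>\<^sup>+z. liminf (\<lambda>n. ennreal ((cmod (Sn n z))\<^sup>2)) \<partial>torus)"
    proof (rule nn_integral_cong_AE, use Slim in \<open>rule AE_mp\<close>, intro AE_I2 impI)
      fix z assume "(\<lambda>n. Sn n z) \<longlonglongrightarrow> f z"
      then have "(\<lambda>n. ennreal ((cmod (Sn n z))\<^sup>2)) \<longlonglongrightarrow> ennreal ((cmod (f z))\<^sup>2)"
        by (intro tendsto_ennrealI tendsto_intros)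
      then show "ennreal ((cmod (f z))\<^sup>2) = liminf (\<lambda>n. ennreal ((cmod (Sn n z))\<^sup>2))"
        by (intro lim_imp_Liminf[symmetric]) auto
    qed
    also have "\<dots> \<le> liminf (\<lambda>n. \<integral>\<^sup>+z. ennreal ((cmod (Sn n z))\<^sup>2) \<partial>torus)"
      by (rule nn_integral_liminf) measurable
    also have "\<dots> \<le> ennreal (C * infsum (\<lambda>k. (cmod (a k))\<^sup>2) UNIV)"
      by (rule Liminf_le) (use S2 in auto)
    finally have "(\<integral>\<^sup>+z. ennreal ((cmod (f z))\<^sup>2) \<partial>torus) < \<infinity>" using le_less_trans by fastforce
    then show ?thesis
      unfolding square_integrable_def by (intro conjI fm integrableI_nonneg) auto
  qed
  moreover have "((\<lambda>k. a k * pairing k \<theta>) has_sum (\<integral>z. f z * Rep_test_fun \<theta> z \<partial>torus)) UNIV" for \<theta>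
  proof -
    obtain K where K: "K \<ge> 0" "\<And>z. z \<in> square \<Longrightarrow> cmod (Rep_test_fun \<theta> z) \<le> K"
      using continuous_bounded_square[OF test_continuous] by blast
    have sm: "(\<lambda>k. a k * pairing k \<theta>) summable_on UNIV"
      by (rule ell2_product_summable[OF a pairing_ell2])
    have dth: "integrable torus (\<lambda>z. d n z * Rep_test_fun \<theta> z)" for n
      by (rule integrable_mult_continuous[OF di test_continuous])
    have "(\<lambda>n. \<integral>z. d n z * Rep_test_fun \<theta> z \<partial>torus) sums (\<integral>z. (\<Sum>n. d n z * Rep_test_fun \<theta> z) \<partial>torus)"
    proof (rule sums_integral[OF dth])
      show "AE z in torus. summable (\<lambda>n. norm (d n z * Rep_test_fun \<theta> z))"
        using AEs by (rule AE_mp) (auto intro!: AE_I2 summable_mult2 simp: norm_mult)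
      have "summable (\<lambda>n. K * (\<integral>z. cmod (d n z) \<partial>torus))" by (rule summable_mult[OF sumL1])
      then show "summable (\<lambda>n. \<integral>z. norm (d n z * Rep_test_fun \<theta> z) \<partial>torus)"
      proof (rule summable_comparison_test[rotated], intro exI allI impI)
        fix n
        have "(\<integral>z. norm (d n z * Rep_test_fun \<theta> z) \<partial>torus) \<le> (\<integral>z. K * cmod (d n z) \<partial>torus)"
        proof (rule integral_mono)
          show "integrable torus (\<lambda>z. norm (d n z * Rep_test_fun \<theta> z))" using dth by (rule integrable_norm)
          show "integrable torus (\<lambda>z. K * cmod (d n z))" using di by simp
          show "norm (d n z * Rep_test_fun \<theta> z) \<le> K * cmod (d n z)" if "z \<in> space torus" for z
            using mult_left_mono[OF K(2)[of z], of "cmod (d n z)"] that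
            by (simp add: space_torus norm_mult mult.commute)
        qed
        then show "norm (\<integral>z. norm (d n z * Rep_test_fun \<theta> z) \<partial>torus) \<le> K * (\<integral>z. cmod (d n z) \<partial>torus)" by simp
      qed
    qed
    moreover have "(\<integral>z. (\<Sum>n. d n z * Rep_test_fun \<theta> z) \<partial>torus) = (\<integral>z. f z * Rep_test_fun \<theta> z \<partial>torus)"
    proof (rule integral_cong_AE)
      have tm [measurable]: "Rep_test_fun \<theta> \<in> borel_measurable torus"
        by (rule continuous_measurable_torus[OF test_continuous])
      show "(\<lambda>z. \<Sum>n. d n z * Rep_test_fun \<theta> z) \<in> borel_measurable torus" by measurable
      show "(\<lambda>z. f z * Rep_test_fun \<theta> z) \<in> borel_measurable torus" by measurable
      show "AE z in torus. (\<Sum>n. d n z * Rep_test_fun \<theta> z) = f z * Rep_test_fun \<theta> z"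
        using AEs
      proof (rule AE_mp, intro AE_I2 impI)
        fix z assume "summable (\<lambda>n. cmod (d n z))"
        then have "summable (\<lambda>n. d n z)" by (rule summable_norm_cancel)
        then show "(\<Sum>n. d n z * Rep_test_fun \<theta> z) = f z * Rep_test_fun \<theta> z"
          unfolding f_def by (rule suminf_mult2[symmetric])
      qed
    qed
    moreover have "(\<integral>z. d n z * Rep_test_fun \<theta> z \<partial>torus) = (\<Sum>k\<in>D n. a k * pairing k \<theta>)" for n
    proof -
      have "(\<integral>z. d n z * Rep_test_fun \<theta> z \<partial>torus) = (\<integral>z. (\<Sum>k\<in>D n. a k * (fexp k z * Rep_test_fun \<theta> z)) \<partial>torus)"
        by (simp add: d_def sum_distrib_right mult.assoc)
      also have "\<dots> = (\<Sum>k\<in>D n. a k * pairing k \<theta>)"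
        using pairing_integrable by (simp add: Bochner_Integration.integral_sum pairing_def)
      finally show ?thesis .
    qed
    ultimately have "(\<lambda>n. \<Sum>i<n. \<Sum>k\<in>D i. a k * pairing k \<theta>) \<longlonglongrightarrow> (\<integral>z. f z * Rep_test_fun \<theta> z \<partial>torus)"
      by (simp add: sums_def)
    then have lim: "(\<lambda>n. \<Sum>k\<in>B n. a k * pairing k \<theta>) \<longlonglongrightarrow> (\<integral>z. f z * Rep_test_fun \<theta> z \<partial>torus)"
      unfolding sumB .
    have "filterlim B (finite_subsets_at_top UNIV) sequentially"
      unfolding filterlim_finite_subsets_at_top
    proof (intro allI impI)
      fix X :: "(int \<times> int) set" assume X: "finite X \<and> X \<subseteq> UNIV"
      have mono: "B m \<subseteq> B n" if "m \<le> n" for m n using lift_Suc_mono_le[of B m n] B(2) that by blast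
      have "\<exists>n. X \<subseteq> B n"
        using X[THEN conjunct1]
      proof (induction X rule: finite_induct)
        case (insert x X)
        then obtain n where n: "X \<subseteq> B n" by blast
        obtain m where m: "x \<in> B m" using B(4) by blast
        have "insert x X \<subseteq> B (max m n)" using m n mono[of m "max m n"] mono[of n "max m n"] by auto
        then show ?case by blast
      qed simp
      then obtain n where n: "X \<subseteq> B n" by blast
      show "\<forall>\<^sub>F y in sequentially. finite (B y) \<and> X \<subseteq> B y \<and> B y \<subseteq> UNIV"
        by (rule eventually_sequentiallyI[of n]) (use n mono B(1) in blast)
    qed
    moreover have "(sum (\<lambda>k. a k * pairing k \<theta>) \<longlongrightarrow> infsum (\<lambda>k. a k * pairing k \<theta>) UNIV) (finite_subsets_at_top UNIV)"
      using has_sum_infsum[OF sm] unfolding has_sum_def .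
    ultimately have "(\<lambda>n. \<Sum>k\<in>B n. a k * pairing k \<theta>) \<longlonglongrightarrow> infsum (\<lambda>k. a k * pairing k \<theta>) UNIV"
      by (rule filterlim_compose[rotated])
    from LIMSEQ_unique[OF this lim] show ?thesis using has_sum_infsum[OF sm] by simp
  qed
  ultimately show ?thesis by blast
qed

section \<open>The Euler operator in Fourier coefficients\<close>

text \<open>
  \<open>riesz_fischer\<close> constructs a function with the same coefficients as \<open>f\<close>, and uniqueness identifies the two.
\<close>

lemma parseval:
  assumes f: "square_integrable f"
  shows "((\<lambda>k. fcoeff f k * pairing k \<theta>) has_sum (\<integral>z. f z * Rep_test_fun \<theta> z \<partial>torus)) UNIV"
proof -
  define a where "a = fcoeff f"
  obtain g where g: "square_integrable g"
    "\<And>\<theta>. ((\<lambda>k. a k * pairing k \<theta>) has_sum (\<integral>z. g z * Rep_test_fun \<theta> z \<partial>torus)) UNIV"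
    using riesz_fischer[OF fcoeff_ell2[OF f]] unfolding a_def by blast
  have fi: "integrable torus f" and gi: "integrable torus g"
    using f g(1) by (auto intro: square_integrable_integrable)
  have gc: "(\<integral>z. g z * fexp (- k) z \<partial>torus) = (\<integral>z. f z * fexp (- k) z \<partial>torus)" for k
  proof -
    have "((\<lambda>j. a j * pairing j (em (- k))) has_sum a k * (4 * pi\<^sup>2)) UNIV"
    proof (rule has_sum_finite_neutralI[of "{k}"])
      show "a k * (4 * pi\<^sup>2) = (\<Sum>j\<in>{k}. a j * pairing j (em (- k)))" by (simp add: pairing_em)
    qed (auto simp: pairing_em)
    from has_sum_unique[OF g(2)[of "em (- k)"] this]
    show ?thesis by (simp add: em.rep_eq a_def fcoeff_def)
  qed
  have "AE z in torus. f z - g z = 0"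
  proof (rule fourier_uniqueness)
    show "integrable torus (\<lambda>z. f z - g z)" using fi gi by simp
    fix k
    have "(\<integral>z. (f z - g z) * fexp k z \<partial>torus) = (\<integral>z. f z * fexp k z \<partial>torus) - (\<integral>z. g z * fexp k z \<partial>torus)"
      unfolding left_diff_distrib
      by (intro Bochner_Integration.integral_diff integrable_mult_continuous fi gi continuous_fexp)
    then show "(\<integral>z. (f z - g z) * fexp k z \<partial>torus) = 0" using gc[of "- k"] by simp
  qed
  then have "(\<integral>z. f z * Rep_test_fun \<theta> z \<partial>torus) = (\<integral>z. g z * Rep_test_fun \<theta> z \<partial>torus)"
    using integrable_mult_continuous[OF fi test_continuous, of \<theta>] integrable_mult_continuous[OF gi test_continuous, of \<theta>]
    by (intro integral_cong_AE) auto
  then show ?thesis using g(2)[of \<theta>] by (simp add: a_def)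
qed

lemma L2_cases:
  obtains f where "square_integrable f" "w = abs_L2_torus f"
proof -
  have "L2_rel (rep_L2_torus w) (rep_L2_torus w)" "abs_L2_torus (rep_L2_torus w) = w"
    using Quotient_rep_reflp[OF Quotient_L2_torus] Quotient_abs_rep[OF Quotient_L2_torus] by auto
  then show ?thesis using that[of "rep_L2_torus w"] by (simp add: L2_rel_def)
qed

lemma L2_rel_refl: "square_integrable f \<Longrightarrow> L2_rel f f"
  by (simp add: L2_rel_def)

lemma dist_of_abs: "square_integrable f \<Longrightarrow> dist_of (abs_L2_torus f) \<theta> = (\<integral>z. f z * Rep_test_fun \<theta> z \<partial>torus)"
  using dist_of.abs_eq[OF L2_rel_refl] by simp

text \<open>
  Defined through \<open>dist_of\<close>, the coefficients do not refer to a representative of the class.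
\<close>

definition coef :: "L2_torus \<Rightarrow> int \<times> int \<Rightarrow> complex" where
  "coef w k = dist_of w (em (- k)) / (4 * pi\<^sup>2)"

lemma coef_abs: "square_integrable f \<Longrightarrow> coef (abs_L2_torus f) = fcoeff f"
  by (simp add: fun_eq_iff coef_def fcoeff_def dist_of_abs em.rep_eq)

lemma coef_ell2: "coef w \<in> ell2"
  by (rule L2_cases[of w]) (simp add: coef_abs fcoeff_ell2)

lemma dist_of_has_sum: "((\<lambda>k. coef w k * pairing k \<theta>) has_sum dist_of w \<theta>) UNIV"
  by (rule L2_cases[of w]) (simp add: coef_abs dist_of_abs parseval)

lemma coef_unique:
  assumes "\<And>\<theta>. ((\<lambda>k. b k * pairing k \<theta>) has_sum dist_of w \<theta>) UNIV"
  shows "b = coef w"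
proof (rule ext)
  fix k
  have "((\<lambda>j. b j * pairing j (em (- k))) has_sum b k * (4 * pi\<^sup>2)) UNIV"
  proof (rule has_sum_finite_neutralI[of "{k}"])
    show "b k * (4 * pi\<^sup>2) = (\<Sum>j\<in>{k}. b j * pairing j (em (- k)))" by (simp add: pairing_em)
  qed (auto simp: pairing_em)
  from has_sum_unique[OF assms[of "em (- k)"] this]
  show "b k = coef w k" by (simp add: coef_def)
qed

lemma dist_of_eqI:
  assumes "\<And>\<theta>. ((\<lambda>k. coef w k * pairing k \<theta>) has_sum T \<theta>) UNIV"
  shows "dist_of w = T"
  using has_sum_unique[OF dist_of_has_sum assms] by auto

lemma coef_inject:
  assumes "coef v = coef w"
  shows "v = w"
proof -
  obtain f where f: "square_integrable f" "v = abs_L2_torus f" by (rule L2_cases)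
  obtain g where g: "square_integrable g" "w = abs_L2_torus g" by (rule L2_cases)
  have fi: "integrable torus f" and gi: "integrable torus g"
    using f(1) g(1) by (auto intro: square_integrable_integrable)
  have eq: "(\<integral>z. f z * fexp k z \<partial>torus) = (\<integral>z. g z * fexp k z \<partial>torus)" for k
    using fun_cong[OF assms, of "- k"] f g by (simp add: coef_abs fcoeff_def)
  have "AE z in torus. f z - g z = 0"
  proof (rule fourier_uniqueness)
    show "integrable torus (\<lambda>z. f z - g z)" using fi gi by simp
    fix k
    have "(\<integral>z. (f z - g z) * fexp k z \<partial>torus) = (\<integral>z. f z * fexp k z \<partial>torus) - (\<integral>z. g z * fexp k z \<partial>torus)"
      unfolding left_diff_distrib
      by (intro Bochner_Integration.integral_diff integrable_mult_continuous fi gi continuous_fexp)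
    then show "(\<integral>z. (f z - g z) * fexp k z \<partial>torus) = 0" using eq by simp
  qed
  then have "L2_rel f g" using f(1) g(1) by (simp add: L2_rel_def)
  then show ?thesis using f(2) g(2) Quotient_rel_abs[OF Quotient_L2_torus] by blast
qed

lemma coef_surj:
  assumes "a \<in> ell2"
  obtains w where "coef w = a"
proof -
  obtain f where f: "square_integrable f"
    "\<And>\<theta>. ((\<lambda>k. a k * pairing k \<theta>) has_sum (\<integral>z. f z * Rep_test_fun \<theta> z \<partial>torus)) UNIV"
    using riesz_fischer[OF assms] by blast
  have "a = coef (abs_L2_torus f)"
    by (rule coef_unique) (use f in \<open>simp add: dist_of_abs\<close>)
  then show ?thesis using that by simp
qed

lemma coef_add: "coef (v + w) = coef v + coef w"
proof -
  obtain f where f: "square_integrable f" "v = abs_L2_torus f" by (rule L2_cases)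
  obtain g where g: "square_integrable g" "w = abs_L2_torus g" by (rule L2_cases)
  have fi: "integrable torus f" and gi: "integrable torus g"
    using f(1) g(1) by (auto intro: square_integrable_integrable)
  have "v + w = abs_L2_torus (\<lambda>z. f z + g z)"
    unfolding f(2) g(2) by (rule plus_L2_torus.abs_eq) (use f g L2_rel_refl in auto)
  moreover have "fcoeff (\<lambda>z. f z + g z) k = fcoeff f k + fcoeff g k" for k
    unfolding fcoeff_def distrib_right add_divide_distrib[symmetric]
    by (subst Bochner_Integration.integral_add) (auto intro!: integrable_mult_continuous fi gi continuous_fexp)
  ultimately show ?thesis
    using f g by (simp add: fun_eq_iff coef_abs square_integrable_add)
qed

lemma coef_scale: "coef (L2_scale c w) = seq_scale c (coef w)"
proof -
  obtain f where f: "square_integrable f" "w = abs_L2_torus f" by (rule L2_cases)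
  have "L2_scale c w = abs_L2_torus (\<lambda>z. c * f z)"
    unfolding f(2) by (rule L2_scale.abs_eq) (use f L2_rel_refl in auto)
  then show ?thesis
    using f by (simp add: fun_eq_iff coef_abs square_integrable_cmult fcoeff_def mult.assoc)
qed

lemma coef_linear: "Vector_Spaces.linear L2_scale seq_scale coef"
  unfolding linear_iff_module_hom module_hom_def module_hom_axioms_def
  using L2.module_axioms seq.module_axioms coef_add coef_scale by auto

lemma coef_zero: "coef 0 = 0"
  using coef_scale[of 0 0] by (simp add: fun_eq_iff)

lemma coef_diff: "coef (v - w) = coef v - coef w"
  using coef_add[of "v - w" w] by simp

lemma mean_zero_iff: "mean_zero w \<longleftrightarrow> coef w 0 = 0"
proof -
  obtain f where f: "square_integrable f" "w = abs_L2_torus f" by (rule L2_cases)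
  have "L2_integral w = (\<integral>z. f z \<partial>torus)"
    unfolding f(2) by (rule L2_integral.abs_eq) (use f L2_rel_refl in auto)
  then show ?thesis
    unfolding mean_zero_def using f by (simp add: coef_abs fcoeff_def fexp_simps)
qed

lemma laplacian_has_sum:
  "((\<lambda>k. (- of_int (norm_sq k) * coef v k) * pairing k \<theta>) has_sum dist_laplacian (dist_of v) \<theta>) UNIV"
proof -
  have "((\<lambda>k. coef v k * pairing k (test_dx (test_dx \<theta>)) + coef v k * pairing k (test_dy (test_dy \<theta>)))
      has_sum dist_of v (test_dx (test_dx \<theta>)) + dist_of v (test_dy (test_dy \<theta>))) UNIV"
    by (intro has_sum_add dist_of_has_sum)
  moreover have "coef v k * pairing k (test_dx (test_dx \<theta>)) + coef v k * pairing k (test_dy (test_dy \<theta>))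
      = (- of_int (norm_sq k) * coef v k) * pairing k \<theta>" for k
    by (simp add: pairing_dx pairing_dy norm_sq_def power2_eq_square algebra_simps)
  ultimately show ?thesis by (simp add: dist_laplacian_def dist_dx_def dist_dy_def)
qed

lemma stream_function_iff:
  "stream_function v w \<longleftrightarrow> (\<forall>k. - of_int (norm_sq k) * coef v k = coef w k)"
proof
  assume "stream_function v w"
  then have "dist_laplacian (dist_of v) = dist_of w" by (simp add: stream_function_def)
  then have "(\<lambda>k. - of_int (norm_sq k) * coef v k) = coef w"
    using laplacian_has_sum[of v] by (intro coef_unique) simp
  then show "\<forall>k. - of_int (norm_sq k) * coef v k = coef w k" by (simp add: fun_eq_iff)
next
  assume "\<forall>k. - of_int (norm_sq k) * coef v k = coef w k"
  then have "((\<lambda>k. coef w k * pairing k \<theta>) has_sum dist_laplacian (dist_of v) \<theta>) UNIV" for \<theta>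
    using laplacian_has_sum[of v \<theta>] by simp
  then show "stream_function v w" unfolding stream_function_def by (rule dist_of_eqI[symmetric])
qed

text \<open>
  The steady state and all its derivatives are combinations of \<open>fexp p\<close> and \<open>fexp (- p)\<close>; multiplication by
  them shifts the Fourier index by \<open>p\<close>.
\<close>

definition two_mode :: "int \<times> int \<Rightarrow> test_fun \<Rightarrow> complex \<Rightarrow> complex \<Rightarrow> bool" where
  "two_mode p f a b \<longleftrightarrow> (\<forall>z. Rep_test_fun f z = a * fexp p z + b * fexp (- p) z)"

lemma two_mode_dx: "two_mode p f a b \<Longrightarrow> two_mode p (test_dx f) (\<i> * of_int (fst p) * a) (- \<i> * of_int (fst p) * b)"
  and two_mode_dy: "two_mode p f a b \<Longrightarrow> two_mode p (test_dy f) (\<i> * of_int (snd p) * a) (- \<i> * of_int (snd p) * b)"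
proof -
  assume f: "two_mode p f a b"
  have dx: "((\<lambda>s. fexp k (s, y)) has_vector_derivative \<i> * of_int (fst k) * fexp k (x, y)) (at x)" for k x y
    using test_dx_deriv[of "em k" y x] by (simp add: em.rep_eq Rep_test_dx_em)
  have dy: "((\<lambda>s. fexp k (x, s)) has_vector_derivative \<i> * of_int (snd k) * fexp k (x, y)) (at y)" for k x y
    using test_dy_deriv[of "em k" x y] by (simp add: em.rep_eq Rep_test_dy_em)
  have rep: "Rep_test_fun f = (\<lambda>z. a * fexp p z + b * fexp (- p) z)" using f by (auto simp: two_mode_def)
  have "Rep_test_fun (test_dx f) (x, y) = a * (\<i> * of_int (fst p) * fexp p (x, y)) + b * (\<i> * of_int (fst (- p)) * fexp (- p) (x, y))" for x y
    using test_dx_deriv[of f y x] unfolding rep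
    by (rule vector_derivative_unique_at) (intro has_vector_derivative_add has_vector_derivative_mult_right dx)
  then show "two_mode p (test_dx f) (\<i> * of_int (fst p) * a) (- \<i> * of_int (fst p) * b)"
    by (auto simp: two_mode_def algebra_simps)
  have "Rep_test_fun (test_dy f) (x, y) = a * (\<i> * of_int (snd p) * fexp p (x, y)) + b * (\<i> * of_int (snd (- p)) * fexp (- p) (x, y))" for x y
    using test_dy_deriv[of f x y] unfolding rep
    by (rule vector_derivative_unique_at) (intro has_vector_derivative_add has_vector_derivative_mult_right dy)
  then show "two_mode p (test_dy f) (\<i> * of_int (snd p) * a) (- \<i> * of_int (snd p) * b)"
    by (auto simp: two_mode_def algebra_simps)
qed

lemma two_mode_add: "two_mode p f a b \<Longrightarrow> two_mode p g c d \<Longrightarrow> two_mode p (f + g) (a + c) (b + d)"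
  by (simp add: two_mode_def Rep_test_add algebra_simps)

lemma two_mode_steady: "two_mode (p1, p2) (steady p1 p2) (1 / 2) (1 / 2)"
  unfolding two_mode_def fexp_simps(3)[symmetric]
  by (auto simp: steady.rep_eq fexp_def complex_eq_iff)

lemma pairing_two_mode:
  assumes "two_mode p f a b"
  shows "pairing k (f * \<theta>) = a * pairing (k + p) \<theta> + b * pairing (k - p) \<theta>"
proof -
  have "fexp k z * Rep_test_fun (f * \<theta>) z = a * (fexp (k + p) z * Rep_test_fun \<theta> z) + b * (fexp (k - p) z * Rep_test_fun \<theta> z)" for z
    using assms fexp_simps(2)[of k p z] fexp_simps(2)[of k "- p" z]
    by (simp add: two_mode_def Rep_test_mult algebra_simps)
  then show ?thesis
    unfolding pairing_def using pairing_integrable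
    by (simp add: Bochner_Integration.integral_add)
qed

lemma pairing_mult_steady:
  fixes p1 p2 :: int and \<theta> :: test_fun
  defines "p \<equiv> (p1, p2)"
  defines "t \<equiv> \<lambda>k. pairing (k + p) \<theta> - pairing (k - p) \<theta>"
  shows "pairing k (test_dx (steady p1 p2) * \<theta>) = \<i> * of_int p1 / 2 * t k"
    and "pairing k (test_dy (steady p1 p2) * \<theta>) = \<i> * of_int p2 / 2 * t k"
    and "pairing k (test_dx (test_laplacian (steady p1 p2)) * \<theta>) = - of_int (norm_sq p) * (\<i> * of_int p1 / 2) * t k"
    and "pairing k (test_dy (test_laplacian (steady p1 p2)) * \<theta>) = - of_int (norm_sq p) * (\<i> * of_int p2 / 2) * t k"
proof -
  note m = two_mode_steady[of p1 p2, folded p_def]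
  note lap = two_mode_add[OF two_mode_dx[OF two_mode_dx[OF m]] two_mode_dy[OF two_mode_dy[OF m]], folded test_laplacian_def]
  have p: "fst p = p1" "snd p = p2" by (simp_all add: p_def)
  show "pairing k (test_dx (steady p1 p2) * \<theta>) = \<i> * of_int p1 / 2 * t k"
    "pairing k (test_dy (steady p1 p2) * \<theta>) = \<i> * of_int p2 / 2 * t k"
    unfolding pairing_two_mode[OF two_mode_dx[OF m]] pairing_two_mode[OF two_mode_dy[OF m]]
    by (simp_all add: t_def p algebra_simps)
  show "pairing k (test_dx (test_laplacian (steady p1 p2)) * \<theta>) = - of_int (norm_sq p) * (\<i> * of_int p1 / 2) * t k"
    "pairing k (test_dy (test_laplacian (steady p1 p2)) * \<theta>) = - of_int (norm_sq p) * (\<i> * of_int p2 / 2) * t k"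
    unfolding pairing_two_mode[OF two_mode_dx[OF lap]] pairing_two_mode[OF two_mode_dy[OF lap]]
    by (simp_all add: t_def p norm_sq_def power2_eq_square algebra_simps add_divide_distrib diff_divide_distrib)
qed

text \<open>
  Moving the derivatives to the test function, each term of the right-hand side acts on the \<open>k\<close>-th mode by
  shifts to \<open>k + p\<close> and \<open>k - p\<close>. Eliminating the stream function by \<open>coef v k = - coef w k / |k|^2\<close> combines
  \<open>coef w k + |p|^2 * coef v k\<close> into \<open>rho p k * coef w k\<close>, and reindexing collects the coefficient of
  \<open>pairing k\<close>.
\<close>

theorem euler_rhs_has_sum:
  assumes sf: "stream_function v w"
  shows "((\<lambda>k. lat_op (p1, p2) (coef w) k * pairing k \<theta>) has_sum euler_rhs p1 p2 v w \<theta>) UNIV"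
proof -
  define p where "p = (p1, p2)"
  let ?\<psi> = "steady p1 p2"
  define g where "g k = of_real (rho p k) * coef w k" for k
  define c :: "int \<times> int \<Rightarrow> complex" where "c k = of_int (cross p k) / 2" for k
  define t where "t k = pairing k \<theta>" for k
  have rhs: "euler_rhs p1 p2 v w \<theta> = - dist_of w (test_dy (test_dx ?\<psi> * \<theta>)) + - dist_of v (test_dx (test_dy (test_laplacian ?\<psi>) * \<theta>))
      + dist_of w (test_dx (test_dy ?\<psi> * \<theta>)) + dist_of v (test_dy (test_dx (test_laplacian ?\<psi>) * \<theta>))"
    by (simp add: euler_rhs_def dist_mult_def dist_dx_def dist_dy_def Let_def)
  have "((\<lambda>k. - (coef w k * pairing k (test_dy (test_dx ?\<psi> * \<theta>))) + - (coef v k * pairing k (test_dx (test_dy (test_laplacian ?\<psi>) * \<theta>)))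
      + coef w k * pairing k (test_dx (test_dy ?\<psi> * \<theta>)) + coef v k * pairing k (test_dy (test_dx (test_laplacian ?\<psi>) * \<theta>)))
      has_sum euler_rhs p1 p2 v w \<theta>) UNIV"
    unfolding rhs by (intro has_sum_add has_sum_uminusI dist_of_has_sum)
  moreover have "- (coef w k * pairing k (test_dy (test_dx ?\<psi> * \<theta>))) + - (coef v k * pairing k (test_dx (test_dy (test_laplacian ?\<psi>) * \<theta>)))
      + coef w k * pairing k (test_dx (test_dy ?\<psi> * \<theta>)) + coef v k * pairing k (test_dy (test_dx (test_laplacian ?\<psi>) * \<theta>))
      = c k * g k * t (k - p) - c k * g k * t (k + p)" (is "?l = _") for k
  proof -
    have "?l = - c k * (coef w k + of_int (norm_sq p) * coef v k) * (t (k + p) - t (k - p))"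
      unfolding pairing_dx pairing_dy pairing_mult_steady p_def[symmetric] t_def
      by (simp add: c_def cross_def p_def algebra_simps add_divide_distrib diff_divide_distrib)
    also have "c k * (coef w k + of_int (norm_sq p) * coef v k) = c k * g k"
    proof (cases "k = 0")
      case False
      then have n: "norm_sq k \<noteq> 0" using norm_sq_eq_0_iff by blast
      have "- of_int (norm_sq k) * coef v k = coef w k" using sf by (simp add: stream_function_iff)
      then have "of_int (norm_sq k) * coef v k = - coef w k" by (metis add.inverse_inverse mult_minus_left)
      then have "coef v k = - coef w k / of_int (norm_sq k)" using n by (metis nonzero_mult_div_cancel_left of_int_eq_0_iff)
      then have "coef w k + of_int (norm_sq p) * coef v k = g k"
        by (simp add: g_def rho_def algebra_simps)
      then show ?thesis by simp
    qed (simp add: c_def)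
    then have "- c k * (coef w k + of_int (norm_sq p) * coef v k) * (t (k + p) - t (k - p)) = - (c k * g k) * (t (k + p) - t (k - p))" by simp
    finally show ?thesis by (simp add: algebra_simps)
  qed
  ultimately have sum: "((\<lambda>k. c k * g k * t (k - p) - c k * g k * t (k + p)) has_sum euler_rhs p1 p2 v w \<theta>) UNIV" by simp
  have g2: "g \<in> ell2"
    unfolding g_def[abs_def]
    by (rule ell2_bounded_mult[OF coef_ell2, of _ "1 + of_int (norm_sq p)"]) (use rho_bounds(1) in auto)
  have ct: "(\<lambda>k. c k * t k) \<in> ell2"
  proof -
    have "c k * t k = (\<i> * of_int p1 / 2) * pairing k (test_dy \<theta>) + (- (\<i> * of_int p2 / 2)) * pairing k (test_dx \<theta>)" for k
      by (simp add: c_def t_def cross_def p_def pairing_dx pairing_dy algebra_simps diff_divide_distrib)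
    then show ?thesis
      using ell2_add[OF ell2_scale[OF pairing_ell2[of "test_dy \<theta>"], of "\<i> * of_int p1 / 2"]
          ell2_scale[OF pairing_ell2[of "test_dx \<theta>"], of "- (\<i> * of_int p2 / 2)"]]
      by (simp add: plus_fun_def)
  qed
  have inj: "inj (\<lambda>k. k + p)" "inj (\<lambda>k. k - p)" by (auto simp: inj_def)
  have cs: "c (k + p) = c k" "c (k - p) = c k" for k by (simp_all add: c_def)
  have bij: "bij (\<lambda>k. k + p)" "bij (\<lambda>k. k - p)"
    by (rule bij_betw_byWitness[of _ "\<lambda>k. k - p"]; auto) (rule bij_betw_byWitness[of _ "\<lambda>k. k + p"]; auto)
  have sm: "(\<lambda>k. g k * (c k * t (k - p))) summable_on UNIV" "(\<lambda>k. g k * (c k * t (k + p))) summable_on UNIV"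
    using ell2_product_summable[OF g2 ell2_comp_inj[OF ct inj(2)]] ell2_product_summable[OF g2 ell2_comp_inj[OF ct inj(1)]]
    by (simp_all add: cs)
  define U where "U = (\<Sum>\<^sub>\<infinity>k. g k * (c k * t (k - p)))"
  define V where "V = (\<Sum>\<^sub>\<infinity>k. g k * (c k * t (k + p)))"
  have UV: "((\<lambda>k. g k * (c k * t (k - p))) has_sum U) UNIV" "((\<lambda>k. g k * (c k * t (k + p))) has_sum V) UNIV"
    unfolding U_def V_def using sm by (auto intro: has_sum_infsum)
  have "((\<lambda>k. c k * g k * t (k - p) - c k * g k * t (k + p)) has_sum U + - V) UNIV"
    using has_sum_add[OF UV(1) has_sum_uminusI[OF UV(2)]] by (simp add: mult_ac)
  then have val: "euler_rhs p1 p2 v w \<theta> = U + - V" using has_sum_unique[OF sum] by simp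
  have "((\<lambda>k. g (k + p) * (c (k + p) * t (k + p - p))) has_sum U) UNIV"
    using has_sum_reindex_bij_betw[OF bij(1), of "\<lambda>k. g k * (c k * t (k - p))" U] UV(1) by simp
  moreover have "((\<lambda>k. g (k - p) * (c (k - p) * t (k - p + p))) has_sum V) UNIV"
    using has_sum_reindex_bij_betw[OF bij(2), of "\<lambda>k. g k * (c k * t (k + p))" V] UV(2) by simp
  ultimately have "((\<lambda>k. g (k + p) * (c k * t k) + - (g (k - p) * (c k * t k))) has_sum U + - V) UNIV"
    by (intro has_sum_add has_sum_uminusI) (simp_all add: cs)
  moreover have "g (k + p) * (c k * t k) + - (g (k - p) * (c k * t k)) = lat_op p (coef w) k * t k" for k
    by (simp add: lat_op_def g_def c_def algebra_simps)
  ultimately show ?thesis unfolding val t_def p_def by simp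
qed

lemma stream_function_exists:
  assumes "coef w 0 = 0"
  obtains v where "stream_function v w"
proof -
  have "(\<lambda>k. (- 1 / of_int (norm_sq k)) * coef w k) \<in> ell2"
  proof (rule ell2_bounded_mult[OF coef_ell2, of _ 1])
    fix k
    show "cmod (- 1 / of_int (norm_sq k)) \<le> 1"
    proof (cases "norm_sq k = 0")
      case False
      then have "norm_sq k \<ge> 1" using norm_sq_nonneg[of k] by linarith
      then show ?thesis by (simp add: norm_divide)
    qed simp
  qed
  then obtain v where v: "coef v = (\<lambda>k. (- 1 / of_int (norm_sq k)) * coef w k)" by (rule coef_surj)
  have "- of_int (norm_sq k) * coef v k = coef w k" for k
    using assms norm_sq_eq_0_iff[of k] by (cases "k = 0") (simp_all add: v)
  then show ?thesis using that stream_function_iff by blast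
qed

lemma euler_op_iff:
  "euler_op p1 p2 w h \<longleftrightarrow> coef w \<in> ell2_0 \<and> coef h \<in> ell2_0 \<and> coef h = lat_op (p1, p2) (coef w)"
proof
  assume "euler_op p1 p2 w h"
  then obtain v where mz: "mean_zero w" "mean_zero h" and v: "stream_function v w" "dist_of h = euler_rhs p1 p2 v w"
    by (auto simp: euler_op_def)
  have "lat_op (p1, p2) (coef w) = coef h"
    by (rule coef_unique) (use euler_rhs_has_sum[OF v(1)] v(2) in simp)
  then show "coef w \<in> ell2_0 \<and> coef h \<in> ell2_0 \<and> coef h = lat_op (p1, p2) (coef w)"
    using mz coef_ell2 by (simp add: ell2_0_def mean_zero_iff)
next
  assume a: "coef w \<in> ell2_0 \<and> coef h \<in> ell2_0 \<and> coef h = lat_op (p1, p2) (coef w)"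
  then have mz: "mean_zero w" "mean_zero h" by (auto simp: ell2_0_def mean_zero_iff)
  obtain v where v: "stream_function v w" using stream_function_exists mz(1) mean_zero_iff by blast
  have "dist_of h = euler_rhs p1 p2 v w"
    by (rule dist_of_eqI) (use euler_rhs_has_sum[OF v] a in simp)
  then show "euler_op p1 p2 w h" using mz v by (auto simp: euler_op_def)
qed

lemma euler_ker_iff: "w \<in> euler_ker p1 p2 \<mu> n \<longleftrightarrow> coef w \<in> seq.gen_ker (lat_op (p1, p2)) ell2_0 \<mu> n"
proof (induction n arbitrary: w)
  case 0
  have "w = 0 \<longleftrightarrow> coef w = 0" using coef_zero coef_inject[of w 0] by metis
  then show ?case unfolding euler_ker.simps seq.gen_ker.simps singleton_iff .
next
  case (Suc n)
  let ?L = "lat_op (p1, p2)"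
  have IH: "h - L2_scale \<mu> w \<in> euler_ker p1 p2 \<mu> n \<longleftrightarrow> coef h - seq_scale \<mu> (coef w) \<in> seq.gen_ker ?L ell2_0 \<mu> n" for h
    using Suc[of "h - L2_scale \<mu> w"] unfolding coef_diff coef_scale .
  show ?case
  proof
    assume "w \<in> euler_ker p1 p2 \<mu> (Suc n)"
    then show "coef w \<in> seq.gen_ker ?L ell2_0 \<mu> (Suc n)"
      using IH by (auto simp: euler_op_iff)
  next
    assume a: "coef w \<in> seq.gen_ker ?L ell2_0 \<mu> (Suc n)"
    then have H: "coef w \<in> ell2_0" "?L (coef w) \<in> ell2_0" by auto
    then obtain h where h: "coef h = ?L (coef w)" using coef_surj by (auto simp: ell2_0_def)
    have "euler_op p1 p2 w h" using H h by (simp add: euler_op_iff)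
    moreover have "h - L2_scale \<mu> w \<in> euler_ker p1 p2 \<mu> n" using a unfolding IH h by simp
    ultimately show "w \<in> euler_ker p1 p2 \<mu> (Suc n)" by auto
  qed
qed

lemma coef_generalised_eigenspace:
  "coef ` generalised_eigenspace p1 p2 \<mu> = seq.gen_eigenspace (lat_op (p1, p2)) ell2_0 \<mu>"
proof
  show "coef ` generalised_eigenspace p1 p2 \<mu> \<subseteq> seq.gen_eigenspace (lat_op (p1, p2)) ell2_0 \<mu>"
    unfolding generalised_eigenspace_def seq.gen_eigenspace_def using euler_ker_iff by blast
  show "seq.gen_eigenspace (lat_op (p1, p2)) ell2_0 \<mu> \<subseteq> coef ` generalised_eigenspace p1 p2 \<mu>"
  proof
    fix a assume "a \<in> seq.gen_eigenspace (lat_op (p1, p2)) ell2_0 \<mu>"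
    then obtain n where n: "a \<in> seq.gen_ker (lat_op (p1, p2)) ell2_0 \<mu> n"
      unfolding seq.gen_eigenspace_def by blast
    then have "a \<in> ell2"
      using seq.gen_ker_subset[OF lat_op_operator ell2_0_subspace] unfolding ell2_0_def by blast
    then obtain w where w: "coef w = a" by (rule coef_surj)
    then have "w \<in> generalised_eigenspace p1 p2 \<mu>"
      using n euler_ker_iff unfolding generalised_eigenspace_def by blast
    then show "a \<in> coef ` generalised_eigenspace p1 p2 \<mu>" using w by blast
  qed
qed

lemma inj_coef: "inj_on coef S"
  by (rule inj_onI) (rule coef_inject)

lemma algebraic_multiplicity_eq:
  "algebraic_multiplicity p1 p2 \<mu> = seq.dim (seq.gen_eigenspace (lat_op (p1, p2)) ell2_0 \<mu>)"
proof -
  let ?E = "generalised_eigenspace p1 p2 \<mu>"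
  obtain B where B: "B \<subseteq> ?E" "L2.independent B" "?E \<subseteq> L2.span B" "card B = L2.dim ?E"
    by (rule L2.basis_exists)
  note hom = coef_linear[unfolded linear_iff_module_hom]
  have ind: "seq.independent (coef ` B)"
    by (rule module_hom.independent_injective_image[OF hom B(2) inj_coef])
  have span: "coef ` ?E \<subseteq> seq.span (coef ` B)"
    unfolding module_hom.span_image[OF hom] by (rule image_mono[OF B(3)])
  have "seq.dim (coef ` ?E) = card (coef ` B)"
    by (rule seq.dim_unique[OF image_mono[OF B(1)] span ind refl])
  also have "\<dots> = L2.dim ?E"
    unfolding B(4)[symmetric] by (rule card_image[OF inj_coef])
  finally show ?thesis
    unfolding algebraic_multiplicity_def coef_generalised_eigenspace[symmetric] by (rule sym)
qed

lemma finite_multiplicityI: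
  assumes "finite b" "seq.gen_eigenspace (lat_op (p1, p2)) ell2_0 \<mu> \<subseteq> seq.span b"
  shows "finite_multiplicity p1 p2 \<mu>"
proof -
  obtain B where B: "B \<subseteq> generalised_eigenspace p1 p2 \<mu>" "L2.independent B" "generalised_eigenspace p1 p2 \<mu> \<subseteq> L2.span B"
    using L2.basis_exists[of "generalised_eigenspace p1 p2 \<mu>"] by metis
  have "seq.independent (coef ` B)"
    by (rule module_hom.independent_injective_image[OF coef_linear[unfolded linear_iff_module_hom] B(2) inj_coef])
  moreover have "coef ` B \<subseteq> seq.span b"
    using image_mono[OF B(1), of coef] assms(2) unfolding coef_generalised_eigenspace by (rule subset_trans)
  ultimately have "finite (coef ` B)" using seq.independent_span_bound[OF assms(1)] by blast
  then have "finite B" using inj_coef finite_imageD by blast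
  then show ?thesis using B(3) unfolding finite_multiplicity_def by blast
qed

lemma (in complex_vector_space) gen_ker_eigenvector:
  assumes "x \<in> gen_ker L H a n" "x \<noteq> 0" "0 \<in> H"
  shows "\<exists>e\<in>H. e \<noteq> 0 \<and> L e = a *c e"
  using assms(1,2)
proof (induction n arbitrary: x)
  case (Suc n)
  show ?case
  proof (cases "L x - a *c x = 0")
    case True
    then show ?thesis using Suc.prems by auto
  next
    case False
    then show ?thesis using Suc.IH[of "L x - a *c x"] Suc.prems(1) by simp
  qed
qed simp

lemma dist_of_scale: "dist_of (L2_scale c w) \<theta> = c * dist_of w \<theta>"
proof -
  have "((\<lambda>k. c * (coef w k * pairing k \<theta>)) has_sum c * dist_of w \<theta>) UNIV"
    by (rule has_sum_cmult_right[OF dist_of_has_sum])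
  then have "((\<lambda>k. coef (L2_scale c w) k * pairing k \<theta>) has_sum c * dist_of w \<theta>) UNIV"
    by (simp add: coef_scale mult.assoc)
  from has_sum_unique[OF dist_of_has_sum this] show ?thesis .
qed

lemma exp_has_vector_derivative:
  "((\<lambda>s. exp (a * complex_of_real s)) has_vector_derivative a * exp (a * of_real t)) (at t)"
proof -
  have "((\<lambda>s. a * complex_of_real s) has_vector_derivative a) (at t)"
    unfolding has_vector_derivative_def
    by (auto intro!: derivative_eq_intros simp: scaleR_conv_of_real algebra_simps)
  from field_vector_diff_chain_at[OF this DERIV_exp] show ?thesis by (simp add: o_def)
qed

text \<open>
  Evaluating a solution \<open>exp (\<mu> t) \<omega>\<close> at time \<open>0\<close> shows that \<open>\<omega>\<close> is an eigenvector; conversely each eigenvector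
  gives such a solution. A nonzero generalised eigenspace contains an eigenvector.
\<close>

lemma euler_eigenvalue_iff:
  "euler_eigenvalue p1 p2 \<mu> \<longleftrightarrow> seq.gen_eigenspace (lat_op (p1, p2)) ell2_0 \<mu> \<noteq> {0}"
proof
  let ?E = "seq.gen_eigenspace (lat_op (p1, p2)) ell2_0 \<mu>"
  assume "euler_eigenvalue p1 p2 \<mu>"
  then obtain w where w: "w \<noteq> 0" "euler_solution p1 p2 (\<lambda>t. L2_scale (exp (\<mu> * of_real t)) w)"
    by (auto simp: euler_eigenvalue_def)
  obtain v where v: "mean_zero w" "stream_function v w"
    "\<And>\<theta>. ((\<lambda>s. dist_of (L2_scale (exp (\<mu> * of_real s)) w) \<theta>) has_vector_derivative euler_rhs p1 p2 v w \<theta>) (at 0)"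
    using w(2) unfolding euler_solution_def by (auto dest!: spec[of _ 0])
  have "euler_rhs p1 p2 v w \<theta> = dist_of (L2_scale \<mu> w) \<theta>" for \<theta>
  proof -
    have "((\<lambda>s. exp (\<mu> * of_real s)) has_vector_derivative \<mu>) (at 0)"
      using exp_has_vector_derivative[of \<mu> 0] by simp
    from has_vector_derivative_mult_left[OF this, of "dist_of w \<theta>"]
    have "((\<lambda>s. dist_of (L2_scale (exp (\<mu> * of_real s)) w) \<theta>) has_vector_derivative \<mu> * dist_of w \<theta>) (at 0)"
      by (simp add: dist_of_scale)
    from vector_derivative_unique_at[OF v(3) this] show ?thesis by (simp add: dist_of_scale)
  qed
  then have d: "dist_of (L2_scale \<mu> w) = euler_rhs p1 p2 v w" by auto
  have "mean_zero (L2_scale \<mu> w)" using v(1) by (simp add: mean_zero_iff coef_scale)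
  then have "euler_op p1 p2 w (L2_scale \<mu> w)" using v d by (auto simp: euler_op_def)
  then have "coef w \<in> ell2_0" "lat_op (p1, p2) (coef w) = seq_scale \<mu> (coef w)" "seq_scale \<mu> (coef w) \<in> ell2_0"
    unfolding euler_op_iff coef_scale by metis+
  then have "coef w \<in> seq.gen_ker (lat_op (p1, p2)) ell2_0 \<mu> (Suc 0)"
    unfolding seq.gen_ker.simps by simp
  then have "coef w \<in> ?E" unfolding seq.gen_eigenspace_def by blast
  moreover have "coef w \<noteq> 0" using w(1) coef_inject[of w 0] coef_zero by auto
  ultimately show "?E \<noteq> {0}" by auto
next
  let ?E = "seq.gen_eigenspace (lat_op (p1, p2)) ell2_0 \<mu>"
  assume "?E \<noteq> {0}"
  then obtain x where "x \<in> ?E" "x \<noteq> 0"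
    using seq.subspace_0[OF seq.gen_eigenspace_subspace[OF lat_op_operator ell2_0_subspace, of "(p1, p2)" \<mu>]] by auto
  then obtain e where e: "e \<in> ell2_0" "e \<noteq> 0" "lat_op (p1, p2) e = seq_scale \<mu> e"
    using seq.gen_ker_eigenvector[of x "lat_op (p1, p2)" ell2_0 \<mu>] seq.subspace_0[OF ell2_0_subspace]
    unfolding seq.gen_eigenspace_def by blast
  then obtain w where w: "coef w = e" using coef_surj by (auto simp: ell2_0_def)
  have "w \<noteq> 0" using w e(2) coef_zero by auto
  moreover have "euler_solution p1 p2 (\<lambda>t. L2_scale (exp (\<mu> * of_real t)) w)"
    unfolding euler_solution_def
  proof (intro allI conjI)
    fix t :: real
    let ?w = "L2_scale (exp (\<mu> * of_real t)) w"
    have c: "coef ?w = seq_scale (exp (\<mu> * of_real t)) e" by (simp add: coef_scale w)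
    show "mean_zero ?w" using e(1) by (simp add: mean_zero_iff c ell2_0_def)
    then obtain v where v: "stream_function v ?w" using stream_function_exists mean_zero_iff by blast
    have "((\<lambda>s. dist_of (L2_scale (exp (\<mu> * of_real s)) w) \<theta>) has_vector_derivative euler_rhs p1 p2 v ?w \<theta>) (at t)" for \<theta>
    proof -
      have "lat_op (p1, p2) (coef ?w) = coef (L2_scale (\<mu> * exp (\<mu> * of_real t)) w)"
        unfolding c seq.operator_scale[OF lat_op_operator] e(3) coef_scale w by (simp add: fun_eq_iff)
      then have "euler_rhs p1 p2 v ?w \<theta> = dist_of (L2_scale (\<mu> * exp (\<mu> * of_real t)) w) \<theta>"
        using has_sum_unique[OF euler_rhs_has_sum[OF v]] dist_of_has_sum[of "L2_scale (\<mu> * exp (\<mu> * of_real t)) w" \<theta>] by metis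
      then show ?thesis
        using has_vector_derivative_mult_left[OF exp_has_vector_derivative[of \<mu> t], of "dist_of w \<theta>"] by (simp add: dist_of_scale)
    qed
    then show "\<exists>v. stream_function v ?w \<and> (\<forall>\<theta>. ((\<lambda>s. dist_of (L2_scale (exp (\<mu> * of_real s)) w) \<theta>) has_vector_derivative euler_rhs p1 p2 v ?w \<theta>) (at t))"
      using v by blast
  qed
  ultimately show "euler_eigenvalue p1 p2 \<mu>" unfolding euler_eigenvalue_def by blast
qed

section \<open>Counting the eigenvalues\<close>

text \<open>
  The flag of \<open>unstable_flag_exists\<close> gives the lower bound, restriction to the disk the upper bound.
\<close>

theorem half_plane_count:
  assumes cop: "coprime (fst p) (snd p)" and s: "\<bar>s\<bar> = (1 :: real)"
  defines "E \<equiv> seq.gen_eigenspace (lat_op p) ell2_0"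
  defines "A \<equiv> {a \<in> {a. s * Re a > 0}. E a \<noteq> {0}}"
  shows "finite A" and "\<And>a. s * Re a > 0 \<Longrightarrow> \<exists>b. finite b \<and> E a \<subseteq> seq.span b"
    and "(\<Sum>a\<in>A. seq.dim (E a)) = card (disk p)"
proof -
  let ?N = "card (disk p)"
  obtain y lam where y: "\<And>i. i < ?N \<Longrightarrow> y i \<in> ell2_0" "\<And>i. i < ?N \<Longrightarrow> lat_op p (y i) \<in> ell2_0"
    "\<And>i. i < ?N \<Longrightarrow> s * Re (lam i) > 0" "seq.triangular (lat_op p) y lam ?N"
    "seq.independent (y ` {..<?N})" "card (y ` {..<?N}) = ?N"
    using unstable_flag_exists[OF cop s] by blast
  define f where "f x = (\<lambda>k. if k \<in> disk p then x k else (0 :: complex))" for x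
  have f: "seq.operator f" by (rule seq.operatorI) (auto simp: f_def fun_eq_iff)
  have card: "card (delta ` disk p) \<le> ?N" by (rule card_image_le[OF finite_disk])
  have fin: "finite (delta ` disk p)" using finite_disk by simp
  have fspan: "f x \<in> seq.span (delta ` disk p)" for x
    unfolding span_delta[OF finite_disk] by (simp add: f_def)
  have inj: "x = 0" if "x \<in> seq.span (\<Union>a\<in>{a. s * Re a > 0}. seq.gen_eigenspace (lat_op p) ell2_0 a)" "f x = 0" for x
  proof (rule unstable_vanishing_on_disk[OF that(1)])
    show "x k = 0" if "k \<in> disk p" for k using fun_cong[OF \<open>f x = 0\<close>, of k] that by (simp add: f_def)
  qed
  have "y i \<in> seq.span (\<Union>a\<in>{a. s * Re a > 0}. seq.gen_eigenspace (lat_op p) ell2_0 a)" if "i < ?N" for i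
    by (rule seq.flag_in_gen_eigenspaces[OF lat_op_operator ell2_0_subspace y(4,1,2) _ that]) (use y(3) in auto)
  then have Y: "y ` {..<?N} \<subseteq> seq.span (\<Union>a\<in>{a. s * Re a > 0}. seq.gen_eigenspace (lat_op p) ell2_0 a)" by blast
  note count = seq.sum_dim_gen_eigenspaces[OF lat_op_operator ell2_0_subspace f fin card fspan inj y(5,6) Y]
  show "finite A" "(\<Sum>a\<in>A. seq.dim (E a)) = card (disk p)"
    using count(1,3) unfolding A_def E_def by blast+
  show "\<exists>b. finite b \<and> E a \<subseteq> seq.span b" if "s * Re a > 0" for a
    using count(2)[of a] that unfolding E_def by blast
qed

theorem theorem6p2:
  fixes p1 p2 :: int
  assumes "gcd p1 p2 = 1"
  shows "finite (nonimaginary_eigenvalues p1 p2) \<and>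
    (\<forall>\<mu> \<in> nonimaginary_eigenvalues p1 p2. finite_multiplicity p1 p2 \<mu>) \<and>
    (\<Sum>\<mu> \<in> nonimaginary_eigenvalues p1 p2. algebraic_multiplicity p1 p2 \<mu>) =
      2 * card {(a1 :: int, a2 :: int). 0 < a1\<^sup>2 + a2\<^sup>2 \<and> a1\<^sup>2 + a2\<^sup>2 < p1\<^sup>2 + p2\<^sup>2}"
proof -
  define p where "p = (p1, p2)"
  define E where "E = seq.gen_eigenspace (lat_op p) ell2_0"
  define A where "A s = {a \<in> {a. s * Re a > 0}. E a \<noteq> {0}}" for s :: real
  have cop: "coprime (fst p) (snd p)" using assms by (simp add: p_def coprime_iff_gcd_eq_1)
  have s: "\<bar>1 :: real\<bar> = 1" "\<bar>- 1 :: real\<bar> = 1" by auto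
  note plus = half_plane_count[OF cop s(1), folded E_def, folded A_def]
  note minus = half_plane_count[OF cop s(2), folded E_def, folded A_def]
  have union: "nonimaginary_eigenvalues p1 p2 = A 1 \<union> A (- 1)"
    unfolding nonimaginary_eigenvalues_def euler_eigenvalue_iff A_def E_def p_def by auto
  have disjoint: "A 1 \<inter> A (- 1) = {}" by (auto simp: A_def)
  have "finite_multiplicity p1 p2 \<mu>" if "\<mu> \<in> nonimaginary_eigenvalues p1 p2" for \<mu>
  proof -
    have "1 * Re \<mu> > 0 \<or> - 1 * Re \<mu> > 0" using that unfolding union A_def by auto
    then obtain b where "finite b" "E \<mu> \<subseteq> seq.span b" using plus(2) minus(2) by blast
    then show ?thesis unfolding E_def p_def by (rule finite_multiplicityI)
  qed
  moreover have "(\<Sum>\<mu> \<in> nonimaginary_eigenvalues p1 p2. algebraic_multiplicity p1 p2 \<mu>) = 2 * card (disk p)"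
  proof -
    have "(\<Sum>\<mu> \<in> nonimaginary_eigenvalues p1 p2. algebraic_multiplicity p1 p2 \<mu>) = (\<Sum>\<mu>\<in>A 1. seq.dim (E \<mu>)) + (\<Sum>\<mu>\<in>A (- 1). seq.dim (E \<mu>))"
      unfolding union algebraic_multiplicity_eq E_def p_def
      by (rule sum.union_disjoint) (use plus(1) minus(1) disjoint in auto)
    then show ?thesis using plus(3) minus(3) by simp
  qed
  moreover have "disk p = {(a1 :: int, a2 :: int). 0 < a1\<^sup>2 + a2\<^sup>2 \<and> a1\<^sup>2 + a2\<^sup>2 < p1\<^sup>2 + p2\<^sup>2}"
    by (auto simp: disk_def norm_sq_def p_def)
  ultimately show ?thesis using plus(1) minus(1) union by simp
qed

end
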